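(* Let $q$ be a power of an odd prime, let $d\ge 2$, and let $Q\in\mathbb F_q[x_1,\dots,x_d]$ be a non-degenerate quadratic form. For $E\subset\mathbb F_q^d$ and $r\in\mathbb F_q^*$ let $$W(r)=\#\Big\{(x,y,z,w)\in E^4:\ Q(z-w)\neq 0,\ \tfrac{Q(x-y)}{Q(z-w)}=r\Big\}.$$ Then: (i) If $d$ is even and $|E|\ge 4q^{d/2}$, then $W(r)\ge \frac{5|E|^4}{48q}$ for all $r\in\mathbb F_q^*$. Moreover, the threshold $d/2$ is sharp: for every such $q$ and every even $d\ge 2$ there exist $E\subset\mathbb F_q^d$ with $|E|=q^{d/2}$ and $r\in\mathbb F_q^*$ with $W(r)=0$. (ii) If $d$ is odd and $|E|\ge 3q^{d/2}$, then $W(r)\ge \frac{2|E|^4}{45q}$ for all non-zero squares $r\in\mathbb F_q^*$. Furthermore, the threshold $d/2$ cannot be lowered: for odd $d\ge 3$ there is no exponent $\gamma<d/2$ and constant $C>0$ such that for all odd prime powers $q$ and all $E\subset\mathbb F_q^d$ with $|E|\ge Cq^{\gamma}$ one has $W(r)>0$ for every non-zero square $r\in\mathbb F_q^*$. (iii) If $d$ is odd and $|E|\ge \frac{11}{6}q^{(d+1)/2}$, then $W(r)\ge \frac{2|E|^4}{363q}$ for all $r\in\mathbb F_q^*$. In addition, the threshold $(d+1)/2$ cannot be improved: for every such $q$ and every odd $d\ge 3$ there exist $E\subset\mathbb F_q^d$ with $|E|=q^{(d+1)/2}$ and $r\in\mathbb F_q^*$ with $W(r)=0$.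
   Context: A non-degenerate quadratic form is $Q(x)=x^{\top}Ax=\sum_{i,j}a_{ij}x_ix_j$ with $A$ a symmetric $d\times d$ matrix over $\mathbb F_q$ with $\det A\neq 0$. $|E|$ denotes cardinality; $\mathbb F_q^*=\mathbb F_q\setminus\{0\}$. *)

theory Defs
  imports "HOL-Algebra.Algebra" "HOL-Combinatorics.Permutations"
begin

definition odd_finite_field :: "'a ring \<Rightarrow> bool" where
  "odd_finite_field R \<longleftrightarrow> field R \<and> finite (carrier R) \<and> odd (card (carrier R))"

definition vecs :: "'a ring \<Rightarrow> nat \<Rightarrow> (nat \<Rightarrow> 'a) set" where
  "vecs R d = {..<d} \<rightarrow>\<^sub>E carrier R"

definition vsub :: "'a ring \<Rightarrow> nat \<Rightarrow> (nat \<Rightarrow> 'a) \<Rightarrow> (nat \<Rightarrow> 'a) \<Rightarrow> (nat \<Rightarrow> 'a)" where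
  "vsub R d x y = (\<lambda>i\<in>{..<d}. x i \<ominus>\<^bsub>R\<^esub> y i)"

definition qform :: "'a ring \<Rightarrow> nat \<Rightarrow> (nat \<Rightarrow> nat \<Rightarrow> 'a) \<Rightarrow> (nat \<Rightarrow> 'a) \<Rightarrow> 'a" where
  "qform R d A x = finsum R (\<lambda>i. finsum R (\<lambda>j. A i j \<otimes>\<^bsub>R\<^esub> x i \<otimes>\<^bsub>R\<^esub> x j) {..<d}) {..<d}"

definition mdet :: "'a ring \<Rightarrow> nat \<Rightarrow> (nat \<Rightarrow> nat \<Rightarrow> 'a) \<Rightarrow> 'a" where
  "mdet R d A = finsum R (\<lambda>p. (if evenperm p then \<one>\<^bsub>R\<^esub> else \<ominus>\<^bsub>R\<^esub> \<one>\<^bsub>R\<^esub>)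
      \<otimes>\<^bsub>R\<^esub> finprod R (\<lambda>i. A i (p i)) {..<d}) {p. p permutes {..<d}}"

definition nondeg_sym :: "'a ring \<Rightarrow> nat \<Rightarrow> (nat \<Rightarrow> nat \<Rightarrow> 'a) \<Rightarrow> bool" where
  "nondeg_sym R d A \<longleftrightarrow> (\<forall>i<d. \<forall>j<d. A i j \<in> carrier R \<and> A i j = A j i) \<and> mdet R d A \<noteq> \<zero>\<^bsub>R\<^esub>"

definition Wcount :: "'a ring \<Rightarrow> nat \<Rightarrow> (nat \<Rightarrow> nat \<Rightarrow> 'a) \<Rightarrow> (nat \<Rightarrow> 'a) set \<Rightarrow> 'a \<Rightarrow> nat" where
  "Wcount R d A E r = card {(x, y, z, w). x \<in> E \<and> y \<in> E \<and> z \<in> E \<and> w \<in> E \<and>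
      qform R d A (vsub R d z w) \<noteq> \<zero>\<^bsub>R\<^esub> \<and>
      qform R d A (vsub R d x y) \<otimes>\<^bsub>R\<^esub> inv\<^bsub>R\<^esub> (qform R d A (vsub R d z w)) = r}"

definition nonzero :: "'a ring \<Rightarrow> 'a set" where
  "nonzero R = carrier R - {\<zero>\<^bsub>R\<^esub>}"

definition nonzero_squares :: "'a ring \<Rightarrow> 'a set" where
  "nonzero_squares R = {r \<in> nonzero R. \<exists>s\<in>carrier R. s \<otimes>\<^bsub>R\<^esub> s = r}"

end

theory Submission
  imports Defs "Jordan_Normal_Form.Determinant" "HOL-Number_Theory.Residues" "HOL-Library.Function_Algebras"
begin

text \<open>Let \<open>\<nu>\<close> be the number of pairs of \<open>E\<close> at \<open>Q\<close>-distance 0 and \<open>N r\<close> the number of solutions of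
  \<open>Q (x - y) = r Q (z - w)\<close> in \<open>E\<close>, so that \<open>W r = N r - \<nu>\<^sup>2\<close>. With \<open>\<chi>\<close> a nontrivial additive character
  and \<open>T s\<close> the sum of \<open>\<chi> (s Q (x - y))\<close> over \<open>E \<times> E\<close>, orthogonality turns \<open>q \<nu>\<close> into the sum of \<open>T s\<close>, and
  \<open>q (N r)\<close> into the sum of \<open>T s\<close> times the conjugate of \<open>T (r s)\<close>. Fourier inversion with respect to the
  bilinear form of \<open>Q\<close> writes \<open>T s\<close> as the Gauss sum \<open>\<Gamma> s\<close> of \<open>Q\<close> times an average of \<open>\<chi> (- Q \<xi> / s)\<close> against
  the power spectrum of \<open>E\<close>. Orthogonal splitting shows that \<open>\<Gamma> (n s) = (- 1)\<^sup>d \<Gamma> s\<close> for a nonsquare \<open>n\<close>.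
  Hence, if \<open>d\<close> is even or \<open>r\<close> is a square, \<open>N r\<close> contains the square of the spectral mass on the
  isotropic cone, which for even \<open>d\<close> cancels the possibly dominant part of \<open>\<nu>\<^sup>2\<close>. If \<open>d\<close> is odd, the sign of
  \<open>\<Gamma>\<close> turns the sum over \<open>s\<close> defining \<open>\<nu>\<close> into a one-dimensional Gauss sum, which gains a factor
  \<open>sqrt q\<close> over the trivial bound. The sharpness examples are \<open>U + S v\<close> with \<open>U\<close> totally isotropic,
  \<open>v\<close> orthogonal to \<open>U\<close>, and \<open>S\<close> a set of scalars: there \<open>Q (x - y) = Q v (t - t')\<^sup>2\<close>, so all ratios are
  ratios of squared differences of \<open>S\<close>.\<close>

section \<open>Finite fields inside a commutative ring\<close>

text \<open>The unit \<open>e\<close> of the field is not assumed to be the unit of the ambient ring: this lets every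
  finite field be realised in one type (see \<open>all_crings\<close> below).\<close>

locale ffield =
  fixes F :: "'k::comm_ring_1 set" and e :: 'k
  assumes finite_F: "finite F"
    and F_0 [simp]: "0 \<in> F"
    and F_e [simp]: "e \<in> F"
    and F_add [simp]: "x \<in> F \<Longrightarrow> y \<in> F \<Longrightarrow> x + y \<in> F"
    and F_mult [simp]: "x \<in> F \<Longrightarrow> y \<in> F \<Longrightarrow> x * y \<in> F"
    and F_uminus [simp]: "x \<in> F \<Longrightarrow> - x \<in> F"
    and e_mult [simp]: "x \<in> F \<Longrightarrow> e * x = x"
    and e_neq_0 [simp]: "e \<noteq> 0"
    and F_inverse: "x \<in> F \<Longrightarrow> x \<noteq> 0 \<Longrightarrow> \<exists>y\<in>F. x * y = e"
    and odd_card_F: "odd (card F)"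
begin

lemma F_diff [simp]: "x \<in> F \<Longrightarrow> y \<in> F \<Longrightarrow> x - y \<in> F"
  using F_add[of x "- y"] by simp

lemma F_double [simp]: "x \<in> F \<Longrightarrow> 2 * x \<in> F"
  unfolding mult_2 by (rule F_add)

lemma F_pow [simp]: "x \<in> F \<Longrightarrow> x\<^sup>2 \<in> F"
  by (simp add: power2_eq_square)

lemma mult_e [simp]: "x \<in> F \<Longrightarrow> x * e = x"
  using e_mult[of x] by (simp add: mult.commute)

lemma F_no_zero_div: 
  assumes "x \<in> F" "y \<in> F" "x * y = 0" shows "x = 0 \<or> y = 0"
proof (rule ccontr)
  assume *: "\<not> (x = 0 \<or> y = 0)"
  then obtain z where z: "z \<in> F" "x * z = e" using F_inverse assms by auto
  have "y = (x * z) * y" using z assms by simp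
  also have "\<dots> = z * (x * y)" by (simp add: ac_simps)
  finally show False using assms * by simp
qed

lemma F_mult_eq_0 [simp]: "x \<in> F \<Longrightarrow> y \<in> F \<Longrightarrow> x * y = 0 \<longleftrightarrow> x = 0 \<or> y = 0"
  using F_no_zero_div by auto

lemma F_cancel: "x \<in> F \<Longrightarrow> y \<in> F \<Longrightarrow> z \<in> F \<Longrightarrow> x \<noteq> 0 \<Longrightarrow> x * y = x * z \<longleftrightarrow> y = z"
  using F_no_zero_div[of x "y - z"] by (auto simp: algebra_simps)

lemma card_F_ge_3: "3 \<le> card F"
proof -
  have "card {0, e} \<le> card F" using finite_F by (intro card_mono) auto
  moreover have "card {0,e} = 2" using e_neq_0 by (metis card_2_iff)
  ultimately show ?thesis using odd_card_F by (cases "card F = 2") auto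
qed

lemma sum_F_translate: 
  assumes "a \<in> F" shows "(\<Sum>x\<in>F. h (x + a)) = (\<Sum>x\<in>F. h x)"
  by (rule sum.reindex_bij_witness[of _ "\<lambda>x. x - a" "\<lambda>x. x + a"]) (use assms in auto)

text \<open>Translation by \<open>e\<close> permutes \<open>F\<close>, so comparing the two sums
  over \<open>F\<close> shows that \<open>card F\<close> times \<open>e\<close> vanishes; as
  \<open>card F\<close> is odd, \<open>e + e = 0\<close> would leave \<open>e = 0\<close>.\<close>

lemma two_e_neq_0: "e + e \<noteq> 0"
proof
  assume 2: "e + e = 0"
  have "(\<Sum>x\<in>F. x + e) = (\<Sum>x\<in>F. x)" using sum_F_translate[of e "\<lambda>x. x"] by simp
  then have "of_nat (card F) * e = 0" by (simp add: sum.distrib)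
  moreover obtain k where "card F = 2 * k + 1" using odd_card_F oddE by blast
  ultimately have "of_nat k * (e + e) + e = 0" by (simp add: algebra_simps)
  then show False using 2 by simp
qed

lemma double_eq_0: assumes "x \<in> F" "x + x = 0" shows "x = 0"
proof -
  have "(e + e) * x = e * x + e * x" by (rule distrib_right)
  then have "(e + e) * x = 0" using assms by simp
  then show ?thesis using F_no_zero_div[OF F_add[OF F_e F_e] assms(1)] two_e_neq_0 by blast
qed

definition iv :: "'k \<Rightarrow> 'k" where
  "iv x = (SOME y. y \<in> F \<and> x * y = e)"

lemma iv: assumes "x \<in> F" "x \<noteq> 0" shows iv_in [simp]: "iv x \<in> F" and mult_iv [simp]: "x * iv x = e"
proof -
  have "\<exists>y. y \<in> F \<and> x * y = e" using F_inverse assms by auto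
  from someI_ex[OF this] show "iv x \<in> F" "x * iv x = e" unfolding iv_def by auto
qed

lemma iv_mult [simp]: "x \<in> F \<Longrightarrow> x \<noteq> 0 \<Longrightarrow> iv x * x = e"
  using mult_iv by (simp add: mult.commute)

lemma iv_neq_0 [simp]: "x \<in> F \<Longrightarrow> x \<noteq> 0 \<Longrightarrow> iv x \<noteq> 0"
  by (metis e_neq_0 mult_iv mult_zero_right)

lemma iv_unique: "x \<in> F \<Longrightarrow> y \<in> F \<Longrightarrow> x * y = e \<Longrightarrow> iv x = y"
  by (metis F_cancel e_neq_0 iv_in mult_iv mult_zero_left)

lemma iv_iv [simp]: "x \<in> F \<Longrightarrow> x \<noteq> 0 \<Longrightarrow> iv (iv x) = x"
  by (rule iv_unique) auto

lemma iv_prod: "x \<in> F \<Longrightarrow> x \<noteq> 0 \<Longrightarrow> y \<in> F \<Longrightarrow> y \<noteq> 0 \<Longrightarrow> iv (x * y) = iv x * iv y"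
proof (rule iv_unique)
  assume *: "x \<in> F" "x \<noteq> 0" "y \<in> F" "y \<noteq> 0"
  have "x * y * (iv x * iv y) = (x * iv x) * (y * iv y)" by (simp only: ac_simps)
  then show "x * y * (iv x * iv y) = e" using * by simp
qed auto

lemma F_sq_eq: assumes "x \<in> F" "y \<in> F" "x\<^sup>2 = y\<^sup>2" shows "x = y \<or> x = - y"
proof -
  have "(x - y) * (x + y) = 0" using assms by (simp add: algebra_simps power2_eq_square)
  then have "x - y = 0 \<or> x + y = 0" using assms F_no_zero_div[of "x - y" "x + y"] by simp
  then show ?thesis by (auto simp: eq_neg_iff_add_eq_0)
qed

section \<open>Square classes of the multiplicative group\<close>

abbreviation "Fs \<equiv> F - {0}"

text \<open>Zero is excluded, so that this is the index-two subgroup of squares in the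
  multiplicative group.\<close>

definition "squares = (\<lambda>u. u\<^sup>2) ` Fs"

lemma finite_Fs: "finite Fs" using finite_F by simp

lemma squares_subset: "squares \<subseteq> Fs"
  by (auto simp: squares_def power2_eq_square)

lemma card_sqrt: 
  assumes "s \<in> squares" shows "card {u\<in>Fs. u\<^sup>2 = s} = 2"
proof -
  obtain w where w: "w \<in> Fs" "s = w\<^sup>2" using assms by (auto simp: squares_def)
  have "{u\<in>Fs. u\<^sup>2 = s} = {w, - w}" using w F_sq_eq by auto
  moreover have "w \<noteq> - w" using w double_eq_0[of w] by (auto simp: eq_neg_iff_add_eq_0)
  ultimately show ?thesis by simp
qed

lemma sum_squares_param:
  fixes h :: "'k \<Rightarrow> 'b::comm_semiring_1"
  shows "(\<Sum>u\<in>Fs. h (u\<^sup>2)) = 2 * (\<Sum>s\<in>squares. h s)"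
proof -
  have "(\<Sum>u\<in>Fs. h (u\<^sup>2)) = (\<Sum>s\<in>squares. \<Sum>u\<in>{u\<in>Fs. u\<^sup>2 = s}. h (u\<^sup>2))"
    unfolding squares_def using finite_Fs by (rule sum.image_gen)
  also have "\<dots> = (\<Sum>s\<in>squares. 2 * h s)"
  proof (rule sum.cong)
    fix s assume "s \<in> squares"
    have "(\<Sum>u\<in>{u\<in>Fs. u\<^sup>2 = s}. h (u\<^sup>2)) = (\<Sum>u\<in>{u\<in>Fs. u\<^sup>2 = s}. h s)" by (rule sum.cong) auto
    then show "(\<Sum>u\<in>{u\<in>Fs. u\<^sup>2 = s}. h (u\<^sup>2)) = 2 * h s"
      using card_sqrt[OF \<open>s \<in> squares\<close>] by (simp only: sum_constant of_nat_numeral)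
  qed simp
  finally show ?thesis by (simp add: sum_distrib_left)
qed

lemma card_squares: "2 * card squares = card F - 1"
  using sum_squares_param[of "\<lambda>_. 1::nat"] finite_F by simp

lemma ex_nonsquare: "\<exists>n\<in>Fs. n \<notin> squares"
proof (rule ccontr)
  assume "\<not> ?thesis"
  then have "squares = Fs" using squares_subset by auto
  then have "2 * (card F - 1) = card F - 1" using card_squares finite_F by simp
  then show False using card_F_ge_3 by simp
qed

text \<open>Otherwise \<open>n\<close> would be the square of \<open>x * iv y\<close>. This is the
  obstruction behind the sharpness examples with a nonsquare ratio.\<close>

lemma nonsquare_not_ratio:
  assumes "n \<in> Fs" "n \<notin> squares" "x \<in> F" "y \<in> F" "y \<noteq> 0"
  shows "x\<^sup>2 \<noteq> n * y\<^sup>2"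
proof
  assume eq: "x\<^sup>2 = n * y\<^sup>2"
  have y: "y\<^sup>2 \<in> Fs" using assms by (auto simp: power2_eq_square)
  have "n = n * (y * iv y)\<^sup>2" using assms by (simp add: power2_eq_square)
  also have "\<dots> = (n * y\<^sup>2) * (iv y)\<^sup>2" by (simp only: power_mult_distrib ac_simps)
  also have "\<dots> = (x * iv y)\<^sup>2" using eq by (simp add: power_mult_distrib)
  finally have n: "n = (x * iv y)\<^sup>2" .
  then have "x \<noteq> 0" using assms by auto
  then have "n \<in> squares" unfolding squares_def using n assms by (intro image_eqI[of _ _ "x * iv y"]) auto
  then show False using assms by simp
qed

text \<open>Multiplication by \<open>n\<close> sends squares injectively to nonsquares, and each
  class fills half of \<open>Fs\<close>, so counting upgrades the inclusion to equality.\<close>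

lemma nonsquares_eq:
  assumes n: "n \<in> Fs" "n \<notin> squares"
  shows "Fs - squares = (\<lambda>s. n * s) ` squares" "inj_on (\<lambda>s. n * s) squares"
proof -
  show inj: "inj_on (\<lambda>s. n * s) squares"
    using F_cancel[of n] n squares_subset by (auto simp: inj_on_def)
  have fin: "finite squares" using squares_subset finite_Fs finite_subset by blast
  have disj: "n * s \<notin> squares" if "s \<in> squares" for s
  proof
    assume "n * s \<in> squares"
    then obtain u where "u \<in> Fs" "n * s = u\<^sup>2" unfolding squares_def by (rule imageE)
    moreover obtain w where "w \<in> Fs" "s = w\<^sup>2" using \<open>s \<in> squares\<close> unfolding squares_def by blast
    ultimately have u: "u \<in> Fs" "n * w\<^sup>2 = u\<^sup>2" "w \<in> Fs" by simp_all
    then show False using nonsquare_not_ratio[OF n, of u w] by simp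
  qed
  have "(\<lambda>s. n * s) ` squares \<subseteq> Fs - squares" using disj n squares_subset by auto
  moreover have "card (Fs - squares) = card ((\<lambda>s. n * s) ` squares)"
  proof -
    have "card (Fs - squares) = card Fs - card squares" 
      using squares_subset fin by (simp add: card_Diff_subset)
    also have "\<dots> = card squares" using card_squares finite_F by simp
    finally show ?thesis using inj by (simp add: card_image)
  qed
  ultimately show "Fs - squares = (\<lambda>s. n * s) ` squares"
    using finite_Fs by (metis card_subset_eq finite_Diff)
qed

text \<open>As \<open>u\<close> runs over \<open>Fs\<close>, \<open>u\<^sup>2\<close> covers the
  squares twice and \<open>n * u\<^sup>2\<close> the nonsquares twice. This trades sums over all
  scalars for sums of quadratic phases.\<close>

lemma sum_square_classes:
  fixes h :: "'k \<Rightarrow> 'b::comm_semiring_1"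
  assumes n: "n \<in> Fs" "n \<notin> squares"
  shows "(\<Sum>u\<in>Fs. h (u\<^sup>2)) + (\<Sum>u\<in>Fs. h (n * u\<^sup>2)) = 2 * (\<Sum>s\<in>Fs. h s)"
proof -
  have "(\<Sum>u\<in>Fs. h (n * u\<^sup>2)) = 2 * (\<Sum>s\<in>squares. h (n * s))"
    by (rule sum_squares_param)
  also have "(\<Sum>s\<in>squares. h (n * s)) = (\<Sum>s\<in>Fs - squares. h s)"
    using nonsquares_eq[OF n] by (simp add: sum.reindex)
  finally show ?thesis 
    using sum.subset_diff[OF squares_subset finite_Fs, of h] sum_squares_param[of h] 
    by (simp add: algebra_simps)
qed

lemma sum_Fs_mult: 
  assumes "a \<in> Fs" shows "(\<Sum>s\<in>Fs. h (a * s)) = (\<Sum>s\<in>Fs. h s)"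
proof (rule sum.reindex_bij_witness[of _ "\<lambda>x. iv a * x" "\<lambda>x. a * x"])
  fix x assume x: "x \<in> Fs"
  show "iv a * (a * x) = x" "a * (iv a * x) = x" using assms x by (simp_all flip: mult.assoc)
qed (use assms in auto)

lemma sum_Fs_iv: "(\<Sum>s\<in>Fs. h (iv s)) = (\<Sum>s\<in>Fs. h s)"
  by (rule sum.reindex_bij_witness[of _ iv iv]) auto

text \<open>Pigeonhole: the values of \<open>a * x\<^sup>2\<close> and of
  \<open>c - b * y\<^sup>2\<close> each fill \<open>(card F + 1) / 2\<close> elements of
  \<open>F\<close>, so the two sets meet.\<close>

lemma represent_by_binary:
  assumes "a \<in> Fs" "b \<in> Fs" "c \<in> F"
  shows "\<exists>x\<in>F. \<exists>y\<in>F. a * x\<^sup>2 + b * y\<^sup>2 = c"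
proof -
  let ?S = "insert 0 squares"
  let ?X = "(\<lambda>s. a * s) ` ?S" and ?Y = "(\<lambda>s. c - b * s) ` ?S"
  have SF: "?S \<subseteq> F" using squares_subset by auto
  have fin: "finite ?S" using SF finite_F by (rule finite_subset)
  have cS: "2 * card ?S = card F + 1" 
    using card_squares card_F_ge_3 fin squares_subset by (subst card_insert_disjoint) auto
  have "card ?X = card ?S" using SF F_cancel[of a] assms by (intro card_image) (auto simp: inj_on_def)
  moreover have "card ?Y = card ?S" using SF F_cancel[of b] assms by (intro card_image) (auto simp: inj_on_def)
  moreover have "card (?X \<union> ?Y) \<le> card F" using SF assms finite_F by (intro card_mono) auto
  ultimately have "?X \<inter> ?Y \<noteq> {}" 
    using card_Un_disjoint[of ?X ?Y] fin cS by fastforce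
  then obtain s t where st: "s \<in> ?S" "t \<in> ?S" "a * s = c - b * t" by blast
  have "\<exists>u\<in>F. s = u\<^sup>2" if "s \<in> ?S" for s
  proof -
    have "s = 0 \<or> s \<in> squares" using that by simp
    then show ?thesis using F_0 unfolding squares_def by (metis (no_types, lifting) Diff_iff imageE zero_power2)
  qed
  then obtain x y where "x \<in> F" "y \<in> F" "s = x\<^sup>2" "t = y\<^sup>2" using st by metis
  then show ?thesis using st by (intro bexI[of _ x] bexI[of _ y]) (auto simp: algebra_simps)
qed

end

section \<open>Additive characters\<close>

definition add_subgroup :: "'k::ab_group_add set \<Rightarrow> bool" where
  "add_subgroup H \<longleftrightarrow> 0 \<in> H \<and> (\<forall>x\<in>H. \<forall>y\<in>H. x - y \<in> H)"

lemma add_subgroup_uminus: "add_subgroup H \<Longrightarrow> x \<in> H \<Longrightarrow> - x \<in> H"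
  unfolding add_subgroup_def by (metis diff_0)

lemma add_subgroup_add: "add_subgroup H \<Longrightarrow> x \<in> H \<Longrightarrow> y \<in> H \<Longrightarrow> x + y \<in> H"
  using add_subgroup_uminus[of H y] unfolding add_subgroup_def by (metis diff_minus_eq_add)

lemma add_subgroup_of_int:
  fixes x :: "'k::comm_ring_1"
  assumes H: "add_subgroup H" and x: "x \<in> H"
  shows "of_int k * x \<in> H"
proof (induction k rule: int_induct[where k = 0])
  case base
  then show ?case using H by (simp add: add_subgroup_def)
next
  case (step1 i)
  then show ?case using add_subgroup_add[OF H _ x, of "of_int i * x"] by (simp add: distrib_right)
next
  case (step2 i)
  then show ?case using H x by (simp add: left_diff_distrib add_subgroup_def)
qed

lemma (in ffield) F_add_subgroup: "add_subgroup F"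
  by (simp add: add_subgroup_def)

lemma ex_maximal_subgroup:
  assumes G: "finite G" "add_subgroup G" "G \<noteq> {0}"
  obtains H where "add_subgroup H" "H \<subset> G" "\<And>K. add_subgroup K \<Longrightarrow> H \<subset> K \<Longrightarrow> K \<subseteq> G \<Longrightarrow> K = G"
proof -
  let ?\<H> = "{H. add_subgroup H \<and> H \<subset> G}"
  have "{0} \<in> ?\<H>" using G by (auto simp: add_subgroup_def)
  moreover have "finite ?\<H>" by (rule finite_subset[of _ "Pow G"]) (use G in auto)
  ultimately obtain H where "H \<in> ?\<H>" and max: "\<And>K. K \<in> ?\<H> \<Longrightarrow> H \<subseteq> K \<Longrightarrow> H = K"
    using finite_has_maximal[of ?\<H>] by (metis (lifting) equals0D)
  then show ?thesis using that[of H] by blast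
qed

text \<open>Choose a maximal proper subgroup \<open>H\<close> and \<open>g\<close> in
  \<open>G\<close> outside it. By maximality \<open>G\<close> is \<open>H\<close> plus the integer
  multiples of \<open>g\<close>. If \<open>m\<close> is the order of \<open>g\<close> modulo
  \<open>H\<close>, sending \<open>h + k g\<close> to the \<open>k\<close>-th power of a primitive
  \<open>m\<close>-th root of unity gives the character.\<close>

lemma ex_nontrivial_character:
  fixes G :: "'k::comm_ring_1 set"
  assumes G: "finite G" "add_subgroup G" "G \<noteq> {0}"
  shows "\<exists>\<chi> :: 'k \<Rightarrow> complex. (\<forall>x\<in>G. \<forall>y\<in>G. \<chi> (x + y) = \<chi> x * \<chi> y) \<and> (\<forall>x\<in>G. norm (\<chi> x) = 1) 
           \<and> (\<exists>x\<in>G. \<chi> x \<noteq> 1)"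
proof -
  obtain H where H: "add_subgroup H" "H \<subset> G" 
    and max: "\<And>K. add_subgroup K \<Longrightarrow> H \<subset> K \<Longrightarrow> K \<subseteq> G \<Longrightarrow> K = G"
    using ex_maximal_subgroup[OF G] by blast
  obtain g where g: "g \<in> G" "g \<notin> H" using H by auto
  have multG: "of_int k * g \<in> G" for k :: int using add_subgroup_of_int G g by blast
  \<comment> \<open>Finiteness of \<open>G\<close> forces two multiples of \<open>g\<close> to
    coincide, so some positive multiple of \<open>g\<close> is 0 and lies in
    \<open>H\<close>.\<close>
  have "\<not> inj (\<lambda>k::nat. of_int (int k) * g)"
  proof
    assume inj: "inj (\<lambda>k::nat. of_int (int k) * g)"
    have "range (\<lambda>k::nat. of_int (int k) * g) \<subseteq> G" using multG by blast
    then have "finite (range (\<lambda>k::nat. of_int (int k) * g))" using G(1) by (rule finite_subset)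
    then show False using inj finite_imageD infinite_UNIV_nat by blast
  qed
  then obtain i j :: nat where "i < j" "of_int (int i) * g = of_int (int j) * g"
    unfolding inj_def by (metis (no_types) linorder_neqE_nat)
  then have "of_nat (j - i) * g = 0" by (simp add: of_nat_diff algebra_simps)
  then have ex: "\<exists>m>0. of_nat m * g \<in> H" using \<open>i < j\<close> H(1) 
    by (intro exI[of _ "j - i"]) (auto simp: add_subgroup_def)
  define m where "m = (LEAST m. m > 0 \<and> of_nat m * g \<in> H)"
  have m: "m > 0" "of_nat m * g \<in> H" using LeastI_ex[OF ex] by (auto simp: m_def)
  have m_least: "m \<le> k" if "k > 0" "of_nat k * g \<in> H" for k using that by (auto simp: m_def intro: Least_le)
  \<comment> \<open>Division with remainder: a nonzero remainder would be a positive number below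
    \<open>m\<close> whose multiple of \<open>g\<close> lies in \<open>H\<close>.\<close>
  have dvd: "int m dvd k" if "of_int k * g \<in> H" for k
  proof -
    have "of_int (k mod int m) * g = of_int k * g - of_int (k div int m) * (of_nat m * g)"
    proof -
      have "(of_int k :: 'k) = of_int (k div int m * int m + k mod int m)" by simp
      then have "(of_int k :: 'k) = of_int (k div int m) * of_nat m + of_int (k mod int m)"
        by (simp only: of_int_add of_int_mult of_int_of_nat_eq)
      then show ?thesis by (simp add: algebra_simps)
    qed
    then have *: "of_int (k mod int m) * g \<in> H"
      using that add_subgroup_of_int[OF H(1) m(2)] H(1) by (auto simp: add_subgroup_def)
    have "k mod int m \<ge> 0" "k mod int m < int m" using m by auto
    then have "k mod int m = 0" using m_least[of "nat (k mod int m)"] * 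
      by (cases "k mod int m = 0") (auto simp: of_nat_nat)
    then show ?thesis by auto
  qed
  define K where "K = {x\<in>G. \<exists>k::int. x - of_int k * g \<in> H}"
  have "add_subgroup K" unfolding add_subgroup_def
  proof (intro conjI ballI)
    show "0 \<in> K" using G H(1) by (auto simp: K_def add_subgroup_def intro: exI[of _ 0])
    fix x y assume "x \<in> K" "y \<in> K"
    then obtain k l where "x \<in> G" "y \<in> G" "x - of_int k * g \<in> H" "y - of_int l * g \<in> H" by (auto simp: K_def)
    moreover have "(x - y) - of_int (k - l) * g = (x - of_int k * g) - (y - of_int l * g)"
      by (simp add: algebra_simps)
    ultimately have "x - y \<in> G" "(x - y) - of_int (k - l) * g \<in> H"
      using H(1) G(2) unfolding add_subgroup_def by metis+
    then show "x - y \<in> K" unfolding K_def by blast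
  qed
  moreover have "H \<subseteq> K" using H by (auto simp: K_def intro!: exI[of _ 0])
  moreover have "g \<in> K" using g H(1) by (auto simp: K_def add_subgroup_def intro!: exI[of _ 1])
  ultimately have KG: "K = G" using g by (intro max) (auto simp: K_def)
  define \<chi> where "\<chi> x = cis (2 * pi * of_int (SOME k. x - of_int k * g \<in> H) / m)" for x
  \<comment> \<open>The choice of \<open>k\<close> is immaterial: two admissible values differ by a
    multiple of \<open>m\<close>, which changes the angle by full turns.\<close>
  have \<chi>: "\<chi> x = cis (2 * pi * of_int k / m)" if "x - of_int k * g \<in> H" for x k
  proof -
    define l where "l = (SOME k. x - of_int k * g \<in> H)"
    have "x - of_int l * g \<in> H" unfolding l_def using that by (rule someI)
    then have "(x - of_int k * g) - (x - of_int l * g) \<in> H" using that H(1) unfolding add_subgroup_def by blast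
    then have "of_int (l - k) * g \<in> H" by (simp add: algebra_simps)
    then obtain c where "l - k = int m * c" using dvd[of "l - k"] unfolding dvd_def by blast
    then have "l = k + int m * c" by simp
    then have "2 * pi * of_int l / m = 2 * pi * of_int k / m + 2 * pi * of_int c" 
      using m by (simp add: field_simps)
    then have "cis (2 * pi * of_int l / m) = cis (2 * pi * of_int k / m) * cis (2 * pi * of_int c)"
      by (simp only: cis_mult)
    also have "cis (2 * pi * of_int c) = 1" by simp
    finally show ?thesis unfolding \<chi>_def l_def by simp
  qed
  have "\<chi> (x + y) = \<chi> x * \<chi> y" if "x \<in> G" "y \<in> G" for x y
  proof -
    have "x \<in> K" "y \<in> K" using that KG by simp_all
    then obtain k l where kl: "x - of_int k * g \<in> H" "y - of_int l * g \<in> H" unfolding K_def by blast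
    moreover have "(x + y) - of_int (k + l) * g = (x - of_int k * g) + (y - of_int l * g)"
      by (simp add: algebra_simps)
    ultimately have "(x + y) - of_int (k + l) * g \<in> H" using add_subgroup_add[OF H(1)] by metis
    from \<chi>[OF this] \<chi>[OF kl(1)] \<chi>[OF kl(2)] show ?thesis
      by (simp add: cis_mult add_divide_distrib distrib_left)
  qed
  \<comment> \<open>Triviality at \<open>g\<close> would make \<open>m\<close> divide 1, but
    \<open>m = 1\<close> would put \<open>g\<close> into \<open>H\<close>.\<close>
  moreover have "\<chi> g \<noteq> 1"
  proof
    have "m \<noteq> 1" using m g by auto
    then have m2: "m \<ge> 2" using m by simp
    have "g - of_int 1 * g \<in> H" using H(1) by (simp add: add_subgroup_def)
    from \<chi>[OF this] have "\<chi> g = cis (2 * pi / m)" by simp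
    moreover assume "\<chi> g = 1"
    ultimately have "cos (2 * pi / m) = 1" by (metis cis.sel(1) one_complex.sel(1))
    then obtain n :: int where "2 * pi / m = n * 2 * pi" using cos_one_2pi_int by auto
    then have "1 = of_int n * real m" using m by (simp add: field_simps)
    then have "1 = n * int m" by (metis of_int_1 of_int_eq_iff of_int_mult of_int_of_nat_eq)
    then have "int m dvd 1" by (metis dvd_triv_right)
    then show False using m2 by simp
  qed
  ultimately show ?thesis using g by (intro exI[of _ \<chi>]) (auto simp: \<chi>_def)
qed

section \<open>Quadratic spaces and totally isotropic subspaces\<close>

text \<open>Linearity of \<open>sm\<close> and \<open>B\<close> is required on the whole type, and
  only closure and the action of \<open>e\<close> on \<open>V\<close>, which keeps membership
  conditions out of the algebra. That \<open>e\<close> acts as the identity is asked on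
  \<open>V\<close> alone because \<open>e\<close> need not be the ambient unit.\<close>

locale bspace = ffield F e for F :: "'k::comm_ring_1 set" and e +
  fixes V :: "'v::ab_group_add set" and sm :: "'k \<Rightarrow> 'v \<Rightarrow> 'v" and B :: "'v \<Rightarrow> 'v \<Rightarrow> 'k"
  assumes finite_V: "finite V"
    and V_0 [simp]: "0 \<in> V"
    and V_add [simp]: "x \<in> V \<Longrightarrow> y \<in> V \<Longrightarrow> x + y \<in> V"
    and V_sm [simp]: "c \<in> F \<Longrightarrow> x \<in> V \<Longrightarrow> sm c x \<in> V"
    and sm_add: "sm c (x + y) = sm c x + sm c y"
    and sm_add_left: "sm (c + c') x = sm c x + sm c' x"
    and sm_sm: "sm c (sm c' x) = sm (c * c') x"
    and sm_e [simp]: "x \<in> V \<Longrightarrow> sm e x = x"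
    and B_in [simp]: "x \<in> V \<Longrightarrow> y \<in> V \<Longrightarrow> B x y \<in> F"
    and B_sym: "B x y = B y x"
    and B_add: "B (x + y) z = B x z + B y z"
    and B_sm: "B (sm c x) y = c * B x y"
begin

lemma sm_0_left [simp]: "sm 0 x = 0" using sm_add_left[of 0 0 x] by simp
lemma sm_0_right [simp]: "sm c 0 = 0" using sm_add[of c 0 0] by simp
lemma sm_uminus_left: "sm (- c) x = - sm c x" 
  using sm_add_left[of "- c" c x] by (simp add: eq_neg_iff_add_eq_0)
lemma sm_diff_left: "sm (c - c') x = sm c x - sm c' x" 
  using sm_add_left[of c "- c'" x] by (simp add: sm_uminus_left)
lemma V_uminus [simp]: "x \<in> V \<Longrightarrow> - x \<in> V"
  using V_sm[of "- e" x] by (simp add: sm_uminus_left)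
lemma V_diff [simp]: "x \<in> V \<Longrightarrow> y \<in> V \<Longrightarrow> x - y \<in> V"
  using V_add[of x "- y"] by simp
lemma B_0_left [simp]: "B 0 y = 0" using B_add[of 0 0 y] by simp
lemma B_0_right [simp]: "B y 0 = 0" using B_sym[of y 0] by simp
lemma B_uminus: "B (- x) y = - B x y" 
  using B_add[of "- x" x y] by (simp add: eq_neg_iff_add_eq_0)
lemma B_diff: "B (x - y) z = B x z - B y z" using B_add[of x "- y" z] by (simp add: B_uminus)
lemma B_add_right: "B z (x + y) = B z x + B z y" using B_add[of x y z] by (simp add: B_sym)
lemma B_diff_right: "B z (x - y) = B z x - B z y" using B_diff[of x y z] by (simp add: B_sym)
lemma B_uminus_right: "B x (- y) = - B x y" using B_uminus[of y x] by (simp add: B_sym)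
lemma B_sm_right: "B x (sm c y) = c * B x y" using B_sm[of c y x] by (simp add: B_sym)

lemmas B_lin = B_add B_diff B_uminus B_sm B_add_right B_diff_right B_uminus_right B_sm_right

definition Q :: "'v \<Rightarrow> 'k" where "Q x = B x x"

lemma Q_in [simp]: "x \<in> V \<Longrightarrow> Q x \<in> F" by (simp add: Q_def)
lemma Q_0 [simp]: "Q 0 = 0" by (simp add: Q_def)
lemma Q_add: "Q (x + y) = Q x + Q y + (B x y + B x y)"
  by (simp add: Q_def B_lin B_sym[of y x])
lemma Q_diff: "Q (x - y) = Q x + Q y - (B x y + B x y)"
  by (simp add: Q_def B_lin B_sym[of y x])
lemma Q_sm: "Q (sm c x) = c\<^sup>2 * Q x"
  by (simp add: Q_def B_lin power2_eq_square mult.assoc)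
lemma Q_uminus [simp]: "Q (- x) = Q x"
  by (simp add: Q_def B_lin)

section \<open>Subspaces and orthogonal complements\<close>

definition subsp :: "'v set \<Rightarrow> bool" where
  "subsp W \<longleftrightarrow> W \<subseteq> V \<and> 0 \<in> W \<and> (\<forall>x\<in>W. \<forall>y\<in>W. x + y \<in> W) \<and> (\<forall>c\<in>F. \<forall>x\<in>W. sm c x \<in> W)"

lemma subsp_V: "subsp V" by (simp add: subsp_def)

lemma subspD: 
  assumes "subsp W" 
  shows "W \<subseteq> V" "0 \<in> W" "x \<in> W \<Longrightarrow> y \<in> W \<Longrightarrow> x + y \<in> W" "c \<in> F \<Longrightarrow> x \<in> W \<Longrightarrow> sm c x \<in> W"
    "x \<in> W \<Longrightarrow> y \<in> W \<Longrightarrow> x - y \<in> W"  "x \<in> W \<Longrightarrow> x \<in> V" "finite W"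
proof -
  show *: "W \<subseteq> V" "0 \<in> W" using assms by (auto simp: subsp_def)
  show add: "x \<in> W \<Longrightarrow> y \<in> W \<Longrightarrow> x + y \<in> W" for x y using assms by (auto simp: subsp_def)
  show sm: "c \<in> F \<Longrightarrow> x \<in> W \<Longrightarrow> sm c x \<in> W" for c x using assms by (auto simp: subsp_def)
  show "x \<in> W \<Longrightarrow> x \<in> V" using * by auto
  show "finite W" using * finite_V finite_subset by blast
  assume xy: "x \<in> W" "y \<in> W"
  have "sm (- e) y = - y" using xy * by (auto simp: sm_uminus_left)
  then show "x - y \<in> W" using add[OF xy(1) sm[of "- e" y]] xy by simp
qed

lemma subsp_perp: 
  assumes "subsp W" shows "subsp {x\<in>W. B v x = 0}"
  using subspD[OF assms] by (auto simp: subsp_def B_lin)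

text \<open>Subtracting one point of a fibre of \<open>B v\<close> moves the fibre into the kernel,
  so \<open>W\<close> is covered by at most \<open>card F\<close> fibres, none larger than the
  kernel.\<close>

lemma card_perp:
  assumes W: "subsp W" and v: "v \<in> V"
  shows "card W \<le> card F * card {x\<in>W. B v x = 0}"
proof -
  let ?P = "{x\<in>W. B v x = 0}"
  have fib: "card {x\<in>W. B v x = t} \<le> card ?P" for t
  proof (cases "{x\<in>W. B v x = t} = {}")
    case True
    then show ?thesis by (metis card.empty zero_le)
  next
    case False
    then obtain y where y: "y \<in> W" "B v y = t" by auto
    have "(\<lambda>x. x - y) ` {x\<in>W. B v x = t} \<subseteq> ?P" using y subspD[OF W] by (auto simp: B_lin)
    moreover have "finite ?P" using subspD(7)[OF W] by auto
    moreover have "inj_on (\<lambda>x. x - y) {x\<in>W. B v x = t}" by (auto simp: inj_on_def)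
    ultimately show ?thesis using card_inj_on_le by blast
  qed
  have "W = (\<Union>t\<in>F. {x\<in>W. B v x = t})" using v subspD(6)[OF W] by auto
  then have "card W \<le> (\<Sum>t\<in>F. card {x\<in>W. B v x = t})" 
    using card_UN_le[OF finite_F, of "\<lambda>t. {x\<in>W. B v x = t}"] by auto
  also have "\<dots> \<le> (\<Sum>t\<in>F. card ?P)" by (intro sum_mono fib)
  finally show ?thesis by simp
qed

lemma inj_line_sum:
  assumes U: "subsp U" and v: "v \<in> V" "v \<notin> U"
  shows "inj_on (\<lambda>(u, t). u + sm t v) (U \<times> F)"
proof (rule inj_onI, clarify)
  fix u t u' t' assume *: "u \<in> U" "t \<in> F" "u' \<in> U" "t' \<in> F" "u + sm t v = u' + sm t' v"
  then have eq: "sm (t - t') v = u' - u" by (simp add: sm_diff_left algebra_simps)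
  have "t = t'"
  proof (rule ccontr)
    assume "t \<noteq> t'"
    then have ne: "t - t' \<noteq> 0" "t - t' \<in> F" using * by auto
    have "sm (iv (t - t')) (sm (t - t') v) \<in> U" 
      unfolding eq using * ne subspD[OF U] by auto
    moreover have "sm (iv (t - t')) (sm (t - t') v) = v" using ne v by (simp add: sm_sm)
    ultimately show False using v by simp
  qed
  then show "u = u' \<and> t = t'" using eq by simp
qed

lemma subsp_line_sum:
  assumes U: "subsp U" and v: "v \<in> V"
  shows "subsp ((\<lambda>(u, t). u + sm t v) ` (U \<times> F))"
  unfolding subsp_def
proof (intro conjI ballI)
  show "(\<lambda>(u, t). u + sm t v) ` (U \<times> F) \<subseteq> V" using v subspD(6)[OF U] by auto
  show "0 \<in> (\<lambda>(u, t). u + sm t v) ` (U \<times> F)"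
    using subspD[OF U] by (intro image_eqI[of _ _ "(0, 0)"]) auto
next
  fix x y assume "x \<in> (\<lambda>(u, t). u + sm t v) ` (U \<times> F)" "y \<in> (\<lambda>(u, t). u + sm t v) ` (U \<times> F)"
  then obtain u t u' t' where "u \<in> U" "t \<in> F" "u' \<in> U" "t' \<in> F" "x = u + sm t v" "y = u' + sm t' v" by auto
  then show "x + y \<in> (\<lambda>(u, t). u + sm t v) ` (U \<times> F)"
    using subspD[OF U] by (intro image_eqI[of _ _ "(u + u', t + t')"]) (auto simp: sm_add_left)
next
  fix x c assume "x \<in> (\<lambda>(u, t). u + sm t v) ` (U \<times> F)" "c \<in> F"
  then obtain u t where "u \<in> U" "t \<in> F" "x = u + sm t v" "c \<in> F" by auto
  then show "sm c x \<in> (\<lambda>(u, t). u + sm t v) ` (U \<times> F)"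
    using subspD[OF U] by (intro image_eqI[of _ _ "(sm c u, c * t)"]) (auto simp: sm_add sm_sm)
qed

text \<open>Three pairwise orthogonal anisotropic vectors span an isotropic one, because the binary form
  \<open>a x\<^sup>2 + b y\<^sup>2\<close> represents every scalar.\<close>

lemma ex_isotropic:
  assumes U: "subsp U" and P: "subsp P" and UP: "U \<subseteq> P"
    and orth: "\<And>u x. u \<in> U \<Longrightarrow> x \<in> P \<Longrightarrow> B u x = 0"
    and card: "card F ^ 3 * card U \<le> card P"
  shows "\<exists>x\<in>P. x \<notin> U \<and> Q x = 0"
proof (rule ccontr)
  assume neg: "\<not> ?thesis"
  have q: "card F > 1" using card_F_ge_3 by simp
  have cU: "card U > 0" using subspD(2,7)[OF U] card_gt_0_iff by blast
  \<comment> \<open>One step splits off an anisotropic direction: \<open>W\<close> has room for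
    \<open>v\<close> outside \<open>U\<close>, and passing to the complement of \<open>v\<close>
    costs at most a factor \<open>card F\<close>. The factor \<open>card F ^ 3\<close> pays for
    three such steps.\<close>
  have step: "\<exists>v\<in>W. v \<notin> U \<and> Q v \<in> Fs \<and> subsp {x\<in>W. B v x = 0} \<and> U \<subseteq> {x\<in>W. B v x = 0} 
      \<and> card F ^ k * card U \<le> card {x\<in>W. B v x = 0}"
    if W: "subsp W" "U \<subseteq> W" "W \<subseteq> P" "card F ^ Suc k * card U \<le> card W" for W k
  proof -
    have "1 < card F ^ Suc k" using q by (rule one_less_power) simp
    then have "card U < card F ^ Suc k * card U" using cU by simp
    then have "W \<noteq> U" using W by auto
    then obtain v where v: "v \<in> W" "v \<notin> U" using W by auto
    then have vP: "v \<in> P" using W by auto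
    then have "Q v \<in> Fs" using neg v subspD(6)[OF P] by auto
    moreover have "U \<subseteq> {x\<in>W. B v x = 0}" using orth vP W B_sym by auto
    moreover have "card F * (card F ^ k * card U) \<le> card F * card {x\<in>W. B v x = 0}"
      using card_perp[OF W(1), of v] subspD(6)[OF P vP] W(4) unfolding power_Suc mult.assoc by linarith
    then have "card F ^ k * card U \<le> card {x\<in>W. B v x = 0}" using q by simp
    ultimately show ?thesis using v subsp_perp[OF W(1)] by blast
  qed
  obtain v where v: "v \<in> P" "Q v \<in> Fs" "subsp {x\<in>P. B v x = 0}" "U \<subseteq> {x\<in>P. B v x = 0}"
      "card F ^ 2 * card U \<le> card {x\<in>P. B v x = 0}"
    using step[of P 2] P UP card by (auto simp: eval_nat_numeral)
  define P1 where "P1 = {x\<in>P. B v x = 0}"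
  obtain w where w: "w \<in> P1" "Q w \<in> Fs" "subsp {x\<in>P1. B w x = 0}" "U \<subseteq> {x\<in>P1. B w x = 0}"
      "card F ^ 1 * card U \<le> card {x\<in>P1. B w x = 0}"
    using step[of P1 1] v unfolding P1_def by (auto simp: eval_nat_numeral)
  obtain z where z: "z \<in> P1" "B w z = 0" "Q z \<in> Fs"
    using step[of "{x\<in>P1. B w x = 0}" 0] w v unfolding P1_def by auto
  have in_P: "w \<in> P" "z \<in> P" and orth': "B v w = 0" "B v z = 0" using w z by (auto simp: P1_def)
  obtain a b where ab: "a \<in> F" "b \<in> F" "Q v * a\<^sup>2 + Q w * b\<^sup>2 = - Q z"
    using represent_by_binary[of "Q v" "Q w" "- Q z"] v(2) w(2) z(3) by auto
  let ?x = "sm a v + sm b w + z"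
  have "?x \<in> P" using subspD[OF P] ab v in_P by auto
  moreover have "Q ?x = 0"
    using ab(3) orth' z(2) B_sym[of v z] B_sym[of w z] B_sym[of v w] 
    by (simp add: Q_add Q_sm B_lin algebra_simps)
  \<comment> \<open>Membership in \<open>U\<close> would make \<open>?x\<close> orthogonal to
    \<open>z\<close>, but its product with \<open>z\<close> is \<open>Q z\<close>.\<close>
  moreover have "?x \<notin> U"
  proof
    assume "?x \<in> U"
    then have "B ?x z = 0" using orth in_P by blast
    then show False using orth' z by (simp add: B_lin Q_def)
  qed
  ultimately show False using neg by blast
qed

text \<open>Grow \<open>U\<close> by isotropic vectors while \<open>P\<close> stays orthogonal to
  it. Each new \<open>v\<close> from \<open>ex_isotropic\<close> multiplies \<open>card U\<close> by
  \<open>card F\<close> and costs \<open>P\<close> at most a factor \<open>card F\<close>; the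
  condition on \<open>k\<close> keeps the ratio of sizes at least \<open>card F ^ 3\<close> before
  every extension.\<close>

lemma ex_totally_isotropic:
  assumes "card V = card F ^ d" and "2 * k + 1 \<le> d"
  shows "\<exists>U P. subsp U \<and> subsp P \<and> U \<subseteq> P \<and> (\<forall>u\<in>U. \<forall>x\<in>P. B u x = 0) 
     \<and> card U = card F ^ k \<and> card F ^ (d - k) \<le> card P"
  using assms(2)
proof (induction k)
  case 0
  show ?case using assms subsp_V by (intro exI[of _ "{0}"] exI[of _ V]) (auto simp: subsp_def)
next
  case (Suc k)
  then obtain U P where U: "subsp U" and P: "subsp P" and UP: "U \<subseteq> P" 
    and orth: "\<And>u x. u \<in> U \<Longrightarrow> x \<in> P \<Longrightarrow> B u x = 0"
    and card: "card U = card F ^ k" "card F ^ (d - k) \<le> card P" by auto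
  have q: "card F > 0" using card_F_ge_3 by simp
  have "card F ^ 3 * card U = card F ^ (3 + k)" by (simp add: card power_add)
  also have "\<dots> \<le> card F ^ (d - k)" using q Suc.prems by (intro power_increasing) auto
  also have "\<dots> \<le> card P" by fact
  finally obtain v where v: "v \<in> P" "v \<notin> U" "Q v = 0"
    using ex_isotropic[OF U P UP orth] by auto
  have vV: "v \<in> V" using subspD(6)[OF P] v by auto
  let ?U = "(\<lambda>(u, t). u + sm t v) ` (U \<times> F)" and ?P = "{x\<in>P. B v x = 0}"
  have "?U \<subseteq> ?P"
  proof (clarify)
    fix u t assume u: "u \<in> U" "t \<in> F"
    then have "B v u = 0" "B v v = 0" using orth[OF u(1) v(1)] B_sym[of u v] v by (simp_all add: Q_def)
    then show "u + sm t v \<in> P \<and> B v (u + sm t v) = 0" 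
      using u UP v subspD(3,4)[OF P] by (auto simp: B_lin)
  qed
  moreover have "\<forall>u\<in>?U. \<forall>x\<in>?P. B u x = 0" using orth by (auto simp: B_lin)
  moreover have "card ?U = card F ^ Suc k" 
    using inj_line_sum[OF U vV v(2)] by (simp add: card_image card_cartesian_product card)
  moreover have "d - k = Suc (d - Suc k)" using Suc.prems by simp
  then have "card F ^ (d - k) = card F * card F ^ (d - Suc k)" by (simp only: power_Suc)
  then have "card F * card F ^ (d - Suc k) \<le> card F * card ?P"
    using card_perp[OF P vV] card(2) by linarith
  then have "card F ^ (d - Suc k) \<le> card ?P" using q by simp
  ultimately show ?case using subsp_line_sum[OF U vV] subsp_perp[OF P] by blast
qed

text \<open>The set is \<open>U + S v\<close> with \<open>v\<close> in \<open>P\<close> outside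
  \<open>U\<close>. The \<open>U\<close>-part of a difference is isotropic and orthogonal to
  \<open>v\<close>, so only the \<open>v\<close>-part reaches \<open>Q\<close>; thus
  \<open>a = Q v\<close>, which may be 0.\<close>

lemma ex_degenerate_subset:
  assumes V: "card V = card F ^ d" and k: "2 * k + 1 \<le> d" and S: "S \<subseteq> F"
  shows "\<exists>a\<in>F. \<exists>E\<subseteq>V. card E = card F ^ k * card S \<and> 
    (\<forall>x\<in>E. \<forall>y\<in>E. \<exists>t\<in>S. \<exists>t'\<in>S. Q (x - y) = a * (t - t')\<^sup>2)"
proof -
  obtain U P where U: "subsp U" and P: "subsp P" and UP: "U \<subseteq> P" 
    and orth: "\<And>u x. u \<in> U \<Longrightarrow> x \<in> P \<Longrightarrow> B u x = 0"
    and card: "card U = card F ^ k" "card F ^ (d - k) \<le> card P" using ex_totally_isotropic[OF V k] by blast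
  have "card F > 1" using card_F_ge_3 by simp
  then have "card F ^ k < card F ^ (d - k)" using k by (intro power_strict_increasing) auto
  then have "U \<noteq> P" using card by auto
  then obtain v where v: "v \<in> P" "v \<notin> U" using UP by auto
  have vV: "v \<in> V" using subspD(6)[OF P] v by auto
  let ?E = "(\<lambda>(u, t). u + sm t v) ` (U \<times> S)"
  have "inj_on (\<lambda>(u, t). u + sm t v) (U \<times> S)"
    using inj_line_sum[OF U vV v(2)] by (rule inj_on_subset) (use S in auto)
  then have "card ?E = card F ^ k * card S" by (simp add: card_image card_cartesian_product card)
  moreover have "?E \<subseteq> V" using vV S subspD(6)[OF U] by auto
  moreover have "\<exists>t\<in>S. \<exists>t'\<in>S. Q (x - y) = Q v * (t - t')\<^sup>2" if xy: "x \<in> ?E" "y \<in> ?E" for x y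
  proof -
    obtain u t u' t' where *: "u \<in> U" "t \<in> S" "u' \<in> U" "t' \<in> S" "x = u + sm t v" "y = u' + sm t' v" 
      using xy by auto
    have "x - y = (u - u') + sm (t - t') v" using * by (simp add: sm_diff_left)
    moreover have "u - u' \<in> U" using * subspD(5)[OF U] by simp
    then have "Q (u - u') = 0" "B (u - u') v = 0" using orth UP v unfolding Q_def by blast+
    ultimately have "Q (x - y) = Q v * (t - t')\<^sup>2" by (simp add: Q_add Q_sm B_lin)
    then show ?thesis using * by auto
  qed
  ultimately have "\<exists>E\<subseteq>V. card E = card F ^ k * card S \<and> 
    (\<forall>x\<in>E. \<forall>y\<in>E. \<exists>t\<in>S. \<exists>t'\<in>S. Q (x - y) = Q v * (t - t')\<^sup>2)" by (intro exI[of _ ?E]) blast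
  then show ?thesis using vV by (intro bexI[of _ "Q v"]) auto
qed

end

section \<open>Gauss sums of quadratic forms\<close>

locale ffield_char = ffield F e for F :: "'k::comm_ring_1 set" and e +
  fixes \<chi> :: "'k \<Rightarrow> complex"
  assumes \<chi>_add: "x \<in> F \<Longrightarrow> y \<in> F \<Longrightarrow> \<chi> (x + y) = \<chi> x * \<chi> y"
    and norm_\<chi>: "x \<in> F \<Longrightarrow> norm (\<chi> x) = 1"
    and \<chi>_nontrivial: "\<exists>x\<in>F. \<chi> x \<noteq> 1"
begin

lemma \<chi>_0 [simp]: "\<chi> 0 = 1"
  using \<chi>_add[of 0 0] norm_\<chi>[of 0] by auto

lemma \<chi>_uminus: "x \<in> F \<Longrightarrow> \<chi> (- x) = cnj (\<chi> x)"
proof -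
  assume x: "x \<in> F"
  have "\<chi> x * \<chi> (- x) = 1" using \<chi>_add[of x "- x"] x by simp
  moreover have "\<chi> x * cnj (\<chi> x) = 1" using norm_\<chi>[OF x] by (simp add: complex_norm_square[symmetric])
  moreover have "\<chi> x \<noteq> 0" using norm_\<chi>[OF x] by auto
  ultimately show ?thesis by (metis mult_left_cancel)
qed

lemma sum_\<chi>: "(\<Sum>x\<in>F. \<chi> x) = 0"
proof -
  obtain a where a: "a \<in> F" "\<chi> a \<noteq> 1" using \<chi>_nontrivial by auto
  have "(\<Sum>x\<in>F. \<chi> x) = (\<Sum>x\<in>F. \<chi> (x + a))" using sum_F_translate[OF a(1), of \<chi>] by simp
  also have "\<dots> = \<chi> a * (\<Sum>x\<in>F. \<chi> x)" unfolding sum_distrib_left 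
    by (rule sum.cong) (use a in \<open>auto simp: \<chi>_add\<close>)
  finally show ?thesis using a by simp
qed

lemma sum_Fs_\<chi>:
  assumes "c \<in> F"
  shows "(\<Sum>s\<in>Fs. \<chi> (c * s)) = (if c = 0 then of_nat (card F) else 0) - 1"
proof (cases "c = 0")
  case True
  have "card F \<ge> 1" using card_F_ge_3 by simp
  then show ?thesis using True finite_F by (simp add: of_nat_diff)
next
  case False
  then have "(\<Sum>s\<in>Fs. \<chi> (c * s)) = (\<Sum>s\<in>Fs. \<chi> s)" using sum_Fs_mult[of c \<chi>] assms by simp
  also have "\<dots> = (\<Sum>s\<in>F. \<chi> s) - \<chi> 0" using finite_F by (simp add: sum_diff1)
  finally show ?thesis using False sum_\<chi> by simp
qed

lemma sum_F_\<chi>: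
  assumes "c \<in> F"
  shows "(\<Sum>s\<in>F. \<chi> (s * c)) = (if c = 0 then of_nat (card F) else 0)"
proof -
  have "(\<Sum>s\<in>F. \<chi> (s * c)) = \<chi> (0 * c) + (\<Sum>s\<in>Fs. \<chi> (s * c))" 
    using finite_F by (rule sum.remove) simp
  then show ?thesis using sum_Fs_\<chi>[OF assms] by (simp add: mult.commute)
qed

definition gauss :: "'k \<Rightarrow> complex" where
  "gauss s = (\<Sum>u\<in>F. \<chi> (s * u\<^sup>2))"

lemma gauss_conv: "(\<Sum>u\<in>Fs. \<chi> (s * u\<^sup>2)) = gauss s - 1"
  unfolding gauss_def using finite_F by (simp add: sum_diff1)

text \<open>The two sums of phases together run twice over \<open>Fs\<close>, where the character
  sums to -1; adding the two terms at 0 gives total 0.\<close>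

lemma gauss_nonsquare:
  assumes n: "n \<in> Fs" "n \<notin> squares" and s: "s \<in> Fs"
  shows "gauss (n * s) = - gauss s"
proof -
  have "(\<Sum>u\<in>Fs. \<chi> (s * u\<^sup>2)) + (\<Sum>u\<in>Fs. \<chi> (s * (n * u\<^sup>2))) = 2 * (\<Sum>t\<in>Fs. \<chi> (s * t))"
    by (rule sum_square_classes[OF n])
  moreover have "(\<Sum>u\<in>Fs. \<chi> (s * (n * u\<^sup>2))) = gauss (n * s) - 1"
    unfolding gauss_conv[symmetric] by (simp add: ac_simps)
  ultimately have "gauss s + gauss (n * s) - 2 = - 2"
    using sum_Fs_\<chi>[of s] s by (simp add: gauss_conv)
  then show ?thesis by (simp add: eq_neg_iff_add_eq_0 add.commute)
qed

end

locale bspace_char = bspace F e V sm B + ffield_char F e \<chi> 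
  for F :: "'k::comm_ring_1 set" and e and V :: "'v::ab_group_add set" and sm B \<chi>
begin

text \<open>Taken over a subspace \<open>W\<close> so that an induction on the dimension can split
  off lines.\<close>

definition \<Gamma> :: "'v set \<Rightarrow> 'k \<Rightarrow> complex" where
  "\<Gamma> W s = (\<Sum>x\<in>W. \<chi> (s * Q x))"

lemma \<Gamma>_square:
  assumes W: "subsp W" and u: "u \<in> Fs"
  shows "\<Gamma> W (s * u\<^sup>2) = \<Gamma> W s"
  unfolding \<Gamma>_def
proof (rule sum.reindex_bij_witness[of _ "sm (iv u)" "sm u"])
  fix x assume x: "x \<in> W"
  then have xV: "x \<in> V" using subspD(6)[OF W] by simp
  show "sm (iv u) (sm u x) = x" "sm u (sm (iv u) x) = x" using u xV by (simp_all add: sm_sm)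
  show "sm u x \<in> W" "sm (iv u) x \<in> W" using u x subspD(4)[OF W] by simp_all
  show "\<chi> (s * Q (sm u x)) = \<chi> (s * u\<^sup>2 * Q x)" by (simp add: Q_sm mult.assoc)
qed

text \<open>Since \<open>Q v\<close> is invertible, subtracting \<open>iv (Q v) * B v x\<close>
  times \<open>v\<close> projects \<open>x\<close> to the complement of \<open>v\<close>.\<close>

lemma orthogonal_split:
  assumes W: "subsp W" and v: "v \<in> W" "Q v \<noteq> 0"
  shows "bij_betw (\<lambda>(x, t). x + sm t v) ({x\<in>W. B v x = 0} \<times> F) W"
proof -
  have vV: "v \<in> V" using subspD(6)[OF W] v by simp
  have Qv: "Q v \<in> F" using vV by simp
  have "inj_on (\<lambda>(x, t). x + sm t v) ({x\<in>W. B v x = 0} \<times> F)"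
    using vV v by (intro inj_line_sum subsp_perp W) (auto simp: Q_def)
  moreover have "x \<in> (\<lambda>(x, t). x + sm t v) ` ({x\<in>W. B v x = 0} \<times> F)" if x: "x \<in> W" for x
  proof (rule image_eqI)
    let ?t = "iv (Q v) * B v x"
    have Bvx: "B v x \<in> F" using vV x subspD(6)[OF W] by simp
    then have t: "?t \<in> F" using Qv v by simp
    have "B v (x - sm ?t v) = B v x - (iv (Q v) * Q v) * B v x" 
      by (simp add: B_lin Q_def mult.assoc mult.left_commute)
    also have "\<dots> = 0" using Qv v Bvx by simp
    finally show "(x - sm ?t v, ?t) \<in> {x\<in>W. B v x = 0} \<times> F"
      using t x v subspD[OF W] by auto
    show "x = (case (x - sm ?t v, ?t) of (x, t) \<Rightarrow> x + sm t v)" by simp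
  qed
  ultimately show ?thesis using v subspD[OF W] unfolding bij_betw_def by auto
qed

text \<open>\<open>Q\<close> is additive along the orthogonal decomposition, so the character sum
  factors.\<close>

lemma \<Gamma>_split:
  assumes W: "subsp W" and v: "v \<in> W" "Q v \<noteq> 0" and s: "s \<in> F"
  shows "\<Gamma> W s = \<Gamma> {x\<in>W. B v x = 0} s * gauss (s * Q v)"
proof -
  let ?W = "{x\<in>W. B v x = 0}"
  have vV: "v \<in> V" using subspD(6)[OF W] v by simp
  have "\<Gamma> W s = (\<Sum>(x,t)\<in>?W \<times> F. \<chi> (s * Q (x + sm t v)))"
    unfolding \<Gamma>_def using sum.reindex_bij_betw[OF orthogonal_split[OF W v], of "\<lambda>x. \<chi> (s * Q x)"]
    by (simp add: case_prod_unfold)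
  also have "\<dots> = (\<Sum>(x,t)\<in>?W \<times> F. \<chi> (s * Q x) * \<chi> (s * Q v * t\<^sup>2))"
  proof (rule sum.cong[OF refl], clarify)
    fix x t assume x: "x \<in> W" "B v x = 0" and t: "t \<in> F"
    have "s * Q (x + sm t v) = s * Q x + s * Q v * t\<^sup>2" 
      using x B_sym[of x v] by (simp add: Q_add Q_sm B_lin algebra_simps)
    moreover have "s * Q x \<in> F" "s * Q v * t\<^sup>2 \<in> F" using x t s vV subspD(6)[OF W] by simp_all
    ultimately show "\<chi> (s * Q (x + sm t v)) = \<chi> (s * Q x) * \<chi> (s * Q v * t\<^sup>2)" by (simp only: \<chi>_add)
  qed
  also have "\<dots> = \<Gamma> ?W s * gauss (s * Q v)"
    unfolding \<Gamma>_def gauss_def sum_product by (simp add: sum.cartesian_product)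
  finally show ?thesis .
qed

definition nondeg_on :: "'v set \<Rightarrow> bool" where
  "nondeg_on W \<longleftrightarrow> (\<forall>x\<in>W. x \<noteq> 0 \<longrightarrow> (\<exists>y\<in>W. B x y \<noteq> 0))"

text \<open>Induction on the dimension: an anisotropic line splits off a one-dimensional Gauss sum,
  and each of these changes sign by \<open>gauss_nonsquare\<close>.\<close>

lemma \<Gamma>_nonsquare:
  assumes n: "n \<in> Fs" "n \<notin> squares" and s: "s \<in> Fs"
    and W: "subsp W" "nondeg_on W" "card W = card F ^ k"
  shows "\<Gamma> W (n * s) = (- 1) ^ k * \<Gamma> W s"
  using W
proof (induction k arbitrary: W)
  case 0
  then have "card W = 1" by simp
  then obtain x where "W = {x}" by (rule card_1_singletonE)
  then have "W = {0}" using subspD(2)[OF 0(1)] by simp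
  then show ?case by (simp add: \<Gamma>_def)
next
  case (Suc k)
  note W = Suc.prems
  have "1 < card F ^ Suc k" using card_F_ge_3 by (intro one_less_power) auto
  then have "card W > 1" using W by simp
  then have "W \<noteq> {0}" by auto
  then obtain x where x: "x \<in> W" "x \<noteq> 0" using subspD(2)[OF W(1)] by blast
  then obtain y where y: "y \<in> W" "B x y \<noteq> 0" using W(2) by (auto simp: nondeg_on_def)
  \<comment> \<open>Polarisation: if \<open>Q\<close> vanished on \<open>W\<close>, so would
    \<open>B x y + B x y\<close>, and doubling is injective on \<open>F\<close>.\<close>
  have "\<exists>v\<in>W. Q v \<noteq> 0"
  proof (rule ccontr)
    assume "\<not> ?thesis"
    then have "Q (x + y) = 0" "Q x = 0" "Q y = 0" using x y subspD(3)[OF W(1)] by auto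
    then have "B x y + B x y = 0" by (simp add: Q_add)
    then show False using double_eq_0[of "B x y"] x y subspD(6)[OF W(1)] by auto
  qed
  then obtain v where v: "v \<in> W" "Q v \<noteq> 0" by auto
  have vV: "v \<in> V" using subspD(6)[OF W(1)] v by simp
  let ?W = "{x\<in>W. B v x = 0}"
  have "card W = card ?W * card F" 
    using bij_betw_same_card[OF orthogonal_split[OF W(1) v]] by (simp add: card_cartesian_product)
  then have card': "card ?W = card F ^ k" using W(3) card_F_ge_3 by simp
  \<comment> \<open>The \<open>v\<close>-component of a witness \<open>y\<close> pairs to 0 with
    \<open>x\<close>, so the projection of \<open>y\<close> is a witness in the complement.\<close>
  have nd: "nondeg_on ?W" unfolding nondeg_on_def
  proof (intro ballI impI)
    fix x assume x: "x \<in> ?W" "x \<noteq> 0"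
    then obtain y where y: "y \<in> W" "B x y \<noteq> 0" using W(2) by (auto simp: nondeg_on_def)
    have "y \<in> (\<lambda>(x, t). x + sm t v) ` (?W \<times> F)" 
      using y(1) bij_betw_imp_surj_on[OF orthogonal_split[OF W(1) v]] by simp
    then obtain z t where z: "z \<in> ?W" "t \<in> F" "y = z + sm t v" by auto
    have "B x y = B x z" using z x B_sym[of x v] by (simp add: B_lin)
    then show "\<exists>y\<in>?W. B x y \<noteq> 0" using y z by auto
  qed
  have IH: "\<Gamma> ?W (n * s) = (- 1) ^ k * \<Gamma> ?W s" by (rule Suc.IH[OF subsp_perp[OF W(1)] nd card'])
  have "gauss (n * s * Q v) = - gauss (s * Q v)" 
    using gauss_nonsquare[OF n, of "s * Q v"] s v vV by (simp add: mult.assoc)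
  then show ?case using IH \<Gamma>_split[OF W(1) v] n s by simp
qed

end

locale nondeg_space = bspace_char F e V sm B \<chi> 
  for F :: "'k::comm_ring_1 set" and e and V :: "'v::ab_group_add set" and sm B \<chi> +
  assumes nondeg: "nondeg_on V"
begin

lemma sum_V_translate: 
  assumes "a \<in> V" shows "(\<Sum>x\<in>V. h (x + a)) = (\<Sum>x\<in>V. h x)"
  by (rule sum.reindex_bij_witness[of _ "\<lambda>x. x - a" "\<lambda>x. x + a"]) (use assms in auto)

text \<open>Translating by a \<open>z\<close> with \<open>B \<xi> z + B \<xi> z = a\<close> and
  \<open>\<chi> a \<noteq> 1\<close> multiplies the sum by \<open>\<chi> a\<close>. The pairing is
  doubled because that is the cross term of \<open>Q\<close>.\<close>

lemma sum_\<chi>_B: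
  assumes \<xi>: "\<xi> \<in> V"
  shows "(\<Sum>x\<in>V. \<chi> (B \<xi> x + B \<xi> x)) = (if \<xi> = 0 then of_nat (card V) else 0)"
proof (cases "\<xi> = 0")
  case False
  then obtain y where y: "y \<in> V" "B \<xi> y \<noteq> 0" using nondeg \<xi> by (auto simp: nondeg_on_def)
  obtain a where a: "a \<in> F" "\<chi> a \<noteq> 1" using \<chi>_nontrivial by auto
  let ?b = "B \<xi> y + B \<xi> y"
  have By: "B \<xi> y \<in> F" using y \<xi> by simp
  have b: "?b \<in> F" "?b \<noteq> 0" using double_eq_0[OF By] y F_add[OF By By] by blast+
  define z where "z = sm (a * iv ?b) y"
  have z: "z \<in> V" using a b y by (simp add: z_def)
  have "B \<xi> z + B \<xi> z = a * (iv ?b * ?b)" by (simp add: z_def B_lin algebra_simps)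
  also have "\<dots> = a" using iv_mult[OF b] a by simp
  finally have Bz: "B \<xi> z + B \<xi> z = a" .
  let ?S = "\<Sum>x\<in>V. \<chi> (B \<xi> x + B \<xi> x)"
  have "?S = (\<Sum>x\<in>V. \<chi> (B \<xi> (x + z) + B \<xi> (x + z)))" 
    using sum_V_translate[OF z, of "\<lambda>x. \<chi> (B \<xi> x + B \<xi> x)"] by simp
  also have "\<dots> = (\<Sum>x\<in>V. \<chi> a * \<chi> (B \<xi> x + B \<xi> x))"
  proof (rule sum.cong[OF refl])
    fix x assume x: "x \<in> V"
    have "B \<xi> (x + z) + B \<xi> (x + z) = a + (B \<xi> x + B \<xi> x)" 
      unfolding Bz[symmetric] B_lin by (simp only: ac_simps)
    then show "\<chi> (B \<xi> (x + z) + B \<xi> (x + z)) = \<chi> a * \<chi> (B \<xi> x + B \<xi> x)" 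
      using \<chi>_add[of a "B \<xi> x + B \<xi> x"] a x \<xi> F_add B_in by metis
  qed
  also have "\<dots> = \<chi> a * ?S" by (simp add: sum_distrib_left)
  finally show ?thesis using a False by simp
qed simp

text \<open>After translation by \<open>- sm (iv s) \<xi>\<close> the linear terms cancel and the
  constant \<open>- (iv s * Q \<xi>)\<close> remains.\<close>

lemma complete_square:
  assumes s: "s \<in> Fs" and \<xi>: "\<xi> \<in> V"
  shows "(\<Sum>x\<in>V. \<chi> (s * Q x + (B \<xi> x + B \<xi> x))) = \<Gamma> V s * \<chi> (- (iv s * Q \<xi>))"
proof -
  let ?a = "sm (iv s) \<xi>"
  have a: "?a \<in> V" using s \<xi> by simp
  have "(\<Sum>x\<in>V. \<chi> (s * Q x + (B \<xi> x + B \<xi> x))) = (\<Sum>x\<in>V. \<chi> (s * Q (x + (- ?a)) + (B \<xi> (x + (- ?a)) + B \<xi> (x + (- ?a)))))"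
    using sum_V_translate[of "- ?a" "\<lambda>x. \<chi> (s * Q x + (B \<xi> x + B \<xi> x))"] a by simp
  also have "\<dots> = (\<Sum>x\<in>V. \<chi> (s * Q x) * \<chi> (- (iv s * Q \<xi>)))"
  proof (rule sum.cong[OF refl])
    fix x assume x: "x \<in> V"
    have s1: "s * (iv s * B x \<xi>) = B x \<xi>" "s * ((iv s)\<^sup>2 * Q \<xi>) = iv s * Q \<xi>"
      using s x \<xi> by (simp_all add: power2_eq_square flip: mult.assoc)
    have "s * Q (x + (- ?a)) + (B \<xi> (x + (- ?a)) + B \<xi> (x + (- ?a))) = 
       s * Q x + s * ((iv s)\<^sup>2 * Q \<xi>) - (s * (iv s * B x \<xi>) + s * (iv s * B x \<xi>)) 
        + (B x \<xi> + B x \<xi>) - (iv s * Q \<xi> + iv s * Q \<xi>)"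
      by (simp add: Q_diff Q_sm B_lin B_sym[of \<xi> x] Q_def[of \<xi>, symmetric] algebra_simps)
    also have "\<dots> = s * Q x + (- (iv s * Q \<xi>))" unfolding s1 by simp
    finally show "\<chi> (s * Q (x + (- ?a)) + (B \<xi> (x + (- ?a)) + B \<xi> (x + (- ?a)))) = \<chi> (s * Q x) * \<chi> (- (iv s * Q \<xi>))"
      using \<chi>_add[of "s * Q x" "- (iv s * Q \<xi>)"] s x \<xi> by simp
  qed
  finally show ?thesis by (simp add: \<Gamma>_def sum_distrib_right)
qed

lemma \<Gamma>_uminus: "s \<in> F \<Longrightarrow> \<Gamma> V (- s) = cnj (\<Gamma> V s)"
  by (simp add: \<Gamma>_def \<chi>_uminus)

text \<open>Substituting \<open>x = z + y\<close> leaves a phase linear in \<open>y\<close>, whose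
  sum over \<open>V\<close> vanishes unless \<open>z = 0\<close>.\<close>

lemma \<Gamma>_mult_cnj:
  assumes s: "s \<in> Fs"
  shows "\<Gamma> V s * cnj (\<Gamma> V s) = of_nat (card V)"
proof -
  have "\<Gamma> V s * cnj (\<Gamma> V s) = (\<Sum>y\<in>V. \<Sum>x\<in>V. \<chi> (s * Q x) * \<chi> (- (s * Q y)))"
    unfolding \<Gamma>_def cnj_sum sum_product using s
    by (subst sum.swap) (auto intro!: sum.cong simp: \<chi>_uminus)
  also have "\<dots> = (\<Sum>y\<in>V. \<Sum>z\<in>V. \<chi> (s * Q (z + y)) * \<chi> (- (s * Q y)))"
    by (rule sum.cong[OF refl]) (simp add: sum_V_translate[where h = "\<lambda>x. \<chi> (s * Q x) * _"])
  also have "\<dots> = (\<Sum>y\<in>V. \<Sum>z\<in>V. \<chi> (s * Q z) * \<chi> (B (sm s z) y + B (sm s z) y))"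
  proof (intro sum.cong refl)
    fix y z assume yz: "y \<in> V" "z \<in> V"
    have "s * Q (z + y) + (- (s * Q y)) = s * Q z + (B (sm s z) y + B (sm s z) y)"
      by (simp add: Q_add B_sm B_sym[of y z] algebra_simps)
    moreover have "s * Q (z + y) \<in> F" "- (s * Q y) \<in> F" "s * Q z \<in> F" "B (sm s z) y + B (sm s z) y \<in> F"
      using yz s by simp_all
    ultimately show "\<chi> (s * Q (z + y)) * \<chi> (- (s * Q y)) = \<chi> (s * Q z) * \<chi> (B (sm s z) y + B (sm s z) y)"
      by (metis \<chi>_add)
  qed
  also have "\<dots> = (\<Sum>z\<in>V. \<chi> (s * Q z) * (\<Sum>y\<in>V. \<chi> (B (sm s z) y + B (sm s z) y)))"
    by (subst sum.swap) (simp add: sum_distrib_left)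
  also have "\<dots> = (\<Sum>z\<in>V. if z = 0 then of_nat (card V) else 0)"
  proof (rule sum.cong[OF refl])
    fix z assume z: "z \<in> V"
    have "sm s z = 0 \<longleftrightarrow> z = 0"
    proof
      assume "sm s z = 0"
      then have "sm (iv s) (sm s z) = 0" by simp
      then show "z = 0" using s z by (simp add: sm_sm)
    qed simp
    then show "\<chi> (s * Q z) * (\<Sum>y\<in>V. \<chi> (B (sm s z) y + B (sm s z) y)) = (if z = 0 then of_nat (card V) else 0)"
      using sum_\<chi>_B[of "sm s z"] s z by simp
  qed
  also have "\<dots> = of_nat (card V)" using finite_V by simp
  finally show ?thesis .
qed

lemma norm_\<Gamma>: 
  assumes s: "s \<in> Fs"
  shows "norm (\<Gamma> V s) = sqrt (card V)"
proof -
  have "complex_of_real ((norm (\<Gamma> V s))\<^sup>2) = complex_of_real (card V)"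
    using \<Gamma>_mult_cnj[OF s] by (simp only: complex_norm_square of_real_of_nat_eq)
  then have "(norm (\<Gamma> V s))\<^sup>2 = real (card V)" by (simp only: of_real_eq_iff)
  then show ?thesis by (metis norm_ge_zero real_sqrt_unique)
qed

end

text \<open>\<open>gauss\<close> is the Gauss sum of the form \<open>u\<^sup>2\<close> on the
  one-dimensional space \<open>F\<close>, with multiplication as both scalar action and bilinear
  form.\<close>

lemma (in ffield_char) norm_gauss:
  assumes s: "s \<in> Fs"
  shows "norm (gauss s) = sqrt (card F)"
proof -
  interpret L: bspace_char F e F "(*)" "(*)" \<chi>
    by unfold_locales (auto simp: finite_F algebra_simps)
  interpret L: nondeg_space F e F "(*)" "(*)" \<chi>
    by unfold_locales (auto simp: L.nondeg_on_def intro!: bexI[of _ e])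
  have "gauss s = L.\<Gamma> F s" by (simp add: gauss_def L.\<Gamma>_def L.Q_def power2_eq_square)
  then show ?thesis using L.norm_\<Gamma>[OF s] by simp
qed

context nondeg_space
begin

text \<open>Once \<open>s\<close> is replaced by its inverse, the Gauss sum is
  \<open>\<Gamma> V e\<close> on squares and its negative on nonsquares. Twice the sum is therefore
  \<open>\<Gamma> V e\<close> times a difference of two one-dimensional Gauss sums, which cancel for
  \<open>c = 0\<close> and reinforce each other otherwise, giving modulus
  \<open>sqrt (card V) * sqrt (card F)\<close>.\<close>

lemma norm_sum_\<Gamma>_odd:
  assumes V: "card V = card F ^ d" "odd d" and c: "c \<in> F"
  shows "norm (\<Sum>s\<in>Fs. \<Gamma> V s * \<chi> (- (iv s * c))) \<le> sqrt (card F ^ Suc d)"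
proof -
  obtain n where n: "n \<in> Fs" "n \<notin> squares" using ex_nonsquare by auto
  let ?h = "\<lambda>s. \<Gamma> V (iv s) * \<chi> (- (s * c))"
  let ?S = "\<Sum>s\<in>Fs. \<Gamma> V s * \<chi> (- (iv s * c))"
  have G1: "\<Gamma> V (iv (u\<^sup>2)) = \<Gamma> V e" if u: "u \<in> Fs" for u
  proof -
    have "iv (u\<^sup>2) = e * (iv u)\<^sup>2" using u by (simp add: power2_eq_square iv_prod)
    then show ?thesis using \<Gamma>_square[OF subsp_V, of "iv u" e] u by simp
  qed
  have G2: "\<Gamma> V (iv (n * u\<^sup>2)) = - \<Gamma> V e" if u: "u \<in> Fs" for u
  proof -
    have "iv (n * u\<^sup>2) = iv n * (iv u)\<^sup>2" using u n by (simp add: power2_eq_square iv_prod)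
    then have "\<Gamma> V (iv (n * u\<^sup>2)) = \<Gamma> V (iv n)" using \<Gamma>_square[OF subsp_V, of "iv u" "iv n"] u by simp
    \<comment> \<open>The inverse of \<open>n\<close> lies in the square class of
      \<open>n\<close>.\<close>
    also have "iv n = n * (iv n)\<^sup>2" using n by (simp add: power2_eq_square flip: mult.assoc)
    also have "\<Gamma> V (n * (iv n)\<^sup>2) = \<Gamma> V n" using \<Gamma>_square[OF subsp_V, of "iv n" n] n by simp
    also have "\<dots> = - \<Gamma> V e" using \<Gamma>_nonsquare[OF n, of e V d] subsp_V nondeg V n by simp
    finally show ?thesis .
  qed
  have "2 * ?S = 2 * (\<Sum>s\<in>Fs. ?h s)"
    using sum_Fs_iv[of ?h] by simp
  also have "\<dots> = (\<Sum>u\<in>Fs. ?h (u\<^sup>2)) + (\<Sum>u\<in>Fs. ?h (n * u\<^sup>2))"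
    by (rule sum_square_classes[OF n, symmetric])
  also have "(\<Sum>u\<in>Fs. ?h (u\<^sup>2)) = (\<Sum>u\<in>Fs. \<Gamma> V e * \<chi> ((- c) * u\<^sup>2))"
    by (rule sum.cong[OF refl]) (simp add: G1 mult.commute)
  also have "\<dots> = \<Gamma> V e * (gauss (- c) - 1)" by (simp only: gauss_conv flip: sum_distrib_left)
  also have "(\<Sum>u\<in>Fs. ?h (n * u\<^sup>2)) = (\<Sum>u\<in>Fs. - \<Gamma> V e * \<chi> ((n * (- c)) * u\<^sup>2))"
    by (rule sum.cong[OF refl]) (simp add: G2 ac_simps)
  also have "\<dots> = - \<Gamma> V e * (gauss (n * (- c)) - 1)" by (simp only: gauss_conv flip: sum_distrib_left)
  finally have S: "2 * ?S = \<Gamma> V e * (gauss (- c) - gauss (n * (- c)))" by (simp add: algebra_simps)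
  show ?thesis
  proof (cases "c = 0")
    case True
    then have "2 * ?S = 0" using S by simp
    then have "?S = 0" by (metis mult_eq_0_iff zero_neq_numeral)
    then show ?thesis by simp
  next
    case False
    have "gauss (n * (- c)) = - gauss (- c)" using c False by (intro gauss_nonsquare[OF n]) simp
    then have "2 * ?S = 2 * (\<Gamma> V e * gauss (- c))" using S by simp
    then have "?S = \<Gamma> V e * gauss (- c)" by (metis mult_left_cancel zero_neq_numeral)
    then have "norm ?S = sqrt (card V) * sqrt (card F)"
      using norm_\<Gamma>[of e] norm_gauss[of "- c"] c False by (simp add: norm_mult)
    then show ?thesis using V by (simp add: real_sqrt_mult mult.commute)
  qed
qed

end

section \<open>Counting by power spectra\<close>

context nondeg_space
begin

text \<open>Squared modulus of the unnormalised Fourier transform of the indicator of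
  \<open>E\<close>, for the doubled pairing that completing the square produces.\<close>

definition spectrum :: "'v set \<Rightarrow> 'v \<Rightarrow> real" where
  "spectrum E \<xi> = (norm (\<Sum>x\<in>E. \<chi> (B \<xi> x + B \<xi> x)))\<^sup>2"

definition dist2 :: "'v \<times> 'v \<Rightarrow> 'k" where
  "dist2 p = Q (fst p - snd p)"

text \<open>The Fourier transform of the function counting ordered pairs of \<open>E\<close> at each
  distance.\<close>

definition T :: "'v set \<Rightarrow> 'k \<Rightarrow> complex" where
  "T E s = (\<Sum>p\<in>E\<times>E. \<chi> (s * dist2 p))"

lemma pair_diff_in: "E \<subseteq> V \<Longrightarrow> p \<in> E \<times> E \<Longrightarrow> fst p - snd p \<in> V"
  by (metis V_diff mem_Times_iff subsetD)

lemma spectrum_nonneg: "spectrum E \<xi> \<ge> 0" by (simp add: spectrum_def)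

lemma spectrum_eq:
  assumes E: "E \<subseteq> V" and \<xi>: "\<xi> \<in> V"
  shows "of_real (spectrum E \<xi>) = (\<Sum>p\<in>E\<times>E. \<chi> (B \<xi> (fst p - snd p) + B \<xi> (fst p - snd p)))"
proof -
  have "of_real (spectrum E \<xi>) = (\<Sum>x\<in>E. \<Sum>y\<in>E. \<chi> (B \<xi> x + B \<xi> x) * cnj (\<chi> (B \<xi> y + B \<xi> y)))"
    unfolding spectrum_def complex_norm_square cnj_sum sum_product ..
  also have "\<dots> = (\<Sum>x\<in>E. \<Sum>y\<in>E. \<chi> (B \<xi> (x - y) + B \<xi> (x - y)))"
  proof (intro sum.cong refl)
    fix x y assume "x \<in> E" "y \<in> E"
    then have *: "B \<xi> x + B \<xi> x \<in> F" "B \<xi> y + B \<xi> y \<in> F" using E \<xi> by auto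
    have "B \<xi> (x - y) + B \<xi> (x - y) = (B \<xi> x + B \<xi> x) + (- (B \<xi> y + B \<xi> y))"
      by (simp add: B_lin)
    then show "\<chi> (B \<xi> x + B \<xi> x) * cnj (\<chi> (B \<xi> y + B \<xi> y)) = \<chi> (B \<xi> (x - y) + B \<xi> (x - y))"
      using \<chi>_add[OF *(1) F_uminus[OF *(2)]] \<chi>_uminus[OF *(2)] by simp
  qed
  finally show ?thesis by (simp add: sum.cartesian_product case_prod_unfold)
qed

text \<open>Plancherel: orthogonality over \<open>\<xi>\<close> keeps only the pairs with equal
  components.\<close>

lemma sum_spectrum:
  assumes E: "E \<subseteq> V"
  shows "(\<Sum>\<xi>\<in>V. spectrum E \<xi>) = card V * card E"
proof -
  have fE: "finite E" using E finite_V finite_subset by blast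
  have "complex_of_real (\<Sum>\<xi>\<in>V. spectrum E \<xi>) = 
     (\<Sum>\<xi>\<in>V. \<Sum>p\<in>E\<times>E. \<chi> (B \<xi> (fst p - snd p) + B \<xi> (fst p - snd p)))"
    using spectrum_eq[OF E] by simp
  also have "\<dots> = (\<Sum>p\<in>E\<times>E. \<Sum>\<xi>\<in>V. \<chi> (B (fst p - snd p) \<xi> + B (fst p - snd p) \<xi>))"
    by (subst sum.swap) (simp add: B_sym)
  also have "\<dots> = (\<Sum>p\<in>E\<times>E. if fst p = snd p then of_nat (card V) else 0)"
  proof (rule sum.cong[OF refl])
    fix p assume "p \<in> E \<times> E"
    then show "(\<Sum>\<xi>\<in>V. \<chi> (B (fst p - snd p) \<xi> + B (fst p - snd p) \<xi>)) = (if fst p = snd p then of_nat (card V) else 0)"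
      using sum_\<chi>_B[OF pair_diff_in[OF E]] by simp
  qed
  also have "\<dots> = (\<Sum>x\<in>E. \<Sum>y\<in>E. if x = y then of_nat (card V) else 0)"
    by (simp add: sum.cartesian_product case_prod_unfold)
  also have "\<dots> = complex_of_real (card V * card E)" using fE by (simp add: mult.commute)
  finally show ?thesis by (simp only: of_real_eq_iff)
qed

text \<open>By \<open>complete_square\<close> the bracket is the Fourier transform of
  \<open>\<chi> (s * Q z)\<close>; orthogonality over \<open>\<xi>\<close> singles out
  \<open>z = - u\<close>, and \<open>Q\<close> is even.\<close>

lemma fourier_inversion:
  assumes s: "s \<in> Fs" and u: "u \<in> V"
  shows "(\<Sum>\<xi>\<in>V. \<chi> (B \<xi> u + B \<xi> u) * (\<Gamma> V s * \<chi> (- (iv s * Q \<xi>)))) = of_nat (card V) * \<chi> (s * Q u)"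
proof -
  have "(\<Sum>\<xi>\<in>V. \<chi> (B \<xi> u + B \<xi> u) * (\<Gamma> V s * \<chi> (- (iv s * Q \<xi>)))) = 
     (\<Sum>\<xi>\<in>V. \<chi> (B \<xi> u + B \<xi> u) * (\<Sum>z\<in>V. \<chi> (s * Q z + (B \<xi> z + B \<xi> z))))"
    by (rule sum.cong[OF refl]) (simp only: complete_square[OF s])
  also have "\<dots> = (\<Sum>\<xi>\<in>V. \<Sum>z\<in>V. \<chi> (s * Q z) * \<chi> (B (u + z) \<xi> + B (u + z) \<xi>))"
    unfolding sum_distrib_left
  proof (intro sum.cong refl)
    fix \<xi> z assume *: "\<xi> \<in> V" "z \<in> V"
    have F: "B \<xi> u + B \<xi> u \<in> F" "B \<xi> z + B \<xi> z \<in> F" "s * Q z \<in> F" using * s u by auto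
    have "B (u + z) \<xi> + B (u + z) \<xi> = (B \<xi> u + B \<xi> u) + (B \<xi> z + B \<xi> z)"
      unfolding B_sym[of "u + z"] B_add_right by (simp only: ac_simps)
    then show "\<chi> (B \<xi> u + B \<xi> u) * \<chi> (s * Q z + (B \<xi> z + B \<xi> z)) = \<chi> (s * Q z) * \<chi> (B (u + z) \<xi> + B (u + z) \<xi>)"
      using \<chi>_add[OF F(1,2)] \<chi>_add[OF F(3,2)] by (simp only: ac_simps)
  qed
  also have "\<dots> = (\<Sum>z\<in>V. \<chi> (s * Q z) * (\<Sum>\<xi>\<in>V. \<chi> (B (u + z) \<xi> + B (u + z) \<xi>)))"
    by (subst sum.swap) (simp add: sum_distrib_left)
  also have "\<dots> = (\<Sum>z\<in>V. if z = - u then of_nat (card V) * \<chi> (s * Q u) else 0)"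
  proof (rule sum.cong[OF refl])
    fix z assume z: "z \<in> V"
    have "u + z = 0 \<longleftrightarrow> z = - u" by (metis add.commute eq_neg_iff_add_eq_0)
    then show "\<chi> (s * Q z) * (\<Sum>\<xi>\<in>V. \<chi> (B (u + z) \<xi> + B (u + z) \<xi>)) = (if z = - u then of_nat (card V) * \<chi> (s * Q u) else 0)"
      using sum_\<chi>_B[of "u + z"] u z by auto
  qed
  also have "\<dots> = of_nat (card V) * \<chi> (s * Q u)" using finite_V u by simp
  finally show ?thesis .
qed

text \<open>Apply \<open>fourier_inversion\<close> to each difference; summing over the pairs turns
  the characters into the power spectrum.\<close>

lemma T_spectrum:
  assumes E: "E \<subseteq> V" and s: "s \<in> Fs"
  shows "of_nat (card V) * T E s = \<Gamma> V s * (\<Sum>\<xi>\<in>V. of_real (spectrum E \<xi>) * \<chi> (- (iv s * Q \<xi>)))"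
proof -
  have "\<Gamma> V s * (\<Sum>\<xi>\<in>V. of_real (spectrum E \<xi>) * \<chi> (- (iv s * Q \<xi>))) = 
    (\<Sum>\<xi>\<in>V. \<Sum>p\<in>E\<times>E. \<chi> (B \<xi> (fst p - snd p) + B \<xi> (fst p - snd p)) * (\<Gamma> V s * \<chi> (- (iv s * Q \<xi>))))"
    unfolding sum_distrib_left
    by (rule sum.cong[OF refl]) (simp only: spectrum_eq[OF E] sum_distrib_left sum_distrib_right ac_simps)
  also have "\<dots> = (\<Sum>p\<in>E\<times>E. \<Sum>\<xi>\<in>V. \<chi> (B \<xi> (fst p - snd p) + B \<xi> (fst p - snd p)) * (\<Gamma> V s * \<chi> (- (iv s * Q \<xi>))))"
    by (rule sum.swap)
  also have "\<dots> = (\<Sum>p\<in>E\<times>E. of_nat (card V) * \<chi> (s * dist2 p))"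
    unfolding dist2_def by (rule sum.cong[OF refl], rule fourier_inversion[OF s pair_diff_in[OF E]])
  finally show ?thesis by (simp add: T_def sum_distrib_left)
qed

section \<open>Counts of distance-zero pairs and of proportional distances\<close>

definition zero_pairs :: "'v set \<Rightarrow> real" where
  "zero_pairs E = (\<Sum>p\<in>E\<times>E. of_bool (dist2 p = 0))"

definition quads :: "'v set \<Rightarrow> 'k \<Rightarrow> real" where
  "quads E r = (\<Sum>p\<in>E\<times>E. \<Sum>p'\<in>E\<times>E. of_bool (dist2 p = r * dist2 p'))"

lemma dist2_in: "E \<subseteq> V \<Longrightarrow> p \<in> E \<times> E \<Longrightarrow> dist2 p \<in> F"
  unfolding dist2_def by (intro Q_in pair_diff_in)

lemma zero_pairs_T:
  assumes E: "E \<subseteq> V"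
  shows "of_nat (card F) * of_real (zero_pairs E) = (\<Sum>s\<in>F. T E s)"
proof -
  have "(\<Sum>s\<in>F. T E s) = (\<Sum>p\<in>E\<times>E. \<Sum>s\<in>F. \<chi> (s * dist2 p))" unfolding T_def by (rule sum.swap)
  also have "\<dots> = (\<Sum>p\<in>E\<times>E. of_nat (card F) * of_bool (dist2 p = 0))"
    by (rule sum.cong[OF refl]) (simp add: sum_F_\<chi> dist2_in[OF E])
  finally show ?thesis by (simp add: zero_pairs_def sum_distrib_left of_bool_def if_distrib cong: if_cong)
qed

lemma quads_T:
  assumes E: "E \<subseteq> V" and r: "r \<in> F"
  shows "of_nat (card F) * of_real (quads E r) = (\<Sum>s\<in>F. T E s * cnj (T E (r * s)))"
proof -
  have "(\<Sum>s\<in>F. T E s * cnj (T E (r * s))) = 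
     (\<Sum>s\<in>F. \<Sum>p\<in>E\<times>E. \<Sum>p'\<in>E\<times>E. \<chi> (s * (dist2 p - r * dist2 p')))"
    unfolding T_def cnj_sum sum_product
  proof (intro sum.cong refl)
    fix s p p' assume *: "s \<in> F" "p \<in> E \<times> E" "p' \<in> E \<times> E"
    have F: "s * dist2 p \<in> F" "r * s * dist2 p' \<in> F" using * r dist2_in[OF E] by auto
    have "s * (dist2 p - r * dist2 p') = s * dist2 p + (- (r * s * dist2 p'))" by (simp add: algebra_simps)
    then show "\<chi> (s * dist2 p) * cnj (\<chi> (r * s * dist2 p')) = \<chi> (s * (dist2 p - r * dist2 p'))"
      using \<chi>_add[OF F(1) F_uminus[OF F(2)]] \<chi>_uminus[OF F(2)] by simp
  qed
  also have "\<dots> = (\<Sum>p\<in>E\<times>E. \<Sum>s\<in>F. \<Sum>p'\<in>E\<times>E. \<chi> (s * (dist2 p - r * dist2 p')))"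
    by (rule sum.swap)
  also have "\<dots> = (\<Sum>p\<in>E\<times>E. \<Sum>p'\<in>E\<times>E. \<Sum>s\<in>F. \<chi> (s * (dist2 p - r * dist2 p')))"
    by (rule sum.cong[OF refl]) (rule sum.swap)
  also have "\<dots> = (\<Sum>p\<in>E\<times>E. \<Sum>p'\<in>E\<times>E. of_nat (card F) * of_bool (dist2 p = r * dist2 p'))"
    by (intro sum.cong refl) (use r in \<open>simp add: sum_F_\<chi> dist2_in[OF E]\<close>)
  finally show ?thesis by (simp add: quads_def sum_distrib_left of_bool_def if_distrib cong: if_cong)
qed

lemma T_0: assumes E: "E \<subseteq> V" shows "T E 0 = of_nat ((card E)\<^sup>2)"
  by (simp add: T_def card_cartesian_product power2_eq_square)

text \<open>All phases are bounded by 1: the Gauss sum contributes \<open>sqrt (card V)\<close> and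
  Plancherel evaluates the rest.\<close>

lemma norm_T_le:
  assumes E: "E \<subseteq> V" and s: "s \<in> Fs"
  shows "norm (T E s) \<le> sqrt (card V) * card E"
proof -
  have V: "card V > 0" using finite_V V_0 card_gt_0_iff by blast
  have "norm (\<Sum>\<xi>\<in>V. of_real (spectrum E \<xi>) * \<chi> (- (iv s * Q \<xi>))) \<le> (\<Sum>\<xi>\<in>V. spectrum E \<xi>)"
    by (rule order_trans[OF norm_sum], rule sum_mono) 
       (use s in \<open>simp add: norm_mult norm_\<chi> spectrum_nonneg\<close>)
  then have "norm (\<Gamma> V s * (\<Sum>\<xi>\<in>V. of_real (spectrum E \<xi>) * \<chi> (- (iv s * Q \<xi>)))) \<le> sqrt (card V) * (card V * card E)"
    unfolding norm_mult norm_\<Gamma>[OF s] sum_spectrum[OF E] by (intro mult_left_mono) auto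
  then have "card V * norm (T E s) \<le> card V * (sqrt (card V) * card E)"
    unfolding T_spectrum[OF E s, symmetric] by (simp add: norm_mult mult.left_commute)
  then show ?thesis using V by simp
qed

text \<open>The frequency 0 supplies the main term \<open>card E ^ 4\<close>, and each of the other
  \<open>card F - 1\<close> frequencies is bounded by \<open>norm_T_le\<close>. It serves arbitrary
  ratios in odd dimension, where \<open>\<Gamma> V (r * s)\<close> and \<open>\<Gamma> V s\<close>
  may have opposite signs.\<close>

lemma quads_ge_crude:
  assumes E: "E \<subseteq> V" and r: "r \<in> Fs"
  shows "card F * quads E r \<ge> real (card E) ^ 4 - (real (card F) - 1) * (card V * (card E)\<^sup>2)"
proof -
  let ?S = "\<Sum>s\<in>Fs. T E s * cnj (T E (r * s))"
  have "of_nat (card F) * of_real (quads E r) = T E 0 * cnj (T E (r * 0)) + ?S"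
    using quads_T[OF E, of r] r finite_F by (simp add: sum.remove[of F 0])
  then have eq: "?S = of_real (card F * quads E r - real (card E) ^ 4)"
    by (simp add: T_0[OF E] power_mult[symmetric] flip: power_add)
  have "norm ?S \<le> (\<Sum>s\<in>Fs. real (card V) * (card E)\<^sup>2)"
  proof (rule order_trans[OF norm_sum], rule sum_mono)
    fix s assume s: "s \<in> Fs"
    have "norm (T E s * cnj (T E (r * s))) \<le> (sqrt (card V) * card E) * (sqrt (card V) * card E)"
      unfolding norm_mult complex_mod_cnj using s r by (intro mult_mono norm_T_le E) auto
    also have "\<dots> = real (card V) * (card E)\<^sup>2"
      by (simp add: power2_eq_square algebra_simps)
    finally show "norm (T E s * cnj (T E (r * s))) \<le> real (card V) * (card E)\<^sup>2" .
  qed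
  then have "\<bar>card F * quads E r - real (card E) ^ 4\<bar> \<le> real (card Fs) * (card V * (card E)\<^sup>2)"
    unfolding eq norm_of_real by simp
  moreover have "real (card Fs) = real (card F) - 1" using finite_F card_F_ge_3 by (simp add: of_nat_diff)
  ultimately show ?thesis by simp
qed

text \<open>Kept as a separate quantity because it enters both \<open>quads\<close> and
  \<open>zero_pairs\<close>, and in even dimension its large contributions to the two
  cancel.\<close>

definition isotropic_mass :: "'v set \<Rightarrow> real" where
  "isotropic_mass E = (\<Sum>\<xi>\<in>V. of_bool (Q \<xi> = 0) * spectrum E \<xi>)"

lemma isotropic_mass_bounds:
  assumes "E \<subseteq> V"
  shows "0 \<le> isotropic_mass E" "isotropic_mass E \<le> card V * card E"
proof -
  show "0 \<le> isotropic_mass E" unfolding isotropic_mass_def 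
    by (intro sum_nonneg) (simp add: spectrum_nonneg)
  show "isotropic_mass E \<le> card V * card E" 
    unfolding isotropic_mass_def sum_spectrum[OF assms, symmetric]
    by (intro sum_mono) (simp add: spectrum_nonneg)
qed

text \<open>As the Gauss sums at \<open>s\<close> and \<open>r * s\<close> agree, their product in
  \<open>T E s * cnj (T E (r * s))\<close> collapses to \<open>card V\<close>. Summing the remaining
  phases over \<open>s\<close> gives \<open>card F\<close> on the pairs with
  \<open>iv r * Q \<zeta> = Q \<xi>\<close>, minus 1 everywhere. The minus 1 is the Plancherel loss,
  and the isotropic cone gives the gain.\<close>

lemma quads_ge_split:
  assumes E: "E \<subseteq> V" and r: "r \<in> Fs" 
    and \<Gamma>: "\<And>s. s \<in> Fs \<Longrightarrow> \<Gamma> V (r * s) = \<Gamma> V s"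
  shows "card F * quads E r \<ge> real (card E) ^ 4 - card V * (card E)\<^sup>2 + card F * (isotropic_mass E)\<^sup>2 / card V"
proof -
  have V: "card V > 0" using finite_V V_0 card_gt_0_iff by blast
  let ?S = "\<Sum>s\<in>Fs. T E s * cnj (T E (r * s))"
  let ?f = "spectrum E"
  have "of_nat (card F) * of_real (quads E r) = T E 0 * cnj (T E (r * 0)) + ?S"
    using quads_T[OF E, of r] r finite_F by (simp add: sum.remove[of F 0])
  then have eq: "?S = of_real (card F * quads E r - real (card E) ^ 4)"
    by (simp add: T_0[OF E] power_mult[symmetric] flip: power_add)
  have prd: "of_nat (card V) * (T E s * cnj (T E (r * s))) = 
     (\<Sum>\<xi>\<in>V. \<Sum>\<zeta>\<in>V. of_real (?f \<xi> * ?f \<zeta>) * \<chi> ((iv r * Q \<zeta> - Q \<xi>) * iv s))" if s: "s \<in> Fs" for s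
  proof -
    have rs: "r * s \<in> Fs" using r s by simp
    have "of_nat (card V) * (of_nat (card V) * (T E s * cnj (T E (r * s)))) = 
      (of_nat (card V) * T E s) * cnj (of_nat (card V) * T E (r * s))" by simp
    also have "\<dots> = (\<Gamma> V s * cnj (\<Gamma> V s)) * ((\<Sum>\<xi>\<in>V. of_real (?f \<xi>) * \<chi> (- (iv s * Q \<xi>))) 
         * cnj (\<Sum>\<xi>\<in>V. of_real (?f \<xi>) * \<chi> (- (iv (r * s) * Q \<xi>))))"
      unfolding T_spectrum[OF E s] T_spectrum[OF E rs] \<Gamma>[OF s] by simp
    also have "\<dots> = of_nat (card V) * ((\<Sum>\<xi>\<in>V. of_real (?f \<xi>) * \<chi> (- (iv s * Q \<xi>))) 
         * cnj (\<Sum>\<xi>\<in>V. of_real (?f \<xi>) * \<chi> (- (iv (r * s) * Q \<xi>))))"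
      unfolding \<Gamma>_mult_cnj[OF s] ..
    also have "(\<Sum>\<xi>\<in>V. of_real (?f \<xi>) * \<chi> (- (iv s * Q \<xi>))) 
         * cnj (\<Sum>\<xi>\<in>V. of_real (?f \<xi>) * \<chi> (- (iv (r * s) * Q \<xi>))) = 
       (\<Sum>\<xi>\<in>V. \<Sum>\<zeta>\<in>V. of_real (?f \<xi> * ?f \<zeta>) * \<chi> ((iv r * Q \<zeta> - Q \<xi>) * iv s))"
      unfolding cnj_sum sum_product
    proof (intro sum.cong refl)
      fix \<xi> \<zeta> assume *: "\<xi> \<in> V" "\<zeta> \<in> V"
      have F: "- (iv s * Q \<xi>) \<in> F" "iv (r * s) * Q \<zeta> \<in> F" using * s rs by auto
      have "(iv r * Q \<zeta> - Q \<xi>) * iv s = - (iv s * Q \<xi>) + iv (r * s) * Q \<zeta>"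
        using r s by (simp add: iv_prod algebra_simps)
      then have "\<chi> ((iv r * Q \<zeta> - Q \<xi>) * iv s) = \<chi> (- (iv s * Q \<xi>)) * \<chi> (iv (r * s) * Q \<zeta>)"
        using \<chi>_add[OF F] by simp
      then show "of_real (?f \<xi>) * \<chi> (- (iv s * Q \<xi>)) * cnj (of_real (?f \<zeta>) * \<chi> (- (iv (r * s) * Q \<zeta>))) = 
         of_real (?f \<xi> * ?f \<zeta>) * \<chi> ((iv r * Q \<zeta> - Q \<xi>) * iv s)"
        using \<chi>_uminus[OF F(2)] by simp
    qed
    finally show ?thesis using V by simp
  qed
  have "of_nat (card V) * ?S = (\<Sum>s\<in>Fs. \<Sum>\<xi>\<in>V. \<Sum>\<zeta>\<in>V. of_real (?f \<xi> * ?f \<zeta>) * \<chi> ((iv r * Q \<zeta> - Q \<xi>) * iv s))"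
    unfolding sum_distrib_left using prd by (intro sum.cong refl) blast
  also have "\<dots> = (\<Sum>\<xi>\<in>V. \<Sum>s\<in>Fs. \<Sum>\<zeta>\<in>V. of_real (?f \<xi> * ?f \<zeta>) * \<chi> ((iv r * Q \<zeta> - Q \<xi>) * iv s))"
    by (rule sum.swap)
  also have "\<dots> = (\<Sum>\<xi>\<in>V. \<Sum>\<zeta>\<in>V. \<Sum>s\<in>Fs. of_real (?f \<xi> * ?f \<zeta>) * \<chi> ((iv r * Q \<zeta> - Q \<xi>) * iv s))"
    by (rule sum.cong[OF refl]) (rule sum.swap)
  also have "\<dots> = (\<Sum>\<xi>\<in>V. \<Sum>\<zeta>\<in>V. of_real (?f \<xi> * ?f \<zeta> * (real (card F) * of_bool (iv r * Q \<zeta> = Q \<xi>) - 1)))"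
  proof (intro sum.cong refl)
    fix \<xi> \<zeta> assume *: "\<xi> \<in> V" "\<zeta> \<in> V"
    let ?c = "iv r * Q \<zeta> - Q \<xi>"
    have c: "?c \<in> F" using * r by simp
    have "(\<Sum>s\<in>Fs. of_real (?f \<xi> * ?f \<zeta>) * \<chi> (?c * iv s)) = of_real (?f \<xi> * ?f \<zeta>) * (\<Sum>s\<in>Fs. \<chi> (?c * s))"
      unfolding sum_distrib_left[symmetric] using sum_Fs_iv[of "\<lambda>s. \<chi> (?c * s)"] by simp
    also have "(\<Sum>s\<in>Fs. \<chi> (?c * s)) = of_real (real (card F) * of_bool (iv r * Q \<zeta> = Q \<xi>) - 1)"
      unfolding sum_Fs_\<chi>[OF c] by simp
    finally show "(\<Sum>s\<in>Fs. of_real (?f \<xi> * ?f \<zeta>) * \<chi> (?c * iv s)) = 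
       complex_of_real (?f \<xi> * ?f \<zeta> * (real (card F) * of_bool (iv r * Q \<zeta> = Q \<xi>) - 1))" by simp
  qed
  finally have "complex_of_real (card V * (card F * quads E r - real (card E) ^ 4)) = 
     complex_of_real (\<Sum>\<xi>\<in>V. \<Sum>\<zeta>\<in>V. ?f \<xi> * ?f \<zeta> * (real (card F) * of_bool (iv r * Q \<zeta> = Q \<xi>) - 1))"
    unfolding eq by simp
  then have "card V * (card F * quads E r - real (card E) ^ 4) = 
     (\<Sum>\<xi>\<in>V. \<Sum>\<zeta>\<in>V. ?f \<xi> * ?f \<zeta> * (real (card F) * of_bool (iv r * Q \<zeta> = Q \<xi>) - 1))"
    by (simp only: of_real_eq_iff)
  \<comment> \<open>Of the pairs with \<open>iv r * Q \<zeta> = Q \<xi>\<close> only those with both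
    values 0 are kept; the weights are nonnegative.\<close>
  also have "\<dots> \<ge> (\<Sum>\<xi>\<in>V. \<Sum>\<zeta>\<in>V. ?f \<xi> * ?f \<zeta> * (real (card F) * (of_bool (Q \<xi> = 0) * of_bool (Q \<zeta> = 0)) - 1))"
    by (intro sum_mono mult_left_mono diff_right_mono) (auto simp: spectrum_nonneg)
  also have "(\<Sum>\<xi>\<in>V. \<Sum>\<zeta>\<in>V. ?f \<xi> * ?f \<zeta> * (real (card F) * (of_bool (Q \<xi> = 0) * of_bool (Q \<zeta> = 0)) - 1)) = 
     card F * (isotropic_mass E)\<^sup>2 - (\<Sum>\<xi>\<in>V. ?f \<xi>)\<^sup>2"
  proof -
    have "card F * (isotropic_mass E)\<^sup>2 = (\<Sum>\<xi>\<in>V. \<Sum>\<zeta>\<in>V. card F * ((of_bool (Q \<xi> = 0) * ?f \<xi>) * (of_bool (Q \<zeta> = 0) * ?f \<zeta>)))"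
      unfolding isotropic_mass_def power2_eq_square sum_product by (simp only: sum_distrib_left)
    moreover have "(\<Sum>\<xi>\<in>V. ?f \<xi>)\<^sup>2 = (\<Sum>\<xi>\<in>V. \<Sum>\<zeta>\<in>V. ?f \<xi> * ?f \<zeta>)"
      unfolding power2_eq_square sum_product ..
    ultimately show ?thesis by (simp add: algebra_simps flip: sum_subtractf)
  qed
  finally have "card F * (isotropic_mass E)\<^sup>2 - (card V * card E)\<^sup>2 \<le> card V * (card F * quads E r - real (card E) ^ 4)"
    unfolding sum_spectrum[OF E] by simp
  then have "(card F * (isotropic_mass E)\<^sup>2 - (card V * card E)\<^sup>2) / card V \<le> card F * quads E r - real (card E) ^ 4"
    using V by (simp add: divide_le_eq mult.commute)
  moreover have "(card F * (isotropic_mass E)\<^sup>2 - (card V * card E)\<^sup>2) / card V = 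
      card F * (isotropic_mass E)\<^sup>2 / card V - card V * (card E)\<^sup>2"
    using V by (simp add: field_simps power2_eq_square)
  ultimately show ?thesis by simp
qed

lemma zero_pairs_spectrum:
  assumes E: "E \<subseteq> V"
  shows "of_nat (card V) * (of_nat (card F) * of_real (zero_pairs E) - of_nat ((card E)\<^sup>2)) = 
    (\<Sum>\<xi>\<in>V. of_real (spectrum E \<xi>) * (\<Sum>s\<in>Fs. \<Gamma> V s * \<chi> (- (iv s * Q \<xi>))))"
proof -
  have "of_nat (card F) * of_real (zero_pairs E) - of_nat ((card E)\<^sup>2) = (\<Sum>s\<in>Fs. T E s)"
    using zero_pairs_T[OF E] T_0[OF E] finite_F by (simp add: sum.remove[of F 0])
  then have "of_nat (card V) * (of_nat (card F) * of_real (zero_pairs E) - of_nat ((card E)\<^sup>2)) = 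
      (\<Sum>s\<in>Fs. of_nat (card V) * T E s)" by (simp only: sum_distrib_left)
  also have "\<dots> = (\<Sum>s\<in>Fs. \<Sum>\<xi>\<in>V. of_real (spectrum E \<xi>) * (\<Gamma> V s * \<chi> (- (iv s * Q \<xi>))))"
    by (rule sum.cong[OF refl]) (simp only: T_spectrum[OF E] sum_distrib_left ac_simps)
  also have "\<dots> = (\<Sum>\<xi>\<in>V. \<Sum>s\<in>Fs. of_real (spectrum E \<xi>) * (\<Gamma> V s * \<chi> (- (iv s * Q \<xi>))))"
    by (rule sum.swap)
  finally show ?thesis by (simp only: sum_distrib_left)
qed

text \<open>\<open>norm_sum_\<Gamma>_odd\<close> bounds the inner sum over \<open>s\<close>
  uniformly in \<open>\<xi>\<close>; Plancherel sums the weights.\<close>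

lemma zero_pairs_odd:
  assumes E: "E \<subseteq> V" and V: "card V = card F ^ d" "odd d"
  shows "\<bar>card F * zero_pairs E - (card E)\<^sup>2\<bar> \<le> sqrt (card F ^ Suc d) * card E"
proof -
  have V0: "card V > 0" using finite_V V_0 card_gt_0_iff by blast
  have "norm (\<Sum>\<xi>\<in>V. of_real (spectrum E \<xi>) * (\<Sum>s\<in>Fs. \<Gamma> V s * \<chi> (- (iv s * Q \<xi>)))) \<le> 
     (\<Sum>\<xi>\<in>V. spectrum E \<xi> * sqrt (card F ^ Suc d))"
    by (rule order_trans[OF norm_sum], rule sum_mono) 
       (auto simp: norm_mult spectrum_nonneg intro!: mult_left_mono norm_sum_\<Gamma>_odd[OF V, simplified])
  also have "\<dots> = card V * card E * sqrt (card F ^ Suc d)" 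
    unfolding sum_distrib_right[symmetric] sum_spectrum[OF E] by simp
  finally have "norm (complex_of_real (card V * (card F * zero_pairs E - (card E)\<^sup>2))) \<le> card V * card E * sqrt (card F ^ Suc d)"
    unfolding zero_pairs_spectrum[OF E, symmetric] by simp
  then have "card V * \<bar>card F * zero_pairs E - (card E)\<^sup>2\<bar> \<le> card V * (sqrt (card F ^ Suc d) * card E)"
    unfolding norm_of_real abs_mult by (simp add: ac_simps)
  then show ?thesis using V0 by simp
qed

text \<open>When the Gauss sum is a real constant \<open>g\<close>, the inner sum over
  \<open>s\<close> is \<open>g * (card F - 1)\<close> on the isotropic cone and \<open>- g\<close>
  off it, so the count is exact.\<close>

lemma zero_pairs_even:
  assumes E: "E \<subseteq> V" and g: "\<And>s. s \<in> Fs \<Longrightarrow> \<Gamma> V s = of_real g"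
  shows "card V * (card F * zero_pairs E - (card E)\<^sup>2) = g * (card F * isotropic_mass E - card V * card E)"
proof -
  have "complex_of_real (card V * (card F * zero_pairs E - (card E)\<^sup>2)) = 
      (\<Sum>\<xi>\<in>V. of_real (spectrum E \<xi>) * (\<Sum>s\<in>Fs. \<Gamma> V s * \<chi> (- (iv s * Q \<xi>))))"
    using zero_pairs_spectrum[OF E] by simp
  also have "\<dots> = (\<Sum>\<xi>\<in>V. complex_of_real (g * (real (card F) * (of_bool (Q \<xi> = 0) * spectrum E \<xi>) - spectrum E \<xi>)))"
  proof (rule sum.cong[OF refl])
    fix \<xi> assume \<xi>: "\<xi> \<in> V"
    have "(\<Sum>s\<in>Fs. \<Gamma> V s * \<chi> (- (iv s * Q \<xi>))) = (\<Sum>s\<in>Fs. of_real g * \<chi> ((- Q \<xi>) * iv s))"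
      by (rule sum.cong[OF refl]) (simp add: g mult.commute)
    also have "\<dots> = of_real g * (\<Sum>s\<in>Fs. \<chi> ((- Q \<xi>) * s))"
      unfolding sum_distrib_left[symmetric] using sum_Fs_iv[of "\<lambda>s. \<chi> ((- Q \<xi>) * s)"] by simp
    also have "\<dots> = of_real (g * (real (card F) * of_bool (Q \<xi> = 0) - 1))"
      unfolding sum_Fs_\<chi>[OF F_uminus[OF Q_in[OF \<xi>]]] by simp
    finally have *: "(\<Sum>s\<in>Fs. \<Gamma> V s * \<chi> (- (iv s * Q \<xi>))) = of_real (g * (real (card F) * of_bool (Q \<xi> = 0) - 1))" .
    show "of_real (spectrum E \<xi>) * (\<Sum>s\<in>Fs. \<Gamma> V s * \<chi> (- (iv s * Q \<xi>))) = 
       complex_of_real (g * (real (card F) * (of_bool (Q \<xi> = 0) * spectrum E \<xi>) - spectrum E \<xi>))"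
      unfolding * by (simp add: algebra_simps)
  qed
  also have "\<dots> = complex_of_real (g * (card F * isotropic_mass E - card V * card E))"
    unfolding isotropic_mass_def sum_spectrum[OF E, symmetric]
    by (simp add: sum_distrib_left sum_subtractf algebra_simps)
  finally show ?thesis by (simp only: of_real_eq_iff)
qed

definition ratio_quads :: "'v set \<Rightarrow> 'k \<Rightarrow> real" where
  "ratio_quads E r = (\<Sum>p\<in>E\<times>E. \<Sum>p'\<in>E\<times>E. of_bool (dist2 p' \<noteq> 0 \<and> dist2 p = r * dist2 p'))"

text \<open>If \<open>dist2 p' = 0\<close>, proportionality forces \<open>dist2 p = 0\<close> too,
  so the quadruples to discard are exactly the pairs of distance-zero pairs.\<close>

lemma ratio_quads_eq: "ratio_quads E r = quads E r - (zero_pairs E)\<^sup>2"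
proof -
  have "of_bool (dist2 p' \<noteq> 0 \<and> dist2 p = r * dist2 p') = 
     (of_bool (dist2 p = r * dist2 p') - of_bool (dist2 p = 0) * of_bool (dist2 p' = 0) :: real)" for p p'
    by auto
  then show ?thesis unfolding ratio_quads_def quads_def zero_pairs_def power2_eq_square sum_product
    by (simp add: sum_subtractf)
qed

end

section \<open>Bounds for the number of ratios\<close>

text \<open>In the set from \<open>ex_degenerate_subset\<close> a nonzero value of \<open>Q\<close>
  forces \<open>a \<noteq> 0\<close>, and \<open>a\<close> then cancels from every ratio.\<close>

lemma (in bspace) ex_ratio_avoiding:
  assumes V: "card V = card F ^ d" and k: "2 * k + 1 \<le> d" and S: "S \<subseteq> F" and r: "r \<in> F"
    and avoid: "\<And>t t' u u'. t \<in> S \<Longrightarrow> t' \<in> S \<Longrightarrow> u \<in> S \<Longrightarrow> u' \<in> S \<Longrightarrow> u \<noteq> u' \<Longrightarrow> (t - t')\<^sup>2 \<noteq> r * (u - u')\<^sup>2"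
  shows "\<exists>E\<subseteq>V. card E = card F ^ k * card S \<and> 
    (\<forall>x\<in>E. \<forall>y\<in>E. \<forall>z\<in>E. \<forall>w\<in>E. Q (z - w) \<noteq> 0 \<longrightarrow> Q (x - y) \<noteq> r * Q (z - w))"
proof -
  obtain a E where a: "a \<in> F" and E: "E \<subseteq> V" "card E = card F ^ k * card S"
    and dist: "\<And>x y. x \<in> E \<Longrightarrow> y \<in> E \<Longrightarrow> \<exists>t\<in>S. \<exists>t'\<in>S. Q (x - y) = a * (t - t')\<^sup>2"
    using ex_degenerate_subset[OF V k S] by blast
  have "Q (x - y) \<noteq> r * Q (z - w)" 
    if *: "x \<in> E" "y \<in> E" "z \<in> E" "w \<in> E" "Q (z - w) \<noteq> 0" for x y z w
  proof
    assume eq: "Q (x - y) = r * Q (z - w)"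
    obtain t t' where t: "t \<in> S" "t' \<in> S" "Q (x - y) = a * (t - t')\<^sup>2" using dist[OF *(1,2)] by blast
    obtain u u' where u: "u \<in> S" "u' \<in> S" "Q (z - w) = a * (u - u')\<^sup>2" using dist[OF *(3,4)] by blast
    have "t \<in> F" "t' \<in> F" "u \<in> F" "u' \<in> F" using t u S by auto
    then have F: "(t - t')\<^sup>2 \<in> F" "r * (u - u')\<^sup>2 \<in> F" using r by simp_all
    have ne: "a \<noteq> 0" "u \<noteq> u'" using *(5) u by auto
    have "a * (t - t')\<^sup>2 = a * (r * (u - u')\<^sup>2)" using eq t u by (simp add: mult.left_commute)
    then have "(t - t')\<^sup>2 = r * (u - u')\<^sup>2" using F_cancel[OF a F ne(1)] by simp
    then show False using avoid t u ne by blast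
  qed
  then show ?thesis using E by blast
qed

text \<open>With \<open>S = F\<close> every nonzero ratio is a square, and the full line contributes
  the extra factor \<open>card F\<close>.\<close>

lemma (in bspace) ex_nonsquare_avoiding:
  assumes V: "card V = card F ^ d" and k: "2 * k + 1 \<le> d"
  shows "\<exists>r\<in>Fs. \<exists>E\<subseteq>V. card E = card F ^ Suc k \<and> 
    (\<forall>x\<in>E. \<forall>y\<in>E. \<forall>z\<in>E. \<forall>w\<in>E. Q (z - w) \<noteq> 0 \<longrightarrow> Q (x - y) \<noteq> r * Q (z - w))"
proof -
  obtain n where n: "n \<in> Fs" "n \<notin> squares" using ex_nonsquare by auto
  then have nF: "n \<in> F" by simp
  have "(t - t')\<^sup>2 \<noteq> n * (u - u')\<^sup>2" if "t \<in> F" "t' \<in> F" "u \<in> F" "u' \<in> F" "u \<noteq> u'" for t t' u u'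
    using nonsquare_not_ratio[OF n, of "t - t'" "u - u'"] that by simp
  from ex_ratio_avoiding[OF V k order_refl nF this] n(1) show ?thesis
    by (intro bexI[of _ n]) (simp_all add: mult.commute)
qed

text \<open>Here \<open>q = card F\<close>, \<open>P = sqrt (card V)\<close>,
  \<open>c = card E\<close>, \<open>S\<close> is the isotropic mass over \<open>P\<close>, and
  \<open>N\<close>, \<open>z\<close> stand for \<open>quads\<close>, \<open>zero_pairs\<close>; the
  alternatives for \<open>z\<close> are the two signs of the Gauss sum. The term
  \<open>q * S\<^sup>2\<close> cancels against the square of \<open>z\<close>, and with
  \<open>y \<le> x / 4\<close> the signs leave \<open>3 / 8\<close> and \<open>5 / 12\<close> of
  \<open>x\<^sup>2\<close>, both above \<open>5 / 48\<close>.\<close>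

lemma ratio_bound_even:
  fixes q P c S N z :: real
  assumes q: "q \<ge> 3" and P: "P \<ge> 0" and c: "c \<ge> 4 * P" and S: "0 \<le> S" "S \<le> P * c"
    and N: "q * N \<ge> c ^ 4 - P\<^sup>2 * c\<^sup>2 + q * S\<^sup>2"
    and z: "q * z = c\<^sup>2 + (q * S - P * c) \<or> q * z = c\<^sup>2 - (q * S - P * c)"
  shows "N - z\<^sup>2 \<ge> 5 * c ^ 4 / (48 * q)"
proof -
  define x y where "x = c\<^sup>2" and "y = P * c"
  have c0: "c \<ge> 0" using P c by linarith
  have xy: "0 \<le> y" "4 * y \<le> x" "S \<le> y" unfolding x_def y_def power2_eq_square
    using P c c0 S mult_right_mono[OF c c0] by auto
  have N': "q * N \<ge> x\<^sup>2 - y\<^sup>2 + q * S\<^sup>2" using N unfolding x_def y_def 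
    by (simp add: power_mult_distrib flip: power_mult)
  have frac: "t\<^sup>2 / q \<le> t\<^sup>2 / 3" for t :: real using q by (intro divide_left_mono) auto
  have key: "q * (N - z\<^sup>2) \<ge> 5 / 48 * x\<^sup>2"
    using z
  proof
    assume z: "q * z = c\<^sup>2 + (q * S - P * c)"
    have zS: "z = S + (x - y) / q" using z q by (simp add: x_def y_def field_simps)
    have "q * z\<^sup>2 = q * S\<^sup>2 + 2 * S * (x - y) + (x - y)\<^sup>2 / q"
      unfolding zS using q by (simp add: power2_eq_square field_simps)
    moreover have "2 * S * (x - y) \<le> 2 * y * (x - y)" using xy by (intro mult_right_mono) auto
    ultimately have "q * (N - z\<^sup>2) \<ge> x\<^sup>2 - y\<^sup>2 - 2 * y * (x - y) - (x - y)\<^sup>2 / 3"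
      using N' frac[of "x - y"] by (simp add: algebra_simps)
    \<comment> \<open>The first three terms combine to \<open>(x - y)\<^sup>2\<close>.\<close>
    also have "x\<^sup>2 - y\<^sup>2 - 2 * y * (x - y) - (x - y)\<^sup>2 / 3 = 2 / 3 * (x - y)\<^sup>2"
      by (simp add: power2_eq_square field_simps)
    finally have "q * (N - z\<^sup>2) \<ge> 2 / 3 * (x - y)\<^sup>2" .
    moreover have "(x - y)\<^sup>2 \<ge> (3 / 4 * x)\<^sup>2" using xy by (intro power_mono) auto
    moreover have "(3 / 4 * x)\<^sup>2 = 9 / 16 * x\<^sup>2" by (simp add: power_mult_distrib power2_eq_square)
    ultimately show ?thesis using zero_le_power2[of x] by argo
  next
    assume z: "q * z = c\<^sup>2 - (q * S - P * c)"
    have zS: "z = (x + y) / q - S" using z q by (simp add: x_def y_def field_simps)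
    have "q * z\<^sup>2 = q * S\<^sup>2 - 2 * S * (x + y) + (x + y)\<^sup>2 / q"
      unfolding zS using q by (simp add: power2_eq_square field_simps)
    moreover have "0 \<le> 2 * S * (x + y)" using xy S by simp
    ultimately have "q * (N - z\<^sup>2) \<ge> x\<^sup>2 - y\<^sup>2 - (x + y)\<^sup>2 / 3"
      using N' frac[of "x + y"] by (simp add: algebra_simps)
    moreover have "(x + y)\<^sup>2 \<le> (5 / 4 * x)\<^sup>2" using xy by (intro power_mono) auto
    moreover have "y\<^sup>2 \<le> (x / 4)\<^sup>2" using xy by (intro power_mono) auto
    moreover have "(5 / 4 * x)\<^sup>2 = 25 / 16 * x\<^sup>2" "(x / 4)\<^sup>2 = 1 / 16 * x\<^sup>2"
      by (simp_all add: power_mult_distrib power2_eq_square)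
    ultimately show ?thesis using zero_le_power2[of x] by argo
  qed
  moreover have "x\<^sup>2 = c ^ 4" by (simp add: x_def flip: power_mult)
  ultimately show ?thesis using q by (simp add: field_simps)
qed

text \<open>Variables as in \<open>ratio_bound_even\<close>, without the isotropic mass. Dividing
  the bound on \<open>q * z\<close> by \<open>sqrt q\<close> gives
  \<open>sqrt q * z \<le> x / sqrt q + y\<close>, which \<open>y \<le> x / 3\<close> and
  \<open>q \<ge> 3\<close> keep below a fixed fraction of \<open>x\<close>.\<close>

lemma ratio_bound_odd_square:
  fixes q P c N z :: real
  assumes q: "q \<ge> 3" and P: "P \<ge> 0" and c: "c \<ge> 3 * P"
    and N: "q * N \<ge> c ^ 4 - P\<^sup>2 * c\<^sup>2"
    and z: "0 \<le> z" "q * z \<le> c\<^sup>2 + sqrt q * P * c"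
  shows "N - z\<^sup>2 \<ge> 2 * c ^ 4 / (45 * q)"
proof -
  define x y h where "x = c\<^sup>2" and "y = P * c" and "h = sqrt q"
  have c0: "c \<ge> 0" using P c by linarith
  have xy: "0 \<le> y" "3 * y \<le> x" unfolding x_def y_def power2_eq_square
    using P c c0 mult_right_mono[OF c c0] by auto
  have N': "q * N \<ge> x\<^sup>2 - y\<^sup>2" using N unfolding x_def y_def 
    by (simp add: power_mult_distrib flip: power_mult)
  have hq: "h\<^sup>2 = q" using q by (simp add: h_def)
  \<comment> \<open>\<open>173 / 100\<close> is a rational lower bound for \<open>sqrt 3\<close>.
    Then \<open>100 / 173 + 1 / 3 < 912 / 1000\<close>, and
    \<open>1 - 1 / 9 - (912 / 1000)\<^sup>2\<close> exceeds \<open>2 / 45\<close>.\<close>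
  have h: "h \<ge> 173 / 100" unfolding h_def using q by (intro real_le_rsqrt) (simp add: power2_eq_square)
  have "h * (h * z) = q * z" unfolding hq[symmetric] by (simp add: power2_eq_square)
  moreover have "h * (x / h + y) = x + h * y" using h by (simp add: distrib_left)
  moreover have "q * z \<le> x + h * y" using z(2) by (simp add: x_def y_def h_def mult.assoc)
  ultimately have "h * (h * z) \<le> h * (x / h + y)" by linarith
  then have "h * z \<le> x / h + y" using h by simp
  also have "x / h \<le> x / (173 / 100)" using h xy by (intro divide_left_mono) auto
  finally have "h * z \<le> 912 / 1000 * x" using xy by simp
  then have "(h * z)\<^sup>2 \<le> (912 / 1000 * x)\<^sup>2" using h z by (intro power_mono) auto
  then have "q * z\<^sup>2 \<le> (912 / 1000 * x)\<^sup>2" using hq by (simp add: power_mult_distrib)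
  moreover have "y\<^sup>2 \<le> (x / 3)\<^sup>2" using xy by (intro power_mono) auto
  moreover have "(912 / 1000 * x)\<^sup>2 = 12996 / 15625 * x\<^sup>2" "(x / 3)\<^sup>2 = 1 / 9 * x\<^sup>2"
    by (simp_all add: power_mult_distrib power2_eq_square)
  moreover have "q * (N - z\<^sup>2) = q * N - q * z\<^sup>2" by (rule right_diff_distrib)
  ultimately have "q * (N - z\<^sup>2) \<ge> 2 / 45 * x\<^sup>2" using N' zero_le_power2[of x] by argo
  moreover have "x\<^sup>2 = c ^ 4" by (simp add: x_def flip: power_mult)
  ultimately show ?thesis using q by (simp add: field_simps)
qed

text \<open>Now \<open>y = sqrt q * P * c\<close> is at most \<open>6 / 11 * x\<close>. The constant
  is what remains at \<open>q = 3\<close> and \<open>y = 6 / 11 * x\<close>: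
  \<open>1 - 36 / 121 - 1 / 3 - 4 / 11 = 2 / 363\<close>.\<close>

lemma ratio_bound_odd:
  fixes q P c N z :: real
  assumes q: "q \<ge> 3" and P: "P \<ge> 0" and c: "c \<ge> 11 / 6 * (sqrt q * P)"
    and N: "q * N \<ge> c ^ 4 - (q - 1) * (P\<^sup>2 * c\<^sup>2)"
    and z: "0 \<le> z" "q * z \<le> c\<^sup>2 + sqrt q * P * c"
  shows "N - z\<^sup>2 \<ge> 2 * c ^ 4 / (363 * q)"
proof -
  define x y where "x = c\<^sup>2" and "y = sqrt q * P * c"
  have "0 \<le> 11 / 6 * (sqrt q * P)" using q P by simp
  then have c0: "c \<ge> 0" using c by linarith
  have xy: "0 \<le> y" "11 / 6 * y \<le> x" unfolding x_def y_def power2_eq_square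
    using P q c c0 mult_right_mono[OF c c0] by (auto simp: mult.assoc)
  have y2: "y\<^sup>2 = q * (P\<^sup>2 * c\<^sup>2)" using q by (simp add: y_def power_mult_distrib)
  \<comment> \<open>The factor \<open>q - 1\<close> instead of \<open>q\<close> leaves
    \<open>y\<^sup>2 / q\<close>, which removes the same term from
    \<open>(x + y)\<^sup>2 / q\<close>; otherwise the final coefficient would come out negative in
    the extreme case.\<close>
  have N': "q * N \<ge> x\<^sup>2 - y\<^sup>2 + y\<^sup>2 / q" using N q unfolding y2 x_def 
    by (simp add: algebra_simps flip: power_mult)
  have "(q * z)\<^sup>2 \<le> (x + y)\<^sup>2" using z q unfolding x_def y_def by (intro power_mono) auto
  then have "q * z\<^sup>2 \<le> (x + y)\<^sup>2 / q" using q by (simp add: field_simps power2_eq_square)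
  then have "q * (N - z\<^sup>2) \<ge> x\<^sup>2 - y\<^sup>2 - ((x + y)\<^sup>2 - y\<^sup>2) / q"
    using N' by (simp add: algebra_simps diff_divide_distrib)
  moreover have "((x + y)\<^sup>2 - y\<^sup>2) / q \<le> ((x + y)\<^sup>2 - y\<^sup>2) / 3" 
    using q xy by (intro divide_left_mono) (auto simp: power2_eq_square algebra_simps)
  moreover have "x\<^sup>2 - y\<^sup>2 - ((x + y)\<^sup>2 - y\<^sup>2) / 3 \<ge> 2 / 363 * x\<^sup>2"
  proof -
    have "y\<^sup>2 \<le> (6 / 11 * x)\<^sup>2" using xy by (intro power_mono) auto
    moreover have "x * y \<le> x * (6 / 11 * x)" using xy by (intro mult_left_mono) auto
    moreover have "((x + y)\<^sup>2 - y\<^sup>2) / 3 = (x\<^sup>2 + 2 * (x * y)) / 3" by (simp add: power2_eq_square algebra_simps)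
    moreover have "(6 / 11 * x)\<^sup>2 = 36 / 121 * x\<^sup>2" "x * (6 / 11 * x) = 6 / 11 * x\<^sup>2" by (simp_all add: power2_eq_square)
    ultimately show ?thesis by argo
  qed
  ultimately have "q * (N - z\<^sup>2) \<ge> 2 / 363 * x\<^sup>2" by linarith
  moreover have "x\<^sup>2 = c ^ 4" by (simp add: x_def flip: power_mult)
  ultimately show ?thesis using q by (simp add: field_simps)
qed

section \<open>Lower bounds by parity of the dimension and type of ratio\<close>

context nondeg_space
begin

lemma zero_pairs_nonneg: "zero_pairs E \<ge> 0"
  unfolding zero_pairs_def by (intro sum_nonneg) simp

lemma \<Gamma>_mult_square:
  assumes "r \<in> squares"
  shows "\<Gamma> V (r * s) = \<Gamma> V s"
proof -
  obtain u where "u \<in> Fs" "r = u\<^sup>2" using assms unfolding squares_def by blast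
  then show ?thesis using \<Gamma>_square[OF subsp_V, of u s] by (simp add: mult.commute)
qed

text \<open>For even \<open>d\<close> nonsquares preserve the Gauss sum as well, so it is constant
  on \<open>Fs\<close>. Passing from \<open>s\<close> to \<open>- s\<close> conjugates it, so the
  constant is real, hence plus or minus \<open>sqrt (card V)\<close>; these signs are the
  alternatives in \<open>ratio_bound_even\<close>.\<close>

lemma ratio_quads_even:
  assumes V: "card V = card F ^ d" "even d" and E: "E \<subseteq> V" "card E \<ge> 4 * sqrt (card F ^ d)" and r: "r \<in> Fs"
  shows "ratio_quads E r \<ge> 5 * real (card E) ^ 4 / (48 * real (card F))"
proof -
  let ?P = "sqrt (card V)"
  have V0: "card V > 0" using finite_V V_0 card_gt_0_iff by blast
  have const: "\<Gamma> V (r * s) = \<Gamma> V s" if "r \<in> Fs" "s \<in> Fs" for r s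
  proof (cases "r \<in> squares")
    case False
    then show ?thesis using \<Gamma>_nonsquare[of r s V d] that subsp_V nondeg V by simp
  qed (rule \<Gamma>_mult_square)
  have \<Gamma>_e: "\<Gamma> V s = \<Gamma> V e" if "s \<in> Fs" for s using const[OF that, of e] that by simp
  have "cnj (\<Gamma> V e) = \<Gamma> V e" using \<Gamma>_uminus[of e] \<Gamma>_e[of "- e"] by simp
  then obtain g where g: "\<Gamma> V e = of_real g" by (metis Reals_cases Reals_cnj_iff)
  have "\<bar>g\<bar> = ?P" using norm_\<Gamma>[of e] g by simp
  then have g': "g = ?P \<or> g = - ?P" by linarith
  define S where "S = isotropic_mass E / ?P"
  have mass: "isotropic_mass E = ?P * S" using V0 by (simp add: S_def)
  have P2: "?P * ?P = card V" by simp
  show ?thesis unfolding ratio_quads_eq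
  proof (rule ratio_bound_even)
    show "real (card F) \<ge> 3" using card_F_ge_3 by simp
    show "?P \<ge> 0" by simp
    show "4 * ?P \<le> card E" using E V by simp
    have "0 \<le> ?P * S" "?P * S \<le> ?P * (?P * card E)" 
      using isotropic_mass_bounds[OF E(1)] unfolding mass by (simp_all flip: mult.assoc)
    then show "0 \<le> S" "S \<le> ?P * card E" using V0 by (simp_all add: zero_le_mult_iff)
    have "(isotropic_mass E)\<^sup>2 / card V = S\<^sup>2" using V0 unfolding mass by (simp add: power_mult_distrib)
    then have "card F * (isotropic_mass E)\<^sup>2 / card V = card F * S\<^sup>2" by (simp flip: times_divide_eq_right)
    then show "real (card E) ^ 4 - ?P\<^sup>2 * (real (card E))\<^sup>2 + card F * S\<^sup>2 \<le> card F * quads E r"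
      using quads_ge_split[OF E(1) r const[OF r]] by simp
    have *: "card V * (card F * zero_pairs E - (card E)\<^sup>2) = g * (card F * isotropic_mass E - card V * card E)"
      by (rule zero_pairs_even[OF E(1)]) (simp add: \<Gamma>_e g)
    have eq: "g * (card F * isotropic_mass E - card V * card E) = (g * ?P) * (card F * S - ?P * card E)"
    proof -
      have "real (card V) * card E = ?P * (?P * card E)" by (simp flip: mult.assoc)
      then have "card F * isotropic_mass E - card V * card E = ?P * (card F * S - ?P * card E)"
        unfolding mass by (simp add: algebra_simps)
      then show ?thesis by (simp only: mult.assoc)
    qed
    have sign: "g * ?P = real (card V) \<or> g * ?P = - real (card V)" using g' P2 by auto
    have cancel: "a = b \<or> a = - b" if "v \<noteq> 0" "v * a = w * b" "w = v \<or> w = - v" for v w a b :: real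
    proof -
      have "v * (a - b) = 0 \<or> v * (a + b) = 0" using that by (auto simp: algebra_simps)
      then show ?thesis using that(1) by auto
    qed
    have "card F * zero_pairs E - (card E)\<^sup>2 = card F * S - ?P * card E \<or> 
        card F * zero_pairs E - (card E)\<^sup>2 = - (card F * S - ?P * card E)"
      by (rule cancel[OF _ trans[OF * eq] sign]) (use V0 in simp)
    then show "card F * zero_pairs E = (real (card E))\<^sup>2 + (card F * S - ?P * card E) \<or> 
        card F * zero_pairs E = (real (card E))\<^sup>2 - (card F * S - ?P * card E)" by auto
  qed
qed

lemma ratio_quads_odd_square:
  assumes V: "card V = card F ^ d" "odd d" and E: "E \<subseteq> V" "card E \<ge> 3 * sqrt (card F ^ d)" and r: "r \<in> squares"
  shows "ratio_quads E r \<ge> 2 * real (card E) ^ 4 / (45 * real (card F))"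
  unfolding ratio_quads_eq
proof (rule ratio_bound_odd_square)
  have rF: "r \<in> Fs" using r squares_subset by blast
  \<comment> \<open>The isotropic gain is nonnegative and is dropped.\<close>
  have "0 \<le> card F * (isotropic_mass E)\<^sup>2 / card V" by simp
  then have "real (card E) ^ 4 - card V * (card E)\<^sup>2 \<le> card F * quads E r"
    using quads_ge_split[OF E(1) rF \<Gamma>_mult_square[OF r]] by linarith
  then show "real (card E) ^ 4 - (sqrt (card V))\<^sup>2 * (real (card E))\<^sup>2 \<le> card F * quads E r" by simp
  show "card F * zero_pairs E \<le> (real (card E))\<^sup>2 + sqrt (card F) * sqrt (card V) * card E"
    using zero_pairs_odd[OF E(1) V] V(1) by (simp add: real_sqrt_mult)
qed (use card_F_ge_3 E V zero_pairs_nonneg in simp_all)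

lemma ratio_quads_odd:
  assumes V: "card V = card F ^ d" "odd d" and E: "E \<subseteq> V" "card E \<ge> 11 / 6 * sqrt (card F ^ Suc d)" and r: "r \<in> Fs"
  shows "ratio_quads E r \<ge> 2 * real (card E) ^ 4 / (363 * real (card F))"
  unfolding ratio_quads_eq
proof (rule ratio_bound_odd)
  show "real (card E) ^ 4 - (real (card F) - 1) * ((sqrt (card V))\<^sup>2 * (real (card E))\<^sup>2) \<le> card F * quads E r"
    using quads_ge_crude[OF E(1) r] by simp
  show "card F * zero_pairs E \<le> (real (card E))\<^sup>2 + sqrt (card F) * sqrt (card V) * card E"
    using zero_pairs_odd[OF E(1) V] V(1) by (simp add: real_sqrt_mult)
qed (use card_F_ge_3 E V zero_pairs_nonneg in \<open>simp_all add: real_sqrt_mult\<close>)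

end

section \<open>One commutative ring containing all finite fields over a type\<close>

text \<open>The elements are the families choosing an element of every commutative ring \<open>R :: 'a ring\<close>, with
  \<open>undefined\<close> at the records that are not commutative rings. The integer component only ensures
  \<open>0 \<noteq> 1\<close> when \<open>'a\<close> is too small. Each \<open>R\<close> embeds (without preserving 1) as the families supported at \<open>R\<close>,
  so calculations in \<open>R\<close> can be done in a type of class \<open>comm_ring_1\<close>.\<close>

typedef 'a all_crings = "{(n :: int, f :: 'a ring \<Rightarrow> 'a). \<forall>R. if cring R then f R \<in> carrier R else f R = undefined}"
proof
  show "(0, \<lambda>R. if cring R then \<zero>\<^bsub>R\<^esub> else undefined) \<in> 
    {(n :: int, f :: 'a ring \<Rightarrow> 'a). \<forall>R. if cring R then f R \<in> carrier R else f R = undefined}"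
    by (auto simp: cring.cring_simprules)
qed

setup_lifting type_definition_all_crings

instantiation all_crings :: (type) comm_ring_1
begin

lift_definition zero_all_crings :: "'a all_crings" is 
  "(0, \<lambda>R. if cring R then \<zero>\<^bsub>R\<^esub> else undefined)" by (auto simp: cring.cring_simprules)

lift_definition one_all_crings :: "'a all_crings" is 
  "(1, \<lambda>R. if cring R then \<one>\<^bsub>R\<^esub> else undefined)" by (auto simp: cring.cring_simprules)

lift_definition plus_all_crings :: "'a all_crings \<Rightarrow> 'a all_crings \<Rightarrow> 'a all_crings" is 
  "\<lambda>(m, f) (n, g). (m + n, \<lambda>R. if cring R then f R \<oplus>\<^bsub>R\<^esub> g R else undefined)" 
  by (auto simp: cring.cring_simprules split: if_splits)

lift_definition uminus_all_crings :: "'a all_crings \<Rightarrow> 'a all_crings" is 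
  "\<lambda>(m, f). (- m, \<lambda>R. if cring R then \<ominus>\<^bsub>R\<^esub> f R else undefined)" 
  by (auto simp: cring.cring_simprules split: if_splits)

definition minus_all_crings :: "'a all_crings \<Rightarrow> 'a all_crings \<Rightarrow> 'a all_crings" where
  "minus_all_crings x y = x + (- y)"

lift_definition times_all_crings :: "'a all_crings \<Rightarrow> 'a all_crings \<Rightarrow> 'a all_crings" is 
  "\<lambda>(m, f) (n, g). (m * n, \<lambda>R. if cring R then f R \<otimes>\<^bsub>R\<^esub> g R else undefined)" 
  by (auto simp: cring.cring_simprules split: if_splits)

instance
proof
  fix a b c :: "'a all_crings"
  show "a + b + c = a + (b + c)" 
    by transfer (auto simp: fun_eq_iff cring.cring_simprules split: if_splits)
  show "a + b = b + a" 
    by transfer (auto simp: fun_eq_iff cring.cring_simprules split: if_splits)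
  show "0 + a = a" 
    by (transfer, auto simp: fun_eq_iff cring.cring_simprules split: if_splits) metis
  show "- a + a = 0" 
    by transfer (auto simp: fun_eq_iff cring.cring_simprules split: if_splits)
  show "a - b = a + - b" by (rule minus_all_crings_def)
  show "a * b * c = a * (b * c)" 
    by transfer (auto simp: fun_eq_iff cring.cring_simprules split: if_splits)
  show "a * b = b * a" 
    by transfer (auto simp: fun_eq_iff cring.cring_simprules split: if_splits)
  show "1 * a = a" 
    by (transfer, auto simp: fun_eq_iff cring.cring_simprules(12) split: if_splits) metis
  show "(a + b) * c = a * c + b * c" 
    by transfer (auto simp: fun_eq_iff cring.cring_simprules algebra_simps split: if_splits)
  show "(0 :: 'a all_crings) \<noteq> 1" by transfer auto
qed

end

definition emb :: "'a ring \<Rightarrow> 'a \<Rightarrow> 'a all_crings" where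
  "emb R x = Abs_all_crings (0, \<lambda>S. if S = R then x else if cring S then \<zero>\<^bsub>S\<^esub> else undefined)"

lemma Rep_emb:
  assumes "cring R" "x \<in> carrier R"
  shows "Rep_all_crings (emb R x) = (0, \<lambda>S. if S = R then x else if cring S then \<zero>\<^bsub>S\<^esub> else undefined)"
  unfolding emb_def by (rule Abs_all_crings_inverse) (use assms in \<open>auto simp: cring.cring_simprules\<close>)

context
  fixes R :: "'a ring" (structure)
  assumes R: "cring R"
begin

lemma emb_add: "x \<in> carrier R \<Longrightarrow> y \<in> carrier R \<Longrightarrow> emb R (x \<oplus> y) = emb R x + emb R y"
  unfolding Rep_all_crings_inject[symmetric] plus_all_crings.rep_eq 
  using R by (auto simp: Rep_emb fun_eq_iff cring.cring_simprules)

lemma emb_mult: "x \<in> carrier R \<Longrightarrow> y \<in> carrier R \<Longrightarrow> emb R (x \<otimes> y) = emb R x * emb R y"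
  unfolding Rep_all_crings_inject[symmetric] times_all_crings.rep_eq 
  using R by (auto simp: Rep_emb fun_eq_iff cring.cring_simprules)

lemma emb_zero: "emb R \<zero> = 0"
  unfolding Rep_all_crings_inject[symmetric] zero_all_crings.rep_eq 
  using R by (auto simp: Rep_emb fun_eq_iff cring.cring_simprules)

lemma emb_uminus: "x \<in> carrier R \<Longrightarrow> emb R (\<ominus> x) = - emb R x"
  unfolding Rep_all_crings_inject[symmetric] uminus_all_crings.rep_eq 
  using R by (auto simp: Rep_emb fun_eq_iff cring.cring_simprules)

lemma emb_diff: "x \<in> carrier R \<Longrightarrow> y \<in> carrier R \<Longrightarrow> emb R (x \<ominus> y) = emb R x - emb R y"
  using R by (simp add: a_minus_def emb_add emb_uminus cring.cring_simprules)

lemma inj_on_emb: "inj_on (emb R) (carrier R)"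
proof (rule inj_onI)
  fix x y assume "x \<in> carrier R" "y \<in> carrier R" "emb R x = emb R y"
  then have "snd (Rep_all_crings (emb R x)) R = snd (Rep_all_crings (emb R y)) R" by simp
  then show "x = y" using R \<open>x \<in> carrier R\<close> \<open>y \<in> carrier R\<close> by (simp add: Rep_emb)
qed

lemma emb_finsum:
  assumes "finite A" "f \<in> A \<rightarrow> carrier R"
  shows "emb R (finsum R f A) = (\<Sum>i\<in>A. emb R (f i))"
proof -
  interpret cring R by (rule R)
  show ?thesis using assms by (induction A rule: finite_induct) (simp_all add: emb_zero emb_add)
qed

text \<open>The empty product in the ambient ring is 1, whereas \<open>emb R \<one>\<close> is an
  idempotent other than 1; the extra factor corrects this.\<close>

lemma emb_finprod:
  assumes "finite A" "f \<in> A \<rightarrow> carrier R"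
  shows "emb R (finprod R f A) = emb R \<one> * (\<Prod>i\<in>A. emb R (f i))"
proof -
  interpret cring R by (rule R)
  have "emb R \<one> * emb R \<one> = emb R \<one>" by (simp flip: emb_mult)
  with assms show ?thesis 
    by (induction A rule: finite_induct) (simp_all add: emb_mult mult.left_commute)
qed

text \<open>Both sides are Leibniz sums, and \<open>emb R \<one>\<close> collects the idempotents
  from products and signs. This makes the adjugate of \<open>det\<close> available for
  \<open>mdet\<close>.\<close>

lemma emb_mdet:
  assumes A: "\<And>i j. i < d \<Longrightarrow> j < d \<Longrightarrow> A i j \<in> carrier R"
  shows "emb R (mdet R d A) = emb R \<one> * det (mat d d (\<lambda>(i, j). emb R (A i j)))"
proof -
  interpret cring R by (rule R)
  let ?M = "mat d d (\<lambda>(i, j). emb R (A i j))"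
  have in_d: "p i < d" if "p permutes {..<d}" "i < d" for p i
    using that permutes_in_image[of p "{..<d}" i] by simp
  have "emb R (mdet R d A) = (\<Sum>p | p permutes {..<d}. 
     emb R ((if evenperm p then \<one> else \<ominus> \<one>) \<otimes> finprod R (\<lambda>i. A i (p i)) {..<d}))"
    unfolding mdet_def using A in_d by (intro emb_finsum finite_permutations) (auto intro!: finprod_closed)
  also have "\<dots> = (\<Sum>p | p permutes {..<d}. emb R \<one> * (signof p * (\<Prod>i<d. emb R (A i (p i)))))"
  proof (rule sum.cong[OF refl], clarify)
    fix p assume p: "p permutes {..<d}"
    let ?e = "emb R \<one>"
    have e2: "?e * ?e = ?e" by (simp flip: emb_mult)
    have "emb R (if evenperm p then \<one> else \<ominus> \<one>) = ?e * signof p"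
      by (simp add: sign_def emb_uminus)
    moreover have "emb R (finprod R (\<lambda>i. A i (p i)) {..<d}) = ?e * (\<Prod>i<d. emb R (A i (p i)))"
      using A in_d[OF p] by (intro emb_finprod) auto
    moreover have "finprod R (\<lambda>i. A i (p i)) {..<d} \<in> carrier R" using A in_d[OF p] by (intro finprod_closed) auto
    ultimately have "emb R ((if evenperm p then \<one> else \<ominus> \<one>) \<otimes> finprod R (\<lambda>i. A i (p i)) {..<d}) = 
        (?e * ?e) * (signof p * (\<Prod>i<d. emb R (A i (p i))))"
      by (simp add: emb_mult mult.assoc mult.left_commute)
    then show "emb R ((if evenperm p then \<one> else \<ominus> \<one>) \<otimes> finprod R (\<lambda>i. A i (p i)) {..<d}) = 
        ?e * (signof p * (\<Prod>i<d. emb R (A i (p i))))" unfolding e2 .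
  qed
  also have "\<dots> = emb R \<one> * (\<Sum>p | p permutes {..<d}. signof p * (\<Prod>i<d. emb R (A i (p i))))"
    by (simp only: sum_distrib_left)
  also have "(\<Sum>p | p permutes {..<d}. signof p * (\<Prod>i<d. emb R (A i (p i)))) = det ?M"
    unfolding det_def'[OF mat_carrier] lessThan_atLeast0[symmetric]
  proof (rule sum.cong[OF refl], clarify)
    fix p assume p: "p permutes {..<d}"
    have "(\<Prod>i<d. emb R (A i (p i))) = (\<Prod>i<d. ?M $$ (i, p i))" 
      using in_d[OF p] by (intro prod.cong) auto
    then show "signof p * (\<Prod>i<d. emb R (A i (p i))) = signof p * (\<Prod>i<d. ?M $$ (i, p i))" by simp
  qed
  finally show ?thesis .
qed

end

text \<open>Multiplying the kernel equation by the adjugate works over any commutative ring, without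
  division.\<close>

lemma matrix_kernel_det:
  fixes a :: "nat \<Rightarrow> nat \<Rightarrow> 'k::comm_ring_1"
  assumes ker: "\<And>i. i < d \<Longrightarrow> (\<Sum>j<d. a i j * x j) = 0" and i: "i < d"
  shows "det (mat d d (\<lambda>(i, j). a i j)) * x i = 0"
proof -
  let ?M = "mat d d (\<lambda>(i, j). a i j)" and ?v = "vec d x"
  have M: "?M \<in> carrier_mat d d" by simp
  have "?M *\<^sub>v ?v = 0\<^sub>v d"
    by (rule eq_vecI) (auto simp: scalar_prod_def ker lessThan_atLeast0[symmetric])
  then have "(adj_mat ?M * ?M) *\<^sub>v ?v = 0\<^sub>v d"
    using adj_mat(1)[OF M] by (subst assoc_mult_mat_vec[of _ d d _ d]) auto
  then have "(det ?M \<cdot>\<^sub>m 1\<^sub>m d) *\<^sub>v ?v = 0\<^sub>v d" using adj_mat(3)[OF M] by simp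
  then have "((det ?M \<cdot>\<^sub>m 1\<^sub>m d) *\<^sub>v ?v) $ i = 0" using i by simp
  moreover have "((det ?M \<cdot>\<^sub>m 1\<^sub>m d) *\<^sub>v ?v) $ i = det ?M * x i"
    using i by (simp add: scalar_prod_def if_distrib if_distribR sum.delta cong: if_cong)
  ultimately show ?thesis by simp
qed

section \<open>Odd finite fields inside the ambient ring\<close>

locale odd_ff = field R for R :: "'a ring" (structure) +
  assumes finite_R: "finite (carrier R)" and odd_R: "odd (card (carrier R))"

lemma odd_ff_iff: "odd_ff R \<longleftrightarrow> odd_finite_field R"
  by (auto simp: odd_ff_def odd_ff_axioms_def odd_finite_field_def)

context odd_ff
begin

lemmas emb_hom = emb_add[OF is_cring] emb_mult[OF is_cring] emb_zero[OF is_cring] 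
  emb_uminus[OF is_cring] emb_diff[OF is_cring]

lemma emb_eq_iff [simp]: "x \<in> carrier R \<Longrightarrow> y \<in> carrier R \<Longrightarrow> emb R x = emb R y \<longleftrightarrow> x = y"
  using inj_on_emb[OF is_cring] by (auto simp: inj_on_def)

lemma emb_eq_0_iff [simp]: "x \<in> carrier R \<Longrightarrow> emb R x = 0 \<longleftrightarrow> x = \<zero>"
  using emb_eq_iff[of x \<zero>] by (simp add: emb_hom)

sublocale fld: ffield "emb R ` carrier R" "emb R \<one>"
proof
  show "finite (emb R ` carrier R)" using finite_R by simp
  show "odd (card (emb R ` carrier R))" using odd_R inj_on_emb[OF is_cring] by (simp add: card_image)
  show "0 \<in> emb R ` carrier R" using emb_hom(3) by (metis imageI zero_closed)
  show "emb R \<one> \<in> emb R ` carrier R" by simp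
  show "emb R \<one> \<noteq> 0" by simp
  fix x assume "x \<in> emb R ` carrier R"
  then obtain x' where x: "x' \<in> carrier R" "x = emb R x'" by auto
  show "- x \<in> emb R ` carrier R" using x by (auto simp: emb_hom(4)[symmetric])
  show "emb R \<one> * x = x" using x by (simp add: emb_hom(2)[symmetric])
  show "\<exists>y\<in>emb R ` carrier R. x * y = emb R \<one>" if "x \<noteq> 0"
  proof -
    have "x' \<noteq> \<zero>" using that x emb_hom(3) by auto
    then have "x' \<in> Units R" using x field_Units by auto
    then have "inv x' \<in> carrier R" "x' \<otimes> inv x' = \<one>" by auto
    then show ?thesis using x emb_hom(2) by (intro bexI[of _ "emb R (inv x')"]) (auto simp flip: emb_hom(2))
  qed
  fix y assume "y \<in> emb R ` carrier R"
  then obtain y' where y: "y' \<in> carrier R" "y = emb R y'" by auto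
  show "x + y \<in> emb R ` carrier R" using x y by (auto simp: emb_hom(1)[symmetric])
  show "x * y \<in> emb R ` carrier R" using x y by (auto simp: emb_hom(2)[symmetric])
qed

lemma card_emb [simp]: "card (emb R ` carrier R) = card (carrier R)"
  using inj_on_emb[OF is_cring] by (simp add: card_image)

lemma emb_nonzero: "r \<in> nonzero R \<Longrightarrow> emb R r \<in> emb R ` carrier R - {0}"
  by (auto simp: nonzero_def)

lemma emb_nonzero_squares: 
  "emb R ` nonzero_squares R = fld.squares"
proof -
  have sq: "(emb R s)\<^sup>2 = emb R (s \<otimes> s)" if "s \<in> carrier R" for s
    using that by (simp add: power2_eq_square emb_hom(2))
  have "fld.squares = (\<lambda>s. (emb R s)\<^sup>2) ` (carrier R - {\<zero>})"
    unfolding fld.squares_def by (force simp: image_iff)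
  also have "\<dots> = (\<lambda>s. emb R (s \<otimes> s)) ` (carrier R - {\<zero>})"
    by (intro image_cong refl) (simp add: sq)
  also have "\<dots> = emb R ` ((\<lambda>s. s \<otimes> s) ` (carrier R - {\<zero>}))" by (simp add: image_image)
  also have "(\<lambda>s. s \<otimes> s) ` (carrier R - {\<zero>}) = nonzero_squares R"
    unfolding nonzero_squares_def nonzero_def by (auto simp: integral_iff)
  finally show ?thesis ..
qed

end

text \<open>Vectors of \<open>vecs R d\<close> are undefined from index \<open>d\<close> on, whereas their images vanish there.\<close>

definition emb_vec :: "'a ring \<Rightarrow> nat \<Rightarrow> (nat \<Rightarrow> 'a) \<Rightarrow> nat \<Rightarrow> 'a all_crings" where
  "emb_vec R d x = (\<lambda>i. if i < d then emb R (x i) else 0)"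

definition emb_form :: "'a ring \<Rightarrow> nat \<Rightarrow> (nat \<Rightarrow> nat \<Rightarrow> 'a) \<Rightarrow> (nat \<Rightarrow> 'a all_crings) \<Rightarrow> (nat \<Rightarrow> 'a all_crings) \<Rightarrow> 'a all_crings" where
  "emb_form R d A x y = (\<Sum>i<d. \<Sum>j<d. emb R (A i j) * x i * y j)"

definition scale :: "'k::times \<Rightarrow> (nat \<Rightarrow> 'k) \<Rightarrow> nat \<Rightarrow> 'k" where
  "scale c x = (\<lambda>i. c * x i)"

section \<open>The given form as a quadratic space\<close>

locale quadratic_form = odd_ff R for R :: "'a ring" (structure) +
  fixes d :: nat and A :: "nat \<Rightarrow> nat \<Rightarrow> 'a"
  assumes nondeg_sym: "nondeg_sym R d A"
begin

lemma A_in: "i < d \<Longrightarrow> j < d \<Longrightarrow> A i j \<in> carrier R" 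
  and A_sym: "i < d \<Longrightarrow> j < d \<Longrightarrow> A i j = A j i"
  and det_A: "mdet R d A \<noteq> \<zero>"
  using nondeg_sym by (auto simp: nondeg_sym_def)

abbreviation "FF \<equiv> emb R ` carrier R"
abbreviation "VV \<equiv> emb_vec R d ` vecs R d"
abbreviation "BB \<equiv> emb_form R d A"

lemma VV_iff: "x \<in> VV \<longleftrightarrow> (\<forall>i<d. x i \<in> FF) \<and> (\<forall>i\<ge>d. x i = 0)"
proof
  assume "x \<in> VV"
  then obtain y where "y \<in> vecs R d" "x = emb_vec R d y" by blast
  then show "(\<forall>i<d. x i \<in> FF) \<and> (\<forall>i\<ge>d. x i = 0)" by (auto simp: emb_vec_def vecs_def intro!: imageI)
next
  assume x: "(\<forall>i<d. x i \<in> FF) \<and> (\<forall>i\<ge>d. x i = 0)"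
  \<comment> \<open>The restriction to \<open>{..<d}\<close> makes the preimage extensional, as
    \<open>vecs\<close> demands.\<close>
  let ?y = "\<lambda>i\<in>{..<d}. the_inv_into (carrier R) (emb R) (x i)"
  have "?y \<in> vecs R d" unfolding vecs_def using x
    by (auto intro!: the_inv_into_into[OF inj_on_emb[OF is_cring]])
  moreover have "x = emb_vec R d ?y"
    using x by (auto simp: emb_vec_def fun_eq_iff f_the_inv_into_f[OF inj_on_emb[OF is_cring]])
  ultimately show "x \<in> VV" by blast
qed

lemma inj_on_emb_vec: "inj_on (emb_vec R d) (vecs R d)"
proof (rule inj_onI)
  fix x y assume x: "x \<in> vecs R d" and y: "y \<in> vecs R d" and eq: "emb_vec R d x = emb_vec R d y"
  show "x = y"
  proof (rule PiE_ext[of _ "{..<d}" "\<lambda>_. carrier R"])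
    fix i assume i: "i \<in> {..<d}"
    have "emb R (x i) = emb R (y i)" using fun_cong[OF eq, of i] i by (simp add: emb_vec_def)
    moreover have "x i \<in> carrier R" "y i \<in> carrier R" using x y i by (auto simp: vecs_def)
    ultimately show "x i = y i" by simp
  qed (use x y in \<open>simp_all add: vecs_def\<close>)
qed

lemma card_VV: "card VV = card FF ^ d"
  unfolding card_image[OF inj_on_emb_vec] by (simp add: vecs_def card_PiE)

sublocale qs: bspace FF "emb R \<one>" VV scale BB
proof
  show "finite VV" using finite_R by (auto simp: vecs_def intro!: finite_PiE)
  show "0 \<in> VV" by (simp add: VV_iff)
  show "x + y \<in> VV" if "x \<in> VV" "y \<in> VV" for x y using that unfolding VV_iff by simp
  show "scale c x \<in> VV" if "c \<in> FF" "x \<in> VV" for c x using that unfolding VV_iff by (simp add: scale_def)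
  show "scale (emb R \<one>) x = x" if "x \<in> VV" for x
  proof
    fix i show "scale (emb R \<one>) x i = x i" unfolding scale_def using that fld.e_mult[of "x i"] unfolding VV_iff by (cases "i < d") auto
  qed
  show "BB x y \<in> FF" if "x \<in> VV" "y \<in> VV" for x y
  proof -
    have *: "emb R (A i j) * x i * y j \<in> FF" if "i < d" "j < d" for i j
      using that \<open>x \<in> VV\<close> \<open>y \<in> VV\<close> A_in unfolding VV_iff by (intro fld.F_mult) auto
    have sum_in: "sum f S \<in> FF" if "\<And>i. i \<in> S \<Longrightarrow> f i \<in> FF" for f :: "nat \<Rightarrow> 'a all_crings" and S
      using that by (induction S rule: infinite_finite_induct) (auto intro!: fld.F_0 fld.F_add)
    show ?thesis unfolding emb_form_def by (rule sum_in, rule sum_in) (use * in simp)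
  qed
  show "BB x y = BB y x" for x y
  proof -
    have "BB y x = (\<Sum>i<d. \<Sum>j<d. emb R (A j i) * y j * x i)" unfolding emb_form_def by (rule sum.swap)
    also have "\<dots> = BB x y" unfolding emb_form_def 
      by (intro sum.cong refl) (simp add: A_sym mult.assoc mult.commute)
    finally show ?thesis ..
  qed
qed (auto simp: emb_form_def scale_def algebra_simps sum.distrib sum_distrib_left)

text \<open>A vector orthogonal to all coordinate vectors lies in the kernel of the matrix, so
  \<open>matrix_kernel_det\<close> and the nonzero determinant kill its entries.\<close>

lemma nondegenerate:
  assumes x: "x \<in> VV" "x \<noteq> 0" 
  shows "\<exists>y\<in>VV. BB x y \<noteq> 0"
proof (rule ccontr)
  assume neg: "\<not> ?thesis"
  have ker: "(\<Sum>i<d. emb R (A j i) * x i) = 0" if j: "j < d" for j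
  proof -
    \<comment> \<open>The coordinate vector has entry \<open>emb R \<one>\<close>, since the ambient
      1 lies outside \<open>FF\<close>.\<close>
    let ?u = "\<lambda>i. if i = j then emb R \<one> else 0"
    have "?u \<in> VV" using j fld.F_0 unfolding VV_iff by auto
    then have "BB x ?u = 0" using neg by blast
    moreover have "BB x ?u = (\<Sum>i<d. emb R (A j i) * x i)" unfolding emb_form_def
    proof (rule sum.cong[OF refl])
      fix i assume i: "i \<in> {..<d}"
      have "(\<Sum>k<d. emb R (A i k) * x i * ?u k) = emb R (A i j) * x i * emb R \<one>"
        using j by (simp add: if_distrib sum.delta cong: if_cong)
      also have "\<dots> = emb R (A j i) * x i"
        using i j x A_in A_sym unfolding VV_iff by (subst fld.mult_e) auto
      finally show "(\<Sum>k<d. emb R (A i k) * x i * ?u k) = emb R (A j i) * x i" .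
    qed
    ultimately show ?thesis by simp
  qed
  have "x i = 0" for i
  proof (cases "i < d")
    case True
    have "emb R (mdet R d A) * x i = emb R \<one> * (det (mat d d (\<lambda>(i, j). emb R (A i j))) * x i)"
      using emb_mdet[OF is_cring A_in] by (simp add: mult.assoc)
    also have "\<dots> = 0" using matrix_kernel_det[of d "\<lambda>i j. emb R (A i j)" x i] ker True by simp
    finally have "emb R (mdet R d A) * x i = 0" .
    moreover have "mdet R d A \<in> carrier R" unfolding mdet_def
      using A_in permutes_in_image[of _ "{..<d}"] by (intro finsum_closed) (auto intro!: finprod_closed m_closed)
    moreover have "x i \<in> FF" using x True unfolding VV_iff by blast
    ultimately show ?thesis using det_A fld.F_no_zero_div[of "emb R (mdet R d A)" "x i"] by auto
  qed (use x in \<open>simp add: VV_iff\<close>)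
  then show False using x by (auto simp: fun_eq_iff)
qed

lemma ex_nondeg_space: "\<exists>\<chi>. nondeg_space FF (emb R \<one>) VV scale BB \<chi>"
proof -
  have "FF \<noteq> {0}" using fld.F_e fld.e_neq_0 by blast
  then obtain \<chi> :: "'a all_crings \<Rightarrow> complex" where \<chi>: "\<forall>x\<in>FF. \<forall>y\<in>FF. \<chi> (x + y) = \<chi> x * \<chi> y" 
    "\<forall>x\<in>FF. norm (\<chi> x) = 1" "\<exists>x\<in>FF. \<chi> x \<noteq> 1"
    using ex_nontrivial_character[OF fld.finite_F fld.F_add_subgroup] by blast
  interpret bspace_char FF "emb R \<one>" VV scale BB \<chi> by unfold_locales (use \<chi> in auto)
  have "nondeg_space FF (emb R \<one>) VV scale BB \<chi>"
    by unfold_locales (use nondegenerate in \<open>simp add: nondeg_on_def\<close>)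
  then show ?thesis by (intro exI[of _ \<chi>])
qed

lemma Q_emb:
  assumes x: "x \<in> vecs R d" and y: "y \<in> vecs R d"
  shows "qform R d A (vsub R d x y) \<in> carrier R"
    "qs.Q (emb_vec R d x - emb_vec R d y) = emb R (qform R d A (vsub R d x y))"
proof -
  let ?v = "vsub R d x y"
  have in_R: "x i \<in> carrier R" "y i \<in> carrier R" "?v i \<in> carrier R" "?v i = x i \<ominus> y i" if "i < d" for i
    using x y that by (auto simp: vecs_def vsub_def)
  show "qform R d A ?v \<in> carrier R" unfolding qform_def 
    using A_in in_R by (intro finsum_closed funcsetI) auto
  have "emb R (qform R d A ?v) = (\<Sum>i<d. emb R (finsum R (\<lambda>j. A i j \<otimes> ?v i \<otimes> ?v j) {..<d}))"
    unfolding qform_def using A_in in_R 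
    by (intro emb_finsum[OF is_cring]) (auto intro!: finsum_closed)
  also have "\<dots> = (\<Sum>i<d. \<Sum>j<d. emb R (A i j \<otimes> ?v i \<otimes> ?v j))"
    using A_in in_R by (intro sum.cong refl emb_finsum[OF is_cring]) auto
  also have "\<dots> = (\<Sum>i<d. \<Sum>j<d. emb R (A i j) * (emb_vec R d x - emb_vec R d y) i * (emb_vec R d x - emb_vec R d y) j)"
    using A_in in_R by (intro sum.cong refl) (simp add: emb_hom emb_vec_def)
  finally show "qs.Q (emb_vec R d x - emb_vec R d y) = emb R (qform R d A ?v)"
    by (simp add: qs.Q_def emb_form_def)
qed

lemma ratio_iff:
  assumes "b \<in> carrier R" "c \<in> carrier R" "r \<in> carrier R"
  shows "(c \<noteq> \<zero> \<and> b \<otimes> inv c = r) \<longleftrightarrow> (emb R c \<noteq> 0 \<and> emb R b = emb R r * emb R c)"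
proof (cases "c = \<zero>")
  case False
  then have c: "c \<in> Units R" using assms field_Units by auto
  have "b \<otimes> inv c = r \<longleftrightarrow> b = r \<otimes> c"
  proof
    assume "b \<otimes> inv c = r"
    then show "b = r \<otimes> c" using assms c by (auto simp: m_assoc)
  next
    assume "b = r \<otimes> c"
    then show "b \<otimes> inv c = r" using assms c by (auto simp: m_assoc)
  qed
  then show ?thesis using assms False by (simp flip: emb_hom(2))
qed (use assms in \<open>simp add: emb_hom\<close>)

text \<open>The right-hand side is \<open>ratio_quads\<close> written out, since that constant
  becomes available only once a character has been fixed.\<close>

lemma Wcount_eq:
  assumes E: "E \<subseteq> vecs R d" and r: "r \<in> carrier R"
  shows "real (Wcount R d A E r) = (\<Sum>p\<in>emb_vec R d ` E \<times> emb_vec R d ` E. \<Sum>p'\<in>emb_vec R d ` E \<times> emb_vec R d ` E.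
     of_bool (qs.Q (fst p' - snd p') \<noteq> 0 \<and> qs.Q (fst p - snd p) = emb R r * qs.Q (fst p' - snd p')))"
proof -
  let ?\<phi> = "emb_vec R d"
  let ?P = "\<lambda>x y z w. qs.Q (?\<phi> z - ?\<phi> w) \<noteq> 0 \<and> qs.Q (?\<phi> x - ?\<phi> y) = emb R r * qs.Q (?\<phi> z - ?\<phi> w)"
  have fin: "finite E" using E finite_subset finite_R by (fastforce simp: vecs_def intro: finite_PiE)
  have inj: "inj_on ?\<phi> E" using inj_on_emb_vec E by (rule inj_on_subset)
  have "(\<Sum>p\<in>?\<phi> ` E \<times> ?\<phi> ` E. \<Sum>p'\<in>?\<phi> ` E \<times> ?\<phi> ` E.
     of_bool (qs.Q (fst p' - snd p') \<noteq> 0 \<and> qs.Q (fst p - snd p) = emb R r * qs.Q (fst p' - snd p')) :: real) = 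
    (\<Sum>x\<in>E. \<Sum>y\<in>E. \<Sum>z\<in>E. \<Sum>w\<in>E. of_bool (?P x y z w))"
  proof -
    have "(\<Sum>p\<in>?\<phi> ` E \<times> ?\<phi> ` E. f p) = (\<Sum>x\<in>E. \<Sum>y\<in>E. f (?\<phi> x, ?\<phi> y))" for f :: "_ \<Rightarrow> real"
    proof -
      have "(\<Sum>p\<in>?\<phi> ` E \<times> ?\<phi> ` E. f p) = (\<Sum>a\<in>?\<phi> ` E. \<Sum>b\<in>?\<phi> ` E. f (a, b))"
        by (simp add: sum.cartesian_product)
      then show ?thesis by (simp add: sum.reindex[OF inj])
    qed
    then show ?thesis by simp
  qed
  also have "\<dots> = (\<Sum>(x, y, z, w)\<in>E \<times> E \<times> E \<times> E. of_bool (?P x y z w))"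
    by (simp add: sum.cartesian_product)
  also have "\<dots> = real (card ((E \<times> E \<times> E \<times> E) \<inter> {(x, y, z, w). ?P x y z w}))"
    using fin by (simp add: case_prod_unfold sum_of_bool_eq)
  also have "(E \<times> E \<times> E \<times> E) \<inter> {(x, y, z, w). ?P x y z w} = 
     {(x, y, z, w). x \<in> E \<and> y \<in> E \<and> z \<in> E \<and> w \<in> E \<and>
      qform R d A (vsub R d z w) \<noteq> \<zero> \<and> qform R d A (vsub R d x y) \<otimes> inv (qform R d A (vsub R d z w)) = r}"
  proof -
    have "?P x y z w \<longleftrightarrow> qform R d A (vsub R d z w) \<noteq> \<zero> \<and> 
      qform R d A (vsub R d x y) \<otimes> inv (qform R d A (vsub R d z w)) = r" 
      if "x \<in> E" "y \<in> E" "z \<in> E" "w \<in> E" for x y z w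
    proof -
      have "x \<in> vecs R d" "y \<in> vecs R d" "z \<in> vecs R d" "w \<in> vecs R d" using that E by auto
      then show ?thesis using ratio_iff[of "qform R d A (vsub R d x y)" "qform R d A (vsub R d z w)" r] r
        by (simp add: Q_emb)
    qed
    then show ?thesis by auto
  qed
  finally show ?thesis unfolding Wcount_def ..
qed

lemma sqrt_card_powr: "real (card FF) powr (real k / 2) = sqrt (card FF ^ k)"
proof -
  have q: "real (card FF) > 0" using fld.card_F_ge_3 by simp
  have "real (card FF) powr (real k / 2) = (real (card FF) powr real k) powr (1 / 2)" by (simp add: powr_powr)
  also have "\<dots> = sqrt (card FF ^ k)" using q by (simp add: powr_half_sqrt powr_realpow)
  finally show ?thesis .
qed

lemma emb_vec_image:
  assumes E: "E \<subseteq> vecs R d" 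
  shows "emb_vec R d ` E \<subseteq> VV" "card (emb_vec R d ` E) = card E"
  using E card_image[OF inj_on_subset[OF inj_on_emb_vec E]] by auto

lemma Wcount_even:
  assumes d: "even d" and E: "E \<subseteq> vecs R d" and r: "r \<in> nonzero R" 
    and card: "real (card E) \<ge> 4 * real (card (carrier R)) powr (real d / 2)"
  shows "real (Wcount R d A E r) \<ge> 5 * real (card E) ^ 4 / (48 * real (card (carrier R)))"
proof -
  obtain \<chi> where "nondeg_space FF (emb R \<one>) VV scale BB \<chi>" using ex_nondeg_space by blast
  then interpret nondeg_space FF "emb R \<one>" VV scale BB \<chi> .
  have rc: "r \<in> carrier R" using r by (simp add: nonzero_def)
  show ?thesis
    using ratio_quads_even[OF card_VV d emb_vec_image(1)[OF E] _ emb_nonzero[OF r]] card emb_vec_image(2)[OF E]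
      sqrt_card_powr[of d] Wcount_eq[OF E rc] by (simp add: ratio_quads_def dist2_def)
qed

lemma Wcount_odd_square:
  assumes d: "odd d" and E: "E \<subseteq> vecs R d" and r: "r \<in> nonzero_squares R" 
    and card: "real (card E) \<ge> 3 * real (card (carrier R)) powr (real d / 2)"
  shows "real (Wcount R d A E r) \<ge> 2 * real (card E) ^ 4 / (45 * real (card (carrier R)))"
proof -
  obtain \<chi> where "nondeg_space FF (emb R \<one>) VV scale BB \<chi>" using ex_nondeg_space by blast
  then interpret nondeg_space FF "emb R \<one>" VV scale BB \<chi> .
  have rc: "r \<in> carrier R" using r by (simp add: nonzero_def nonzero_squares_def)
  have sq: "emb R r \<in> fld.squares" using r emb_nonzero_squares by blast
  show ?thesis
    using ratio_quads_odd_square[OF card_VV d emb_vec_image(1)[OF E] _ sq] card emb_vec_image(2)[OF E]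
      sqrt_card_powr[of d] Wcount_eq[OF E rc] by (simp add: ratio_quads_def dist2_def)
qed

lemma Wcount_odd:
  assumes d: "odd d" and E: "E \<subseteq> vecs R d" and r: "r \<in> nonzero R" 
    and card: "real (card E) \<ge> 11 / 6 * real (card (carrier R)) powr ((real d + 1) / 2)"
  shows "real (Wcount R d A E r) \<ge> 2 * real (card E) ^ 4 / (363 * real (card (carrier R)))"
proof -
  obtain \<chi> where "nondeg_space FF (emb R \<one>) VV scale BB \<chi>" using ex_nondeg_space by blast
  then interpret nondeg_space FF "emb R \<one>" VV scale BB \<chi> .
  have rc: "r \<in> carrier R" using r by (simp add: nonzero_def)
  show ?thesis
    using ratio_quads_odd[OF card_VV d emb_vec_image(1)[OF E] _ emb_nonzero[OF r]] card emb_vec_image(2)[OF E]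
      sqrt_card_powr[of "Suc d"] Wcount_eq[OF E rc] by (simp add: ratio_quads_def dist2_def add.commute)
qed

lemma Wcount_eq_0_transfer:
  assumes E': "E' \<subseteq> VV" and r: "r \<in> carrier R"
    and avoid: "\<forall>x\<in>E'. \<forall>y\<in>E'. \<forall>z\<in>E'. \<forall>w\<in>E'. qs.Q (z - w) \<noteq> 0 \<longrightarrow> qs.Q (x - y) \<noteq> emb R r * qs.Q (z - w)"
  shows "\<exists>E\<subseteq>vecs R d. card E = card E' \<and> Wcount R d A E r = 0"
proof -
  obtain E where E: "E \<subseteq> vecs R d" "E' = emb_vec R d ` E" using E' by (auto simp: subset_image_iff)
  have "real (Wcount R d A E r) = 0" 
    unfolding Wcount_eq[OF E(1) r] E(2)[symmetric] using avoid by (intro sum.neutral ballI) auto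
  then show ?thesis using E emb_vec_image(2)[OF E(1)] by (intro exI[of _ E]) auto
qed

text \<open>The largest admissible \<open>k\<close> makes \<open>Suc k\<close> equal to
  \<open>d / 2\<close> for even \<open>d\<close> and \<open>(d + 1) / 2\<close> for odd
  \<open>d\<close>, so one construction serves both sharpness claims.\<close>

lemma ex_Wcount_eq_0:
  assumes k: "2 * k + 1 \<le> d"
  shows "\<exists>E r. E \<subseteq> vecs R d \<and> card E = card (carrier R) ^ Suc k \<and> r \<in> nonzero R \<and> Wcount R d A E r = 0"
proof -
  obtain r' E' where r': "r' \<in> FF - {0}" and E': "E' \<subseteq> VV" "card E' = card FF ^ Suc k"
    "\<forall>x\<in>E'. \<forall>y\<in>E'. \<forall>z\<in>E'. \<forall>w\<in>E'. qs.Q (z - w) \<noteq> 0 \<longrightarrow> qs.Q (x - y) \<noteq> r' * qs.Q (z - w)"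
    using qs.ex_nonsquare_avoiding[OF card_VV k] by blast
  obtain r where r: "r \<in> carrier R" "r' = emb R r" using r' by auto
  then have "r \<in> nonzero R" using r' by (auto simp: nonzero_def emb_hom)
  then show ?thesis using Wcount_eq_0_transfer[OF E'(1) r(1)] E' r by auto
qed

end

section \<open>Prime fields on the natural numbers\<close>

text \<open>Built on \<open>nat\<close> so that one type carries prime fields of unbounded size, as
  refuting a uniform exponent requires.\<close>

definition nat_prime_field :: "nat \<Rightarrow> nat ring" where
  "nat_prime_field p = \<lparr>carrier = {..<p}, monoid.mult = (\<lambda>a b. a * b mod p), one = 1, ring.zero = 0, ring.add = (\<lambda>a b. (a + b) mod p)\<rparr>"

text \<open>The field structure is transported from \<open>residue_ring\<close> along the bijection
  \<open>nat\<close>.\<close>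

lemma odd_finite_field_nat_prime_field:
  assumes p: "Factorial_Ring.prime p" "odd p"
  shows "odd_finite_field (nat_prime_field p)"
proof -
  have p2: "p \<ge> 2" using p(1) prime_ge_2_nat by simp
  interpret residues_prime p "residue_ring (int p)" using p p2 by unfold_locales auto
  have "nat \<in> ring_iso (residue_ring (int p)) (nat_prime_field p)"
  proof (rule ring_iso_memI)
    show "bij_betw nat (carrier (residue_ring (int p))) (carrier (nat_prime_field p))"
      by (rule bij_betwI[of _ _ _ int]) (auto simp: residue_ring_def nat_prime_field_def)
  qed (use p2 in \<open>auto simp: residue_ring_def nat_prime_field_def nat_mod_distrib nat_mult_distrib nat_add_distrib\<close>)
  from field.ring_iso_imp_img_field[OF is_field this]
  have "field (nat_prime_field p)" by (simp add: residue_ring_def nat_prime_field_def)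
  then show ?thesis using p by (simp add: odd_finite_field_def) (simp add: nat_prime_field_def)
qed

lemma (in odd_ff) nondeg_sym_identity: "nondeg_sym R d (\<lambda>i j. if i = j then \<one> else \<zero>)"
proof -
  let ?I = "\<lambda>i j. if i = j then \<one> else \<zero>" and ?e = "emb R \<one>"
  have "mat d d (\<lambda>(i, j). emb R (?I i j)) = ?e \<cdot>\<^sub>m 1\<^sub>m d"
    by (rule eq_matI) (auto simp: emb_hom(3))
  then have "emb R (mdet R d ?I) = ?e * ?e ^ d"
    using emb_mdet[OF is_cring, of d ?I] by simp
  \<comment> \<open>Idempotence of \<open>?e\<close> collapses the power; the leading factor covers
    \<open>d = 0\<close>.\<close>
  also have "\<dots> = ?e" by (induction d) (simp_all add: fld.F_e flip: mult.assoc)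
  finally have "mdet R d ?I \<noteq> \<zero>" using fld.e_neq_0 emb_hom(3) by auto
  then show ?thesis by (auto simp: nondeg_sym_def)
qed

text \<open>An arithmetic progression of length about \<open>sqrt p / 2\<close> in the prime field has too few ratios of
  squared differences to exhaust the nonzero squares.\<close>

lemma ex_Wcount_eq_0_prime_field:
  fixes p k K :: nat
  assumes p: "Factorial_Ring.prime p" "odd p" and K: "0 < K" "K \<le> p" "2 * (K - 1)\<^sup>2 < p - 1" and d: "2 * k + 1 \<le> d"
  defines "R \<equiv> nat_prime_field p"
  shows "\<exists>A E. nondeg_sym R d A \<and> E \<subseteq> vecs R d \<and> card E = p ^ k * K \<and> (\<exists>r\<in>nonzero_squares R. Wcount R d A E r = 0)"
proof -
  interpret odd_ff R unfolding R_def odd_ff_iff by (rule odd_finite_field_nat_prime_field[OF p])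
  let ?A = "\<lambda>i j::nat. if i = j then \<one>\<^bsub>R\<^esub> else \<zero>\<^bsub>R\<^esub>"
  interpret quadratic_form R d ?A by unfold_locales (rule nondeg_sym_identity)
  have car: "carrier R = {..<p}" by (simp add: R_def nat_prime_field_def)
  have emb_minus: "emb R i - emb R j = emb R (i - j)" if "j \<le> i" "i < p" for i j
  proof -
    have "emb R i = emb R ((i - j) \<oplus>\<^bsub>R\<^esub> j)" using that by (simp add: R_def nat_prime_field_def)
    then show ?thesis using that emb_hom(1)[of "i - j" j] by (simp add: car)
  qed
  have cF: "card FF = p" unfolding card_emb by (simp add: car)
  let ?S = "emb R ` {..<K}"
  let ?ratios = "(\<lambda>(i, j). fld.iv ((emb R j)\<^sup>2) * (emb R i)\<^sup>2) ` ({1..<K} \<times> {1..<K})"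
  have S: "?S \<subseteq> FF" using K car by auto
  have "{..<K} \<subseteq> carrier R" using K car by auto
  then have cS: "card ?S = K" using card_image[OF inj_on_subset[OF inj_on_emb[OF is_cring]]] by simp
  \<comment> \<open>A difference of two members of the progression is \<open>emb R i\<close> up to
    sign with \<open>i < K\<close>, and squaring forgets the sign. The cases ask which index is
    larger, because subtraction on \<open>nat\<close> truncates.\<close>
  have sq_diff: "\<exists>i<K. (t - t')\<^sup>2 = (emb R i)\<^sup>2 \<and> (i = 0 \<longleftrightarrow> t = t')" if "t \<in> ?S" "t' \<in> ?S" for t t'
  proof -
    obtain i where i: "i < K" "t = emb R i" using \<open>t \<in> ?S\<close> by auto
    obtain j where j: "j < K" "t' = emb R j" using \<open>t' \<in> ?S\<close> by auto
    note ij = i(1) j(1) i(2) j(2)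
    show ?thesis
    proof (cases "j \<le> i")
      case True
      then have "t - t' = emb R (i - j)" using ij K emb_minus by simp
      moreover have "i - j = 0 \<longleftrightarrow> t = t'" using ij True K car by auto
      ultimately show ?thesis using ij by (intro exI[of _ "i - j"]) auto
    next
      case False
      then have "t' - t = emb R (j - i)" using ij K emb_minus by simp
      moreover have "j - i = 0 \<longleftrightarrow> t = t'" using ij False K car by auto
      ultimately show ?thesis using ij power2_commute[of t t'] by (intro exI[of _ "j - i"]) auto
    qed
  qed
  have "card ?ratios \<le> card ({1..<K} \<times> {1..<K})" by (rule card_image_le) simp
  also have "\<dots> = (K - 1)\<^sup>2" by (simp add: card_cartesian_product power2_eq_square)
  \<comment> \<open>There are \<open>(p - 1) / 2\<close> nonzero squares and at most
    \<open>(K - 1)\<^sup>2\<close> ratios, so some nonzero square is not a ratio.\<close>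
  finally have "card ?ratios < card fld.squares"
    using K(3) fld.card_squares cF by linarith
  then have "\<not> fld.squares \<subseteq> ?ratios" by (meson card_mono finite_SigmaI finite_atLeastLessThan finite_imageI leD)
  then obtain r' where r': "r' \<in> fld.squares" "r' \<notin> ?ratios" by blast
  then obtain r where r: "r \<in> nonzero_squares R" "r' = emb R r" using emb_nonzero_squares by blast
  have rc: "r \<in> carrier R" using r by (simp add: nonzero_squares_def nonzero_def)
  have r'F: "r' \<in> FF" "r' \<noteq> 0" using r'(1) fld.squares_subset by auto
  have avoid: "(t - t')\<^sup>2 \<noteq> r' * (u - u')\<^sup>2" 
    if tu: "t \<in> ?S" "t' \<in> ?S" "u \<in> ?S" "u' \<in> ?S" "u \<noteq> u'" for t t' u u'
  proof
    assume eq: "(t - t')\<^sup>2 = r' * (u - u')\<^sup>2"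
    obtain i where i: "i < K" "(t - t')\<^sup>2 = (emb R i)\<^sup>2" using sq_diff \<open>t \<in> ?S\<close> \<open>t' \<in> ?S\<close> by blast
    obtain j where j: "j < K" "(u - u')\<^sup>2 = (emb R j)\<^sup>2" "j \<noteq> 0" using sq_diff[OF tu(3,4)] tu(5) by blast
    have ijF: "emb R i \<in> FF" "emb R j \<in> FF" using i j K car by auto
    have "j \<in> carrier R" "j \<noteq> \<zero>\<^bsub>R\<^esub>" using j K car by (auto simp: R_def nat_prime_field_def)
    then have ej: "(emb R j)\<^sup>2 \<in> FF - {0}" using ijF by (simp add: power2_eq_square)
    have eq': "(emb R i)\<^sup>2 = r' * (emb R j)\<^sup>2" using eq i j by simp
    \<comment> \<open>\<open>?ratios\<close> is indexed from 1, so a zero numerator must be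
      excluded; it would contradict \<open>r' \<noteq> 0\<close>.\<close>
    have "i \<noteq> 0"
    proof
      assume "i = 0"
      then have "emb R i = 0" using emb_hom(3) by (simp add: R_def nat_prime_field_def)
      then show False using eq' ej r'F by simp
    qed
    have "r' = fld.iv ((emb R j)\<^sup>2) * (r' * (emb R j)\<^sup>2)" 
      using ej r'F fld.iv_mult[of "(emb R j)\<^sup>2"] by (simp add: mult.left_commute)
    then have "r' = fld.iv ((emb R j)\<^sup>2) * (emb R i)\<^sup>2" using eq' by simp
    then have "r' \<in> ?ratios" using i j \<open>i \<noteq> 0\<close> by (intro image_eqI[of _ _ "(i, j)"]) auto
    then show False using r' by simp
  qed
  obtain E' where E': "E' \<subseteq> VV" "card E' = card FF ^ k * card ?S"
     "\<forall>x\<in>E'. \<forall>y\<in>E'. \<forall>z\<in>E'. \<forall>w\<in>E'. qs.Q (z - w) \<noteq> 0 \<longrightarrow> qs.Q (x - y) \<noteq> r' * qs.Q (z - w)"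
    using qs.ex_ratio_avoiding[OF card_VV d S r'F(1) avoid] by blast
  obtain E where "E \<subseteq> vecs R d" "card E = card E'" "Wcount R d ?A E r = 0"
    using Wcount_eq_0_transfer[OF E'(1) rc] E'(3) r(2) by blast
  moreover have "card E' = p ^ k * K" using E'(2) cS cF by simp
  ultimately show ?thesis using r(1) nondeg_sym by metis
qed

text \<open>With \<open>d = 2 * k + 1\<close> the set has size \<open>p ^ k * K\<close> and
  \<open>K \<ge> sqrt p / 2\<close>, hence at least half of \<open>p powr (d / 2)\<close>. This
  reaches \<open>C * p powr \<gamma>\<close> as soon as \<open>p powr \<delta> \<ge> 2 * C\<close>,
  and primes are unbounded.\<close>

lemma no_smaller_exponent:
  fixes \<gamma> C :: real
  assumes d: "odd d" and \<gamma>: "\<gamma> < real d / 2" and C: "C > 0"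
  shows "\<exists>(R :: nat ring) A E. odd_finite_field R \<and> nondeg_sym R d A \<and> E \<subseteq> vecs R d \<and>
    real (card E) \<ge> C * real (card (carrier R)) powr \<gamma> \<and> (\<exists>r\<in>nonzero_squares R. Wcount R d A E r = 0)"
proof -
  define \<delta> where "\<delta> = real d / 2 - \<gamma>"
  have \<delta>: "\<delta> > 0" using \<gamma> by (simp add: \<delta>_def)
  obtain p where p: "Factorial_Ring.prime p" "p > max 2 (nat \<lceil>(2 * C) powr (1 / \<delta>)\<rceil>)" using bigger_prime by blast
  have p3: "p \<ge> 3" and pC: "real p \<ge> (2 * C) powr (1 / \<delta>)" using p(2) by linarith+
  have "odd p" using p(1) p3 prime_odd_nat by force
  \<comment> \<open>Chosen so that \<open>K - 1 \<le> sqrt p / 2 \<le> K\<close>: the upper bound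
    keeps the ratios fewer than the squares, the lower one makes the set large.\<close>
  define K where "K = nat \<lfloor>sqrt p / 2\<rfloor> + 1"
  have K1: "real (K - 1) \<le> sqrt p / 2" unfolding K_def using of_int_floor_le[of "sqrt p / 2"] by simp
  have K2: "real K \<ge> sqrt p / 2" unfolding K_def by linarith
  have "(real (K - 1))\<^sup>2 \<le> (sqrt p / 2)\<^sup>2" using K1 by (intro power_mono) auto
  then have "real (4 * (K - 1)\<^sup>2) \<le> real p" by (simp add: power_divide)
  then have K3: "4 * (K - 1)\<^sup>2 \<le> p" by (simp only: of_nat_le_iff)
  then have K4: "2 * (K - 1)\<^sup>2 < p - 1" using p3 by linarith
  have "K - 1 \<le> (K - 1)\<^sup>2" by (cases "K - 1") (simp_all add: power2_eq_square)
  then have K5: "K \<le> p" using K3 p3 by linarith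
  obtain k where k: "d = 2 * k + 1" using d oddE by blast
  let ?R = "nat_prime_field p"
  obtain A E where AE: "nondeg_sym ?R d A" "E \<subseteq> vecs ?R d" "card E = p ^ k * K" 
    "\<exists>r\<in>nonzero_squares ?R. Wcount ?R d A E r = 0"
    using ex_Wcount_eq_0_prime_field[OF p(1) \<open>odd p\<close> _ K5 K4, of k d] k by (auto simp: K_def)
  have "2 * C = ((2 * C) powr (1 / \<delta>)) powr \<delta>" using \<delta> C by (simp add: powr_powr)
  also have "\<dots> \<le> real p powr \<delta>" using pC \<delta> by (intro powr_mono2) auto
  finally have "C * real p powr \<gamma> \<le> (real p powr \<delta> / 2) * real p powr \<gamma>" by (intro mult_right_mono) auto
  also have "\<dots> = real p powr (real d / 2) / 2" by (simp add: \<delta>_def flip: powr_add)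
  also have "real p powr (real d / 2) = real p powr (real k + 1 / 2)" by (simp add: k add_divide_distrib add.commute)
  also have "\<dots> = real p ^ k * sqrt p" using p3 by (simp add: powr_add powr_realpow powr_half_sqrt)
  also have "real p ^ k * sqrt p / 2 \<le> real p ^ k * real K" using mult_left_mono[OF K2, of "real p ^ k"] by simp
  also have "\<dots> = real (card E)" using AE by simp
  finally have "C * real (card (carrier ?R)) powr \<gamma> \<le> real (card E)" by (simp add: nat_prime_field_def)
  then show ?thesis using AE odd_finite_field_nat_prime_field[OF p(1) \<open>odd p\<close>] by blast
qed

section \<open>Assembly of the six claims\<close>

lemma quadratic_formI: "odd_finite_field R \<Longrightarrow> nondeg_sym R d A \<Longrightarrow> quadratic_form R d A"
  by (simp add: quadratic_form_def quadratic_form_axioms_def odd_ff_iff)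

theorem theorem1p6:
  shows
  \<comment> \<open>(i) d even\<close>
  "(\<forall>(R::'a ring) d A E r. odd_finite_field R \<and> 2 \<le> d \<and> even d \<and> nondeg_sym R d A \<and>
       E \<subseteq> vecs R d \<and> r \<in> nonzero R \<and>
       real (card E) \<ge> 4 * real (card (carrier R)) powr (real d / 2)
     \<longrightarrow> real (Wcount R d A E r) \<ge> 5 * real (card E) ^ 4 / (48 * real (card (carrier R))))
 \<and> (\<forall>(R::'a ring) d A. odd_finite_field R \<and> 2 \<le> d \<and> even d \<and> nondeg_sym R d A
     \<longrightarrow> (\<exists>E r. E \<subseteq> vecs R d \<and> card E = card (carrier R) ^ (d div 2) \<and>
                r \<in> nonzero R \<and> Wcount R d A E r = 0))
  \<comment> \<open>(ii) d odd, non-zero square ratios\<close>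
 \<and> (\<forall>(R::'a ring) d A E r. odd_finite_field R \<and> 2 \<le> d \<and> odd d \<and> nondeg_sym R d A \<and>
       E \<subseteq> vecs R d \<and> r \<in> nonzero_squares R \<and>
       real (card E) \<ge> 3 * real (card (carrier R)) powr (real d / 2)
     \<longrightarrow> real (Wcount R d A E r) \<ge> 2 * real (card E) ^ 4 / (45 * real (card (carrier R))))
 \<and> (\<forall>d. 3 \<le> d \<and> odd d \<longrightarrow>
     \<not> (\<exists>(\<gamma>::real) (C::real). \<gamma> < real d / 2 \<and> C > 0 \<and>
          (\<forall>(R::nat ring) A E. odd_finite_field R \<and> nondeg_sym R d A \<and> E \<subseteq> vecs R d \<and>
              real (card E) \<ge> C * real (card (carrier R)) powr \<gamma>
            \<longrightarrow> (\<forall>r \<in> nonzero_squares R. Wcount R d A E r > 0))))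
  \<comment> \<open>(iii) d odd, all non-zero ratios\<close>
 \<and> (\<forall>(R::'a ring) d A E r. odd_finite_field R \<and> 2 \<le> d \<and> odd d \<and> nondeg_sym R d A \<and>
       E \<subseteq> vecs R d \<and> r \<in> nonzero R \<and>
       real (card E) \<ge> 11 / 6 * real (card (carrier R)) powr ((real d + 1) / 2)
     \<longrightarrow> real (Wcount R d A E r) \<ge> 2 * real (card E) ^ 4 / (363 * real (card (carrier R))))
 \<and> (\<forall>(R::'a ring) d A. odd_finite_field R \<and> 3 \<le> d \<and> odd d \<and> nondeg_sym R d A
     \<longrightarrow> (\<exists>E r. E \<subseteq> vecs R d \<and> card E = card (carrier R) ^ ((d + 1) div 2) \<and>
                r \<in> nonzero R \<and> Wcount R d A E r = 0))"
proof (intro conjI allI impI, goal_cases)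
  case (1 R d A E r)
  then interpret quadratic_form R d A using quadratic_formI by blast
  show ?case using 1 Wcount_even by blast
next
  case (2 R d A)
  then interpret quadratic_form R d A using quadratic_formI by blast
  have "2 * (d div 2 - 1) + 1 \<le> d" "Suc (d div 2 - 1) = d div 2" using 2 by auto
  then show ?case using ex_Wcount_eq_0[of "d div 2 - 1"] by simp
next
  case (3 R d A E r)
  then interpret quadratic_form R d A using quadratic_formI by blast
  show ?case using 3 Wcount_odd_square by blast
next
  case (4 d)
  show ?case
  proof (intro notI, elim exE conjE)
    fix \<gamma> C :: real
    assume \<gamma>: "\<gamma> < real d / 2" and C: "C > 0"
      and all: "\<forall>(R::nat ring) A E. odd_finite_field R \<and> nondeg_sym R d A \<and> E \<subseteq> vecs R d \<and>
              real (card E) \<ge> C * real (card (carrier R)) powr \<gamma>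
            \<longrightarrow> (\<forall>r \<in> nonzero_squares R. Wcount R d A E r > 0)"
    obtain R :: "nat ring" and A E r where *: "odd_finite_field R" "nondeg_sym R d A" "E \<subseteq> vecs R d"
      "real (card E) \<ge> C * real (card (carrier R)) powr \<gamma>" "r \<in> nonzero_squares R" "Wcount R d A E r = 0"
      using no_smaller_exponent[OF _ \<gamma> C] 4 by blast
    then have "Wcount R d A E r > 0" using all by blast
    then show False using * by simp
  qed
next
  case (5 R d A E r)
  then interpret quadratic_form R d A using quadratic_formI by blast
  show ?case using 5 Wcount_odd by blast
next
  case (6 R d A)
  then interpret quadratic_form R d A using quadratic_formI by blast
  have "2 * ((d + 1) div 2 - 1) + 1 \<le> d" "Suc ((d + 1) div 2 - 1) = (d + 1) div 2" using 6 by auto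
  then show ?case using ex_Wcount_eq_0[of "(d + 1) div 2 - 1"] by simp
qed

end
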